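(* Let $H$ be any fixed hypergraph with at least one edge, and for each $n$ let $\boldsymbol p=\boldsymbol p(n)=(p_1,\dots,p_n)\in(0,1)^n$. Then $\widetilde Z_H^n$ converges in distribution, as $n\to\infty$, to the standard normal distribution $\mathcal N(0,1)$ if and only if $$\min_{F\subseteq H:\,e_F\ge 1} P_F\,n^{v_F}\longrightarrow\infty$$ and, for every $e\in E(H)$, $$n^{|e|}(1-p_{|e|})+\frac{\max_{F\subseteq H:\,e_F\ge1} n^{-v_F}Q_F/P_F}{n^{-|e|}(1-p_{|e|})}\longrightarrow\infty ,$$ as $n\to\infty$.
   Context: A hypergraph $H$ consists of a finite vertex set $V(H)$ and a set $E(H)$ of non-empty subsets of $V(H)$ (edges, of arbitrary sizes; size $1$ is allowed). $v_H=|V(H)|$, $e_H=|E(H)|$, and $|e|$ is the size of the edge $e$. $F\subseteq H$ means $V(F)\subseteq V(H)$ and $E(F)\subseteq E(H)$; $\simeq$ denotes hypergraph isomorphism. $[n]=\{1,\dots,n\}$ and $K_n^*=([n],2^{[n]}\setminus\{\emptyset\})$ is the complete hypergraph on $[n]$. For $\boldsymbol p=(p_1,\dots,p_n)\in(0,1)^n$ (which may depend on $n$), the random hypergraph $\mathbb H(n,\boldsymbol p)$ has vertex set $[n]$, and each non-empty $e\subseteq[n]$ is an edge independently with probability $p_{|e|}$. $Z_H^n$ is the number of hypergraphs $H'\subseteq K_n^*$ with $H'\simeq H$ and $H'\subseteq\mathbb H(n,\boldsymbol p)$, and $\widetilde Z_H^n=(Z_H^n-\mathbf E[Z_H^n])/\sqrt{\mathrm{Var}[Z_H^n]}$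 (defined for $n\ge v_H$). For a hypergraph $F$, $P_F=\prod_{e\in E(F)}p_{|e|}$ and $Q_F=\prod_{e\in E(F)}(1-p_{|e|})$. *)

theory Defs
  imports "HOL-Probability.Central_Limit_Theorem" "HOL-Probability.Product_PMF"
begin

datatype 'a hypergraph = Hypergraph (verts: "'a set") (edges: "'a set set")

definition wf_hypergraph :: "'a hypergraph \<Rightarrow> bool" where
  "wf_hypergraph H \<longleftrightarrow> finite (verts H) \<and> edges H \<subseteq> Pow (verts H) - {{}}"

definition subhypergraph :: "'a hypergraph \<Rightarrow> 'a hypergraph \<Rightarrow> bool" where
  "subhypergraph F H \<longleftrightarrow>
     wf_hypergraph F \<and> wf_hypergraph H \<and> verts F \<subseteq> verts H \<and> edges F \<subseteq> edges H"

definition isomorphic :: "'a hypergraph \<Rightarrow> 'b hypergraph \<Rightarrow> bool" where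
  "isomorphic G H \<longleftrightarrow>
     (\<exists>f. bij_betw f (verts G) (verts H) \<and> (\<lambda>e. f ` e) ` edges G = edges H)"

definition complete_hypergraph :: "nat \<Rightarrow> nat hypergraph" where
  "complete_hypergraph n = Hypergraph {1..n} (Pow {1..n} - {{}})"

text \<open>The entry \<open>p k\<close> of a probability vector is the probability of an edge of size \<open>k\<close>;
  only the entries with \<open>1 \<le> k \<le> n\<close> are used.\<close>

definition binomial_hypergraph :: "nat \<Rightarrow> (nat \<Rightarrow> real) \<Rightarrow> nat hypergraph pmf" where
  "binomial_hypergraph n p =
     map_pmf (\<lambda>X. Hypergraph {1..n} {e \<in> edges (complete_hypergraph n). X e})
       (Pi_pmf (edges (complete_hypergraph n)) False (\<lambda>e. bernoulli_pmf (p (card e))))"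

definition copies :: "'a hypergraph \<Rightarrow> nat \<Rightarrow> nat hypergraph \<Rightarrow> nat hypergraph set" where
  "copies H n G =
     {H'. subhypergraph H' (complete_hypergraph n) \<and> isomorphic H' H \<and> subhypergraph H' G}"

definition Z :: "'a hypergraph \<Rightarrow> nat \<Rightarrow> nat hypergraph \<Rightarrow> real" where
  "Z H n G = real (card (copies H n G))"

text \<open>For \<open>n < card (verts H)\<close> the variance is \<open>0\<close>, so that \<open>Z_std\<close> is constantly \<open>0\<close>.\<close>

definition Z_std :: "'a hypergraph \<Rightarrow> nat \<Rightarrow> (nat \<Rightarrow> real) \<Rightarrow> nat hypergraph \<Rightarrow> real" where
  "Z_std H n p G =
     (Z H n G - measure_pmf.expectation (binomial_hypergraph n p) (Z H n))
       / sqrt (measure_pmf.variance (binomial_hypergraph n p) (Z H n))"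

definition P_weight :: "(nat \<Rightarrow> real) \<Rightarrow> 'a hypergraph \<Rightarrow> real" where
  "P_weight p F = (\<Prod>e\<in>edges F. p (card e))"

definition Q_weight :: "(nat \<Rightarrow> real) \<Rightarrow> 'a hypergraph \<Rightarrow> real" where
  "Q_weight p F = (\<Prod>e\<in>edges F. 1 - p (card e))"

definition nonempty_subhypergraphs :: "'a hypergraph \<Rightarrow> 'a hypergraph set" where
  "nonempty_subhypergraphs H = {F. subhypergraph F H \<and> card (edges F) \<ge> 1}"

end

theory Submission
  imports Defs
begin

text \<open>
  Write \<open>V\<close> and \<open>E\<close> for the vertices and edges of the fixed hypergraph. Up to the number of
  automorphisms, the count of copies is the number \<open>X\<close> of injections \<open>\<phi>\<close> of \<open>V\<close> into \<open>{1..n}\<close> that send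
  every edge to an edge of the random hypergraph (\<open>X_eq_Z\<close>). With \<open>xi f\<close> the centred indicator of the
  edge \<open>f\<close> and \<open>walsh S\<close> the product of the \<open>xi f\<close> over \<open>f \<in> S\<close>, expanding the indicators gives the
  orthogonal (Hoeffding) decomposition of \<open>X\<close> into the sums of \<open>walsh (\<phi> F)\<close> over \<open>\<phi>\<close>, one for every
  nonempty \<open>F \<subseteq> E\<close>. The part of \<open>F\<close> has variance of the order of
  \<open>(P_E n ^ v)\<^sup>2 psi F\<close>, where \<open>psi F = n ^ (- v_F) Q_F / P_F\<close>; hence the variance of \<open>X\<close> is comparable with
  \<open>(P_E n ^ v)\<^sup>2 M\<close>, where \<open>M\<close> is the largest \<open>psi F\<close>, and \<open>psi F / M\<close> is the share of \<open>F\<close>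
  (\<open>varX_ge\<close>, \<open>varX_le\<close>). The first condition of the theorem says that every \<open>n ^ v_F P_F\<close> is large.
  The second one says that for each edge size \<open>k\<close> either the expected number
  of missing \<open>k\<close>-edges, about \<open>n ^ k (1 - p k)\<close>, is large (the size is then called good), or single
  edges of size \<open>k\<close> have a negligible share.

  Sufficiency. If a set \<open>F\<close> of at least two edges contains an edge \<open>e\<close> of a bad size, then removing \<open>e\<close>
  gives a much larger \<open>psi\<close> (\<open>psi_remove_le\<close>), so these sets are negligible; so are the single bad edges,
  by the second condition. There remains the part \<open>G\<close> of the sets with good edges only. For a
  polynomial \<open>G\<close> in independent Bernoulli variables, an integration by parts in each coordinate shows that the
  characteristic function of \<open>G\<close> nearly solves the differential equation of a Gaussian one, with an
  error controlled by the fluctuation of a certain quadratic form in the discrete derivatives of \<open>G\<close> and by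
  their fourth moments (\<open>stein_tikhomirov\<close>, \<open>third_order_le\<close>). Both are sums of Walsh functions
  indexed by pairs of overlapping placements, so that their second moments reduce to one inequality about a pair of copies
  (\<open>labelled_second_moment_le\<close>, \<open>overlap_weight_le\<close>). This is where both
  conditions are used, and it gives \<open>clt_bound\<close>. Levy's continuity theorem finishes the argument.

  Necessity. The count is nonnegative, while the normal law charges every half-line; hence mean over standard
  deviation tends to infinity, that is, \<open>M\<close> tends to 0, and this implies the first condition
  (\<open>M_small_of_lower_tail\<close>, \<open>dense_of_M_small\<close>). Suppose that the second condition fails for the
  size \<open>k\<close>. The standardised count is, up to a small error, \<open>A + G\<close>, where \<open>A\<close> is a linear combination of the
  \<open>xi f\<close> over edges \<open>f\<close> of bad sizes and \<open>G\<close> is nearly Gaussian and independent of \<open>A\<close> in the limit. The modulus of the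
  characteristic function of \<open>A\<close> is a product of explicit factors
  and is never much smaller than that of a Gaussian of the same variance; the \<open>k\<close>-edges make it larger by a
  fixed factor, because their coefficients are bounded away from 0 and they carry a positive share of the
  variance (\<open>bad_char_ge\<close>). So the characteristic function of the count
  cannot converge to that of the normal law at the point 1.
\<close>

section \<open>Independent Bernoulli variables and their Walsh expansion\<close>

locale bernoulli_product =
  fixes U :: "'e set" and r :: "'e \<Rightarrow> real"
  assumes finite_U: "finite U" and r_bounds: "\<And>e. e \<in> U \<Longrightarrow> 0 \<le> r e \<and> r e \<le> 1"
begin

definition space_pmf :: "('e \<Rightarrow> bool) pmf" where
  "space_pmf = Pi_pmf U False (\<lambda>e. bernoulli_pmf (r e))"

abbreviation Ex :: "(('e \<Rightarrow> bool) \<Rightarrow> 'b::{banach,second_countable_topology}) \<Rightarrow> 'b" where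
  "Ex f \<equiv> measure_pmf.expectation space_pmf f"

definition xi :: "'e \<Rightarrow> ('e \<Rightarrow> bool) \<Rightarrow> real" where
  "xi e w = of_bool (w e) - r e"

definition walsh :: "'e set \<Rightarrow> ('e \<Rightarrow> bool) \<Rightarrow> real" where
  "walsh S w = (\<Prod>e\<in>S. xi e w)"

definition var1 :: "'e \<Rightarrow> real" where
  "var1 e = r e * (1 - r e)"

definition diff_at :: "'e \<Rightarrow> (('e \<Rightarrow> bool) \<Rightarrow> 'b::real_normed_vector) \<Rightarrow> ('e \<Rightarrow> bool) \<Rightarrow> 'b" where
  "diff_at e h w = h (w(e := True)) - h (w(e := False))"

lemma finite_set_space: "finite (set_pmf space_pmf)"
proof -
  have "set_pmf space_pmf \<subseteq> {f. \<forall>x. x \<notin> U \<longrightarrow> f x = False}"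
    unfolding space_pmf_def by (rule set_Pi_pmf_subset[OF finite_U])
  also have "\<dots> \<subseteq> (\<lambda>S x. x \<in> S) ` Pow U"
  proof
    fix f assume "f \<in> {f. \<forall>x. x \<notin> U \<longrightarrow> f x = False}"
    then have "f = (\<lambda>x. x \<in> {x. f x})" "{x. f x} \<in> Pow U" by auto
    then show "f \<in> (\<lambda>S x. x \<in> S) ` Pow U" by blast
  qed
  finally show ?thesis using finite_U finite_surj by (metis finite_Pow_iff finite_subset finite_imageI)
qed

lemma integrable_Ex [simp, intro]:
  fixes f :: "('e \<Rightarrow> bool) \<Rightarrow> 'b::{banach,second_countable_topology}"
  shows "integrable (measure_pmf space_pmf) f"
  by (rule integrable_measure_pmf_finite[OF finite_set_space])

lemma Ex_mono: "(\<And>w. f w \<le> g w) \<Longrightarrow> Ex f \<le> (Ex g :: real)"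
  by (rule integral_mono) auto

lemma Ex_const [simp]: "Ex (\<lambda>_. c) = c"
  by (simp add: measure_pmf.prob_space)

lemma Ex_split:
  fixes h :: "('e \<Rightarrow> bool) \<Rightarrow> 'b::{banach,second_countable_topology}"
  assumes "e \<in> U"
  shows "Ex h = r e *\<^sub>R Ex (\<lambda>w. h (w(e := True))) + (1 - r e) *\<^sub>R Ex (\<lambda>w. h (w(e := False)))"
proof -
  define V where "V = U - {e}"
  have U: "U = insert e V" "e \<notin> V" "finite V" using assms finite_U by (auto simp: V_def)
  let ?P = "Pi_pmf V False (\<lambda>e. bernoulli_pmf (r e))"
  interpret V: bernoulli_product V r by unfold_locales (use U r_bounds in auto)
  have finP: "finite (set_pmf ?P)" using V.finite_set_space unfolding V.space_pmf_def .
  have rb: "0 \<le> r e" "r e \<le> 1" using r_bounds assms by auto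
  have sp: "space_pmf = bernoulli_pmf (r e) \<bind> (\<lambda>y. map_pmf (\<lambda>f. f(e := y)) ?P)"
    using Pi_pmf_insert'[OF U(3,2), of False "\<lambda>e. bernoulli_pmf (r e)"]
    unfolding space_pmf_def U(1)[symmetric] by (simp add: map_pmf_def)
  have split: "Ex g = r e *\<^sub>R measure_pmf.expectation ?P (\<lambda>f. g (f(e := True)))
      + (1 - r e) *\<^sub>R measure_pmf.expectation ?P (\<lambda>f. g (f(e := False)))"
    for g :: "('e \<Rightarrow> bool) \<Rightarrow> 'b"
  proof -
    have "Ex g = (\<Sum>a\<in>UNIV. pmf (bernoulli_pmf (r e)) a *\<^sub>R
        measure_pmf.expectation (map_pmf (\<lambda>f. f(e := a)) ?P) g)"
      unfolding sp by (rule pmf_expectation_bind) (use finP in auto)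
    then show ?thesis using rb by (simp add: UNIV_bool)
  qed
  have "Ex (\<lambda>w. h (w(e := b))) = measure_pmf.expectation ?P (\<lambda>f. h (f(e := b)))" for b
    by (subst split) (simp flip: scaleR_add_left)
  then show ?thesis by (subst split) simp
qed

lemma xi_upd: "xi f (w(e := b)) = (if f = e then of_bool b - r e else xi f w)"
  by (simp add: xi_def)

lemma walsh_upd: "e \<notin> S \<Longrightarrow> walsh S (w(e := b)) = walsh S w"
  unfolding walsh_def by (rule prod.cong) (auto simp: xi_upd)

lemma walsh_insert: "finite S \<Longrightarrow> e \<notin> S \<Longrightarrow> walsh (insert e S) w = xi e w * walsh S w"
  by (simp add: walsh_def)

lemma walsh_remove: "finite S \<Longrightarrow> e \<in> S \<Longrightarrow> walsh S w = xi e w * walsh (S - {e}) w"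
  by (simp add: walsh_def prod.remove)

lemma walsh_empty [simp]: "walsh {} w = 1"
  by (simp add: walsh_def)

text \<open>Integration by parts: the two values of \<open>xi e\<close>, weighted by their probabilities, are
  \<open>r e * (1 - r e)\<close> and its negative.\<close>

lemma Ex_xi_mult:
  fixes h :: "('e \<Rightarrow> bool) \<Rightarrow> 'b::{banach,second_countable_topology}"
  assumes "e \<in> U"
  shows "Ex (\<lambda>w. xi e w *\<^sub>R h w) = var1 e *\<^sub>R Ex (diff_at e h)"
proof -
  have "Ex (\<lambda>w. xi e w *\<^sub>R h w) = r e *\<^sub>R ((1 - r e) *\<^sub>R Ex (\<lambda>w. h (w(e := True))))
      + (1 - r e) *\<^sub>R ((- r e) *\<^sub>R Ex (\<lambda>w. h (w(e := False))))"
    by (subst Ex_split[OF assms]) (simp add: xi_upd)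
  also have "\<dots> = var1 e *\<^sub>R (Ex (\<lambda>w. h (w(e := True))) - Ex (\<lambda>w. h (w(e := False))))"
    by (simp add: var1_def algebra_simps)
  also have "\<dots> = var1 e *\<^sub>R Ex (diff_at e h)"
    unfolding diff_at_def by (subst Bochner_Integration.integral_diff) auto
  finally show ?thesis .
qed

lemma Ex_prod:
  fixes g :: "'e \<Rightarrow> bool \<Rightarrow> 'b::{real_normed_field,banach,second_countable_topology}"
  assumes "B \<subseteq> U"
  shows "Ex (\<lambda>w. \<Prod>e\<in>B. g e (w e)) = (\<Prod>e\<in>B. r e *\<^sub>R g e True + (1 - r e) *\<^sub>R g e False)"
proof -
  have "finite B" using assms finite_U finite_subset by blast
  then show ?thesis using assms
  proof (induction B)
    case empty then show ?case by simp
  next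
    case (insert e B)
    have upd: "(\<Prod>f\<in>B. g f ((w(e := b)) f)) = (\<Prod>f\<in>B. g f (w f))" for w b
      by (rule prod.cong) (use insert in auto)
    have ins: "(\<Prod>f\<in>insert e B. g f ((w(e := b)) f)) = g e b * (\<Prod>f\<in>B. g f (w f))" for w b
      using insert.hyps by (subst prod.insert) (simp_all only: upd fun_upd_same not_False_eq_True)
    have "Ex (\<lambda>w. \<Prod>f\<in>insert e B. g f (w f)) =
       r e *\<^sub>R Ex (\<lambda>w. g e True * (\<Prod>f\<in>B. g f (w f))) + (1 - r e) *\<^sub>R Ex (\<lambda>w. g e False * (\<Prod>f\<in>B. g f (w f)))"
      using insert.prems by (subst Ex_split[of e]) (simp_all only: ins insert_subset)
    also have "\<dots> = (r e *\<^sub>R g e True + (1 - r e) *\<^sub>R g e False) * Ex (\<lambda>w. \<Prod>f\<in>B. g f (w f))"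
      by (simp add: algebra_simps)
    finally show ?case using insert by simp
  qed
qed

lemma Ex_walsh_mult:
  assumes "S \<subseteq> U" "T \<subseteq> U"
  shows "Ex (\<lambda>w. walsh S w * walsh T w) = (if S = T then (\<Prod>e\<in>S. var1 e) else 0)"
proof -
  have fin: "finite S" "finite T" using assms finite_U finite_subset by blast+
  define g :: "'e \<Rightarrow> bool \<Rightarrow> real" where
    "g e b = (if e \<in> S then of_bool b - r e else 1) * (if e \<in> T then of_bool b - r e else 1)" for e b
  have "walsh S w * walsh T w = (\<Prod>e\<in>S\<union>T. g e (w e))" for w
  proof -
    have "walsh S w = (\<Prod>e\<in>S\<union>T. if e \<in> S then of_bool (w e) - r e else 1)"
      unfolding walsh_def xi_def by (rule prod.mono_neutral_cong_left) (use fin in auto)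
    moreover have "walsh T w = (\<Prod>e\<in>S\<union>T. if e \<in> T then of_bool (w e) - r e else 1)"
      unfolding walsh_def xi_def by (rule prod.mono_neutral_cong_left) (use fin in auto)
    ultimately show ?thesis by (simp add: g_def prod.distrib)
  qed
  then have "Ex (\<lambda>w. walsh S w * walsh T w) = (\<Prod>e\<in>S\<union>T. r e *\<^sub>R g e True + (1 - r e) *\<^sub>R g e False)"
    using assms by (simp add: Ex_prod)
  also have "\<dots> = (\<Prod>e\<in>S\<union>T. if e \<in> S \<inter> T then var1 e else 0)"
    by (rule prod.cong) (auto simp: g_def var1_def algebra_simps)
  also have "\<dots> = (if S = T then (\<Prod>e\<in>S. var1 e) else 0)"
  proof (cases "S = T")
    case False
    then obtain e where "e \<in> S \<union> T" "e \<notin> S \<inter> T" by blast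
    then show ?thesis using fin False by (auto intro!: prod_zero)
  qed auto
  finally show ?thesis .
qed

lemma Ex_walsh: "S \<subseteq> U \<Longrightarrow> S \<noteq> {} \<Longrightarrow> Ex (walsh S) = 0"
  using Ex_walsh_mult[of S "{}"] by simp

lemma xi_squared: "(xi e w)\<^sup>2 = (1 - 2 * r e) * xi e w + var1 e"
  by (cases "w e") (simp_all add: xi_def var1_def power2_eq_square algebra_simps)

text \<open>Since \<open>xi e\<close> satisfies a quadratic equation, the product of two Walsh functions is again a
  combination of Walsh functions: for each common coordinate one chooses between the linear term (the
  coordinates in \<open>A\<close>) and the constant term.\<close>

lemma walsh_mult:
  assumes "finite S" "finite T"
  shows "walsh S w * walsh T w = (\<Sum>A\<in>Pow (S \<inter> T).
    (\<Prod>e\<in>A. 1 - 2 * r e) * (\<Prod>e\<in>S \<inter> T - A. var1 e) * walsh ((S - T) \<union> (T - S) \<union> A) w)"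
proof -
  let ?D = "S \<inter> T"
  have fin: "finite ?D" "finite (S - T)" "finite (T - S)" using assms by auto
  have S: "walsh S w = walsh (S - T) w * walsh ?D w"
    unfolding walsh_def using assms(1)
    by (subst prod.union_disjoint[symmetric]) (auto intro!: prod.cong)
  have T: "walsh T w = walsh (T - S) w * walsh ?D w"
    unfolding walsh_def using assms
    by (subst prod.union_disjoint[symmetric]) (auto intro!: prod.cong)
  have D: "walsh ?D w * walsh ?D w = (\<Prod>e\<in>?D. (1 - 2 * r e) * xi e w + var1 e)"
    unfolding walsh_def prod.distrib[symmetric]
    by (rule prod.cong) (simp_all add: xi_squared[symmetric] power2_eq_square)
  also have "\<dots> = (\<Sum>A\<in>Pow ?D. (\<Prod>e\<in>A. (1 - 2 * r e) * xi e w) * (\<Prod>e\<in>?D-A. var1 e))"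
    by (rule prod_add[OF fin(1)])
  finally have "walsh S w * walsh T w = walsh (S - T) w * walsh (T - S) w * \<dots>"
    unfolding S T by (simp add: algebra_simps)
  also have "\<dots> = (\<Sum>A\<in>Pow ?D. walsh (S - T) w * walsh (T - S) w *
      ((\<Prod>e\<in>A. (1 - 2 * r e) * xi e w) * (\<Prod>e\<in>?D-A. var1 e)))"
    by (rule sum_distrib_left)
  also have "\<dots> = (\<Sum>A\<in>Pow ?D.
    (\<Prod>e\<in>A. 1 - 2 * r e) * (\<Prod>e\<in>?D - A. var1 e) * walsh ((S - T) \<union> (T - S) \<union> A) w)"
  proof (rule sum.cong[OF refl])
    fix A assume "A \<in> Pow ?D"
    then have A: "A \<subseteq> ?D" by simp
    then have finA: "finite A" using fin(1) by (rule finite_subset)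
    have "walsh ((S - T) \<union> (T - S) \<union> A) w = walsh (S - T) w * walsh (T - S) w * walsh A w"
      unfolding walsh_def using fin A finA
      by (subst prod.union_disjoint; (subst prod.union_disjoint)?) auto
    then show "walsh (S - T) w * walsh (T - S) w *
      ((\<Prod>e\<in>A. (1 - 2 * r e) * xi e w) * (\<Prod>e\<in>?D-A. var1 e)) =
      (\<Prod>e\<in>A. 1 - 2 * r e) * (\<Prod>e\<in>?D - A. var1 e) * walsh ((S - T) \<union> (T - S) \<union> A) w"
      by (simp add: prod.distrib walsh_def[of A])
  qed
  finally show ?thesis .
qed

lemma var1_nonneg: "e \<in> U \<Longrightarrow> 0 \<le> var1 e"
  using r_bounds by (simp add: var1_def)

lemma Ex_Cauchy_Schwarz: "(Ex (\<lambda>w. f w * g w))\<^sup>2 \<le> Ex (\<lambda>w. (f w)\<^sup>2) * (Ex (\<lambda>w. (g w)\<^sup>2) :: real)"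
proof -
  let ?A = "Ex (\<lambda>w. (f w)\<^sup>2)" and ?B = "Ex (\<lambda>w. f w * g w)" and ?C = "Ex (\<lambda>w. (g w)\<^sup>2)"
  have q: "0 \<le> s\<^sup>2 * ?A - 2 * s * u * ?B + u\<^sup>2 * ?C" for s u
  proof -
    have "0 \<le> Ex (\<lambda>w. (s * f w - u * g w)\<^sup>2)" by (rule Bochner_Integration.integral_nonneg) auto
    also have "\<dots> = Ex (\<lambda>w. s\<^sup>2 * (f w)\<^sup>2 - 2 * s * u * (f w * g w) + u\<^sup>2 * (g w)\<^sup>2)"
      by (simp add: power2_eq_square algebra_simps)
    also have "\<dots> = s\<^sup>2 * ?A - 2 * s * u * ?B + u\<^sup>2 * ?C" by simp
    finally show ?thesis .
  qed
  have C0: "0 \<le> ?C" by (rule Bochner_Integration.integral_nonneg) auto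
  show ?thesis
  proof (cases "?C = 0")
    case True
    have "?B = 0"
    proof (rule ccontr)
      assume "?B \<noteq> 0"
      have "0 \<le> 1 * ?A - 2 * 1 * ((?A + 1) / (2 * ?B)) * ?B"
        using q[of 1 "(?A + 1) / (2 * ?B)"] True by simp
      then show False using \<open>?B \<noteq> 0\<close> by (simp add: field_simps)
    qed
    then show ?thesis using True by simp
  next
    case False
    then have "0 < ?C" using C0 by linarith
    have "0 \<le> ?C * (?C * ?A - ?B\<^sup>2)"
      using q[of ?C ?B] by (simp add: power2_eq_square algebra_simps)
    then show ?thesis using \<open>0 < ?C\<close> by (simp add: zero_le_mult_iff mult.commute)
  qed
qed

lemma Ex_abs_le: "Ex (\<lambda>w. \<bar>f w\<bar>) \<le> sqrt (Ex (\<lambda>w. (f w :: real)\<^sup>2))"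
proof -
  have "(Ex (\<lambda>w. \<bar>f w\<bar> * 1))\<^sup>2 \<le> Ex (\<lambda>w. (\<bar>f w\<bar>)\<^sup>2) * Ex (\<lambda>w. 1\<^sup>2)"
    by (rule Ex_Cauchy_Schwarz)
  then show ?thesis by (intro real_le_rsqrt) simp
qed

end

section \<open>A Stein--Tikhomirov estimate for Walsh polynomials\<close>

text \<open>Several indices may carry the same set. This allows one to index by placements and to postpone all
  counting of placements with the same image.\<close>

locale walsh_polynomial = bernoulli_product U r for U :: "'e set" and r +
  fixes I :: "'i set" and a :: "'i \<Rightarrow> real" and S :: "'i \<Rightarrow> 'e set"
  assumes finite_I: "finite I" and S_sub: "\<And>i. i \<in> I \<Longrightarrow> S i \<subseteq> U" and S_ne: "\<And>i. i \<in> I \<Longrightarrow> S i \<noteq> {}"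
begin

definition G :: "('e \<Rightarrow> bool) \<Rightarrow> real" where
  "G w = (\<Sum>i\<in>I. a i * walsh (S i) w)"

definition D :: "'e \<Rightarrow> ('e \<Rightarrow> bool) \<Rightarrow> real" where
  "D e w = (\<Sum>i\<in>{i\<in>I. e \<in> S i}. a i * walsh (S i - {e}) w)"

text \<open>The derivative of \<open>L\<^sup>-\<^sup>1 G\<close>, where \<open>L\<close> is the number operator, which multiplies \<open>walsh S\<close> by \<open>card S\<close>.\<close>

definition Y :: "'e \<Rightarrow> ('e \<Rightarrow> bool) \<Rightarrow> real" where
  "Y e w = (\<Sum>i\<in>{i\<in>I. e \<in> S i}. a i / real (card (S i)) * walsh (S i - {e}) w)"

text \<open>The carre du champ of \<open>G\<close> and \<open>L\<^sup>-\<^sup>1 G\<close>: its mean is the second moment of \<open>G\<close>, and \<open>G\<close> is close to a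
  Gaussian when it is nearly constant and the error of the chain rule is small.\<close>

definition Gam :: "('e \<Rightarrow> bool) \<Rightarrow> real" where
  "Gam w = (\<Sum>e\<in>U. var1 e * (Y e w * D e w))"

lemma finite_S: "i \<in> I \<Longrightarrow> finite (S i)"
  using S_sub finite_U finite_subset by blast

lemma Y_upd: "Y e (w(e := b)) = Y e w"
  by (simp add: Y_def walsh_upd)

lemma G_eq_sum: "G w = (\<Sum>e\<in>U. xi e w * Y e w)"
proof -
  have "G w = (\<Sum>i\<in>I. \<Sum>e\<in>S i. a i / real (card (S i)) * (xi e w * walsh (S i - {e}) w))"
    unfolding G_def
  proof (rule sum.cong[OF refl])
    fix i assume i: "i \<in> I"
    have "(\<Sum>e\<in>S i. a i / real (card (S i)) * (xi e w * walsh (S i - {e}) w)) =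
        (\<Sum>e\<in>S i. a i / real (card (S i)) * walsh (S i) w)"
      using finite_S[OF i] by (intro sum.cong) (simp_all add: walsh_remove)
    also have "\<dots> = a i * walsh (S i) w" using finite_S[OF i] S_ne[OF i] by simp
    finally show "a i * walsh (S i) w = (\<Sum>e\<in>S i. a i / real (card (S i)) * (xi e w * walsh (S i - {e}) w))" by simp
  qed
  also have "\<dots> = (\<Sum>i\<in>I. \<Sum>e\<in>{e\<in>U. e \<in> S i}. a i / real (card (S i)) * (xi e w * walsh (S i - {e}) w))"
    using S_sub by (intro sum.cong) auto
  also have "\<dots> = (\<Sum>e\<in>U. \<Sum>i\<in>{i\<in>I. e \<in> S i}. a i / real (card (S i)) * (xi e w * walsh (S i - {e}) w))"
    by (rule sum.swap_restrict[OF finite_I finite_U])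
  also have "\<dots> = (\<Sum>e\<in>U. xi e w * Y e w)"
    by (intro sum.cong refl) (simp add: Y_def sum_distrib_left algebra_simps)
  finally show ?thesis .
qed

lemma walsh_diff: "finite T \<Longrightarrow> walsh T (w(e := True)) - walsh T (w(e := False)) =
    (if e \<in> T then walsh (T - {e}) w else 0)"
  by (auto simp: walsh_remove[of T e] xi_upd walsh_upd algebra_simps)

lemma diff_at_G: "diff_at e G w = D e w"
proof -
  have "diff_at e G w = (\<Sum>i\<in>I. a i * (walsh (S i) (w(e := True)) - walsh (S i) (w(e := False))))"
    by (simp add: diff_at_def G_def sum_subtractf right_diff_distrib)
  also have "\<dots> = (\<Sum>i\<in>I. if e \<in> S i then a i * walsh (S i - {e}) w else 0)"
    by (rule sum.cong) (auto simp: walsh_diff finite_S)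
  also have "\<dots> = D e w"
    unfolding D_def using finite_I by (simp add: sum.inter_filter)
  finally show ?thesis .
qed

text \<open>Writing \<open>G = \<Sum>e. xi e * Y e\<close>, where \<open>Y e\<close> does not depend on the coordinate \<open>e\<close>, one integrates by parts in
  each coordinate.\<close>

lemma Ex_G_mult:
  fixes f :: "('e \<Rightarrow> bool) \<Rightarrow> 'b::{banach,second_countable_topology}"
  shows "Ex (\<lambda>w. G w *\<^sub>R f w) = (\<Sum>e\<in>U. var1 e *\<^sub>R Ex (\<lambda>w. Y e w *\<^sub>R diff_at e f w))"
proof -
  have "Ex (\<lambda>w. G w *\<^sub>R f w) = Ex (\<lambda>w. \<Sum>e\<in>U. xi e w *\<^sub>R (Y e w *\<^sub>R f w))"
    by (simp add: G_eq_sum scaleR_sum_left)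
  also have "\<dots> = (\<Sum>e\<in>U. Ex (\<lambda>w. xi e w *\<^sub>R (Y e w *\<^sub>R f w)))"
    by (rule Bochner_Integration.integral_sum) auto
  also have "\<dots> = (\<Sum>e\<in>U. var1 e *\<^sub>R Ex (diff_at e (\<lambda>w. Y e w *\<^sub>R f w)))"
    by (intro sum.cong refl Ex_xi_mult)
  also have "\<dots> = (\<Sum>e\<in>U. var1 e *\<^sub>R Ex (\<lambda>w. Y e w *\<^sub>R diff_at e f w))"
  proof -
    have "diff_at e (\<lambda>w. Y e w *\<^sub>R f w) = (\<lambda>w. Y e w *\<^sub>R diff_at e f w)" for e
      by (simp add: fun_eq_iff diff_at_def Y_upd scaleR_diff_right)
    then show ?thesis by simp
  qed
  finally show ?thesis .
qed

lemma Ex_G_squared: "Ex (\<lambda>w. (G w)\<^sup>2) = Ex Gam"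
proof -
  have "Ex (\<lambda>w. G w *\<^sub>R G w) = (\<Sum>e\<in>U. var1 e *\<^sub>R Ex (\<lambda>w. Y e w *\<^sub>R diff_at e G w))"
    by (rule Ex_G_mult)
  also have "\<dots> = Ex Gam"
    unfolding Gam_def by (subst Bochner_Integration.integral_sum) (auto simp: diff_at_G)
  finally show ?thesis by (simp add: power2_eq_square)
qed

text \<open>The outcome lies on one of the two sides of the discrete derivative; a Taylor expansion of order two around it gives
  the chain rule with a quadratic error.\<close>

lemma diff_at_iexp:
  "cmod (diff_at e (\<lambda>w. iexp (s * G w)) w - \<i> * of_real (s * D e w) * iexp (s * G w)) \<le> (s * D e w)\<^sup>2 / 2"
proof -
  have taylor: "cmod (iexp x - 1 - \<i> * of_real x) \<le> x\<^sup>2 / 2" for x :: real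
    using iexp_approx1[of x 1] by (simp add: diff_diff_eq numeral_2_eq_2)
  have Gd: "G (w(e := True)) - G (w(e := False)) = D e w"
    using diff_at_G[of e w] by (simp add: diff_at_def)
  show ?thesis
  proof (cases "w e")
    case True
    then have w: "w(e := True) = w" by (intro fun_upd_idem) simp
    then have Gf: "G (w(e := False)) = G w - D e w" using Gd by simp
    have "iexp (s * (G w - D e w)) = iexp (s * G w) * iexp (- (s * D e w))"
      by (simp add: exp_add[symmetric] algebra_simps)
    then have "diff_at e (\<lambda>w. iexp (s * G w)) w - \<i> * of_real (s * D e w) * iexp (s * G w) =
        - (iexp (s * G w) * (iexp (- (s * D e w)) - 1 - \<i> * of_real (- (s * D e w))))"
      unfolding diff_at_def w Gf by (simp add: algebra_simps)
    then show ?thesis using taylor[of "- (s * D e w)"]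
      by (simp only: norm_minus_cancel norm_mult norm_exp_i_times mult_1_left power2_minus)
  next
    case False
    then have w: "w(e := False) = w" by (intro fun_upd_idem) simp
    then have Gf: "G (w(e := True)) = G w + D e w" using Gd by simp
    have "iexp (s * (G w + D e w)) = iexp (s * G w) * iexp (s * D e w)"
      by (simp add: exp_add[symmetric] algebra_simps)
    then have "diff_at e (\<lambda>w. iexp (s * G w)) w - \<i> * of_real (s * D e w) * iexp (s * G w) =
        iexp (s * G w) * (iexp (s * D e w) - 1 - \<i> * of_real (s * D e w))"
      unfolding diff_at_def w Gf by (simp add: algebra_simps)
    then show ?thesis using taylor[of "s * D e w"]
      by (simp only: norm_mult norm_exp_i_times mult_1_left)
  qed
qed

lemma Ex_eq_sum:
  fixes f :: "('e \<Rightarrow> bool) \<Rightarrow> 'b::{banach,second_countable_topology}"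
  shows "Ex f = (\<Sum>w\<in>set_pmf space_pmf. pmf space_pmf w *\<^sub>R f w)"
  by (rule integral_measure_pmf[OF finite_set_space]) auto

definition third_order :: real where
  "third_order = (\<Sum>e\<in>U. var1 e * Ex (\<lambda>w. \<bar>Y e w\<bar> * (D e w)\<^sup>2))"

text \<open>The factor \<open>h\<close> may depend on coordinates that do not occur in \<open>G\<close>. It passes through all
  derivatives, so that the estimate also covers the joint law of \<open>G\<close> and of a function of
  the other coordinates.\<close>

lemma Ex_G_iexp:
  fixes h :: "('e \<Rightarrow> bool) \<Rightarrow> complex"
  assumes h1: "\<And>w. cmod (h w) \<le> 1"
    and h_upd: "\<And>i e w b. i \<in> I \<Longrightarrow> e \<in> S i \<Longrightarrow> h (w(e := b)) = h w"
  shows "cmod (Ex (\<lambda>w. G w *\<^sub>R (h w * iexp (s * G w))) - \<i> * of_real s * Ex (\<lambda>w. h w * iexp (s * G w) * of_real (Gam w)))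
    \<le> s\<^sup>2 / 2 * third_order"
proof -
  let ?f = "\<lambda>w. h w * iexp (s * G w)"
  let ?err = "\<lambda>e w. Y e w *\<^sub>R (diff_at e ?f w - \<i> * of_real (s * D e w) * ?f w)"
  have "(\<Sum>e\<in>U. var1 e *\<^sub>R Ex (\<lambda>w. Y e w *\<^sub>R (\<i> * of_real (s * D e w) * ?f w))) =
      Ex (\<lambda>w. \<Sum>e\<in>U. var1 e *\<^sub>R (Y e w *\<^sub>R (\<i> * of_real (s * D e w) * ?f w)))"
    by (subst Bochner_Integration.integral_sum) (simp, simp only: integral_scaleR_right integrable_Ex)
  also have "\<dots> = Ex (\<lambda>w. \<i> * of_real s * (?f w * of_real (Gam w)))"
    by (intro Bochner_Integration.integral_cong refl)
      (simp add: Gam_def sum_distrib_left scaleR_conv_of_real algebra_simps)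
  also have "\<dots> = \<i> * of_real s * Ex (\<lambda>w. ?f w * of_real (Gam w))" by simp
  finally have main: "\<i> * of_real s * Ex (\<lambda>w. ?f w * of_real (Gam w)) =
     (\<Sum>e\<in>U. var1 e *\<^sub>R Ex (\<lambda>w. Y e w *\<^sub>R (\<i> * of_real (s * D e w) * ?f w)))" by simp
  have "Ex (\<lambda>w. G w *\<^sub>R ?f w) - \<i> * of_real s * Ex (\<lambda>w. ?f w * of_real (Gam w)) =
      (\<Sum>e\<in>U. var1 e *\<^sub>R Ex (?err e))"
    unfolding Ex_G_mult main
    by (subst sum_subtractf[symmetric]) (simp add: scaleR_diff_right)
  then have "cmod (Ex (\<lambda>w. G w *\<^sub>R ?f w) - \<i> * of_real s * Ex (\<lambda>w. ?f w * of_real (Gam w))) =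
      cmod (\<Sum>e\<in>U. var1 e *\<^sub>R Ex (?err e))" by (rule arg_cong)
  also have "\<dots> \<le> (\<Sum>e\<in>U. var1 e * (s\<^sup>2 / 2 * Ex (\<lambda>w. \<bar>Y e w\<bar> * (D e w)\<^sup>2)))"
  proof (rule sum_norm_le)
    fix e assume e: "e \<in> U"
    have "cmod (?err e w) \<le> \<bar>Y e w\<bar> * ((s * D e w)\<^sup>2 / 2)" for w
    proof (cases "\<exists>i\<in>I. e \<in> S i")
      case False
      then have "Y e w = 0" by (auto simp: Y_def intro!: sum.neutral)
      then show ?thesis by simp
    next
      case True
      then have hu: "h (w(e := b)) = h w" for w b using h_upd by blast
      have "diff_at e ?f w - \<i> * of_real (s * D e w) * ?f w =
         h w * (diff_at e (\<lambda>w. iexp (s * G w)) w - \<i> * of_real (s * D e w) * iexp (s * G w))"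
        by (simp add: diff_at_def hu algebra_simps)
      then have eq: "cmod (diff_at e ?f w - \<i> * of_real (s * D e w) * ?f w) =
          cmod (h w) * cmod (diff_at e (\<lambda>w. iexp (s * G w)) w - \<i> * of_real (s * D e w) * iexp (s * G w))"
        by (rule ssubst) (rule norm_mult)
      have "cmod (h w) * cmod (diff_at e (\<lambda>w. iexp (s * G w)) w - \<i> * of_real (s * D e w) * iexp (s * G w))
          \<le> 1 * ((s * D e w)\<^sup>2 / 2)"
        by (rule mult_mono[OF h1 diff_at_iexp]) simp_all
      then have "cmod (diff_at e ?f w - \<i> * of_real (s * D e w) * ?f w) \<le> (s * D e w)\<^sup>2 / 2"
        unfolding eq mult_1_left .
      then show ?thesis unfolding norm_scaleR by (intro mult_left_mono) auto
    qed
    then have "Ex (\<lambda>w. cmod (?err e w)) \<le> Ex (\<lambda>w. \<bar>Y e w\<bar> * ((s * D e w)\<^sup>2 / 2))"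
      by (rule Ex_mono)
    then have "cmod (Ex (?err e)) \<le> Ex (\<lambda>w. \<bar>Y e w\<bar> * ((s * D e w)\<^sup>2 / 2))"
      by (rule order_trans[OF integral_norm_bound])
    also have "\<dots> = Ex (\<lambda>w. s\<^sup>2 / 2 * (\<bar>Y e w\<bar> * (D e w)\<^sup>2))"
      by (simp add: power_mult_distrib algebra_simps)
    also have "\<dots> = s\<^sup>2 / 2 * Ex (\<lambda>w. \<bar>Y e w\<bar> * (D e w)\<^sup>2)" by simp
    finally have "cmod (Ex (?err e)) \<le> s\<^sup>2 / 2 * Ex (\<lambda>w. \<bar>Y e w\<bar> * (D e w)\<^sup>2)" .
    then show "cmod (var1 e *\<^sub>R Ex (?err e)) \<le> var1 e * (s\<^sup>2 / 2 * Ex (\<lambda>w. \<bar>Y e w\<bar> * (D e w)\<^sup>2))"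
      unfolding norm_scaleR abs_of_nonneg[OF var1_nonneg[OF e]]
      using var1_nonneg[OF e] by (rule mult_left_mono)
  qed
  also have "\<dots> = s\<^sup>2 / 2 * third_order"
    unfolding third_order_def sum_distrib_left by (intro sum.cong refl mult.left_commute)
  finally show ?thesis .
qed

text \<open>The function \<open>\<psi> u = Ex (h * iexp (u * G))\<close> satisfies \<open>\<psi>' u = - u * v * \<psi> u\<close> up to the fluctuation of
  \<open>Gam\<close> around its mean \<open>v\<close> and the error of the chain rule. The exact equation has the solution
  \<open>\<psi> 0 * exp (- v * u\<^sup>2 / 2)\<close>.\<close>

lemma stein_tikhomirov:
  fixes h :: "('e \<Rightarrow> bool) \<Rightarrow> complex" and t :: real
  assumes h1: "\<And>w. cmod (h w) \<le> 1"
    and h_upd: "\<And>i e w b. i \<in> I \<Longrightarrow> e \<in> S i \<Longrightarrow> h (w(e := b)) = h w"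
  defines "v \<equiv> Ex (\<lambda>w. (G w)\<^sup>2)"
  shows "cmod (Ex (\<lambda>w. h w * iexp (t * G w)) - Ex h * of_real (exp (- (v * t\<^sup>2 / 2))))
    \<le> t\<^sup>2 * sqrt (Ex (\<lambda>w. (Gam w - v)\<^sup>2)) + \<bar>t\<bar> ^ 3 / 2 * third_order"
proof -
  define \<psi> where "\<psi> u = Ex (\<lambda>w. h w * iexp (u * G w))" for u :: real
  define \<psi>' where "\<psi>' u = \<i> * Ex (\<lambda>w. G w *\<^sub>R (h w * iexp (u * G w)))" for u :: real
  define \<delta> where "\<delta> = sqrt (Ex (\<lambda>w. (Gam w - v)\<^sup>2))"
  have \<delta>0: "0 \<le> \<delta>" unfolding \<delta>_def by (intro real_sqrt_ge_zero Bochner_Integration.integral_nonneg) auto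
  have third0: "0 \<le> third_order" unfolding third_order_def
    by (intro sum_nonneg mult_nonneg_nonneg var1_nonneg Bochner_Integration.integral_nonneg) auto
  have v0: "0 \<le> v" unfolding v_def by (rule Bochner_Integration.integral_nonneg) auto
  have der: "(\<psi> has_vector_derivative \<psi>' u) (at u)" for u
  proof -
    have one: "((\<lambda>u. pmf space_pmf w *\<^sub>R (h w * iexp (u * G w))) has_vector_derivative
        pmf space_pmf w *\<^sub>R (\<i> * (G w *\<^sub>R (h w * iexp (u * G w))))) (at u)" for w
      by (rule has_vector_derivative_real_field derivative_eq_intros refl | simp add: scaleR_conv_of_real)+
    have "((\<lambda>u. \<Sum>w\<in>set_pmf space_pmf. pmf space_pmf w *\<^sub>R (h w * iexp (u * G w))) has_vector_derivative
        (\<Sum>w\<in>set_pmf space_pmf. pmf space_pmf w *\<^sub>R (\<i> * (G w *\<^sub>R (h w * iexp (u * G w)))))) (at u)"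
      by (rule has_vector_derivative_sum) (rule one)
    then show ?thesis
      unfolding \<psi>_def \<psi>'_def Ex_eq_sum by (simp add: sum_distrib_left)
  qed
  have bound: "cmod (\<psi>' u + of_real (u * v) * \<psi> u) \<le> \<bar>u\<bar> * \<delta> + u\<^sup>2 / 2 * third_order" for u
  proof -
    let ?f = "\<lambda>w. h w * iexp (u * G w)"
    let ?E = "Ex (\<lambda>w. G w *\<^sub>R ?f w) - \<i> * of_real u * Ex (\<lambda>w. ?f w * of_real (Gam w))"
    have "Ex (\<lambda>w. ?f w * of_real (Gam w - v)) = Ex (\<lambda>w. ?f w * of_real (Gam w)) - of_real v * \<psi> u"
      unfolding \<psi>_def by (simp add: right_diff_distrib)
    then have eq: "\<psi>' u + of_real (u * v) * \<psi> u = \<i> * ?E - of_real u * Ex (\<lambda>w. ?f w * of_real (Gam w - v))"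
      unfolding \<psi>'_def by (simp add: algebra_simps)
    have "cmod (Ex (\<lambda>w. ?f w * of_real (Gam w - v))) \<le> Ex (\<lambda>w. \<bar>Gam w - v\<bar>)"
    proof (rule order_trans[OF integral_norm_bound], rule Ex_mono)
      fix w
      have "cmod (?f w * of_real (Gam w - v)) = cmod (h w) * \<bar>Gam w - v\<bar>"
        by (simp only: norm_mult norm_exp_i_times norm_of_real mult_1_right)
      also have "\<dots> \<le> 1 * \<bar>Gam w - v\<bar>" by (intro mult_right_mono h1) auto
      finally show "cmod (?f w * of_real (Gam w - v)) \<le> \<bar>Gam w - v\<bar>" by simp
    qed
    also have "\<dots> \<le> \<delta>" unfolding \<delta>_def by (rule Ex_abs_le)
    finally have b1: "cmod (Ex (\<lambda>w. ?f w * of_real (Gam w - v))) \<le> \<delta>" .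
    have b2: "cmod ?E \<le> u\<^sup>2 / 2 * third_order" by (rule Ex_G_iexp) (use h1 h_upd in auto)
    have "cmod (\<psi>' u + of_real (u * v) * \<psi> u) \<le> cmod (\<i> * ?E) + cmod (of_real u * Ex (\<lambda>w. ?f w * of_real (Gam w - v)))"
      unfolding eq by (rule norm_triangle_ineq4)
    also have "\<dots> = cmod ?E + \<bar>u\<bar> * cmod (Ex (\<lambda>w. ?f w * of_real (Gam w - v)))"
      unfolding norm_mult by simp
    also have "\<dots> \<le> u\<^sup>2 / 2 * third_order + \<bar>u\<bar> * \<delta>"
      using b1 b2 by (intro add_mono mult_left_mono) auto
    finally show ?thesis by simp
  qed
  \<comment> \<open>Multiplication by the integrating factor turns the approximate equation into a small derivative.\<close>
  define \<kappa> where "\<kappa> u = exp (v * u\<^sup>2 / 2) *\<^sub>R \<psi> u" for u :: real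
  define B where "B = exp (v * t\<^sup>2 / 2) * (\<bar>t\<bar> * \<delta> + t\<^sup>2 / 2 * third_order)"
  have derchi: "(\<kappa> has_vector_derivative exp (v * u\<^sup>2 / 2) *\<^sub>R (\<psi>' u + of_real (u * v) * \<psi> u)) (at u)" for u
  proof -
    have dexp: "((\<lambda>u. exp (v * u\<^sup>2 / 2)) has_real_derivative exp (v * u\<^sup>2 / 2) * (u * v)) (at u)"
      by (rule derivative_eq_intros refl | simp)+
    have "c *\<^sub>R x + (c * d) *\<^sub>R y = c *\<^sub>R (x + of_real d * y)" for c d :: real and x y :: complex
      by (simp add: scaleR_conv_of_real algebra_simps)
    then have "exp (v * u\<^sup>2 / 2) *\<^sub>R \<psi>' u + (exp (v * u\<^sup>2 / 2) * (u * v)) *\<^sub>R \<psi> u =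
        exp (v * u\<^sup>2 / 2) *\<^sub>R (\<psi>' u + of_real (u * v) * \<psi> u)"
      .
    then show ?thesis
      using has_vector_derivative_scaleR[OF dexp der] unfolding \<kappa>_def by simp
  qed
  have "norm (\<kappa> t - \<kappa> 0) \<le> B * norm (t - 0)"
  proof (rule differentiable_bound[where S = "closed_segment 0 t"
        and f' = "\<lambda>u y. y *\<^sub>R (exp (v * u\<^sup>2 / 2) *\<^sub>R (\<psi>' u + of_real (u * v) * \<psi> u))"])
    fix u assume "u \<in> closed_segment 0 t"
    then have ut: "\<bar>u\<bar> \<le> \<bar>t\<bar>" by (auto simp: closed_segment_eq_real_ivl split: if_splits)
    then have u2: "u\<^sup>2 \<le> t\<^sup>2" by (simp add: abs_le_square_iff)
    show "(\<kappa> has_derivative (\<lambda>y. y *\<^sub>R (exp (v * u\<^sup>2 / 2) *\<^sub>R (\<psi>' u + of_real (u * v) * \<psi> u)))) (at u within closed_segment 0 t)"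
      using derchi[of u] unfolding has_vector_derivative_def by (rule has_derivative_at_withinI)
    have "cmod (exp (v * u\<^sup>2 / 2) *\<^sub>R (\<psi>' u + of_real (u * v) * \<psi> u)) \<le> B"
      unfolding B_def norm_scaleR abs_exp_cancel
    proof (rule mult_mono)
      show "exp (v * u\<^sup>2 / 2) \<le> exp (v * t\<^sup>2 / 2)" using u2 v0 by (simp add: mult_left_mono)
      show "cmod (\<psi>' u + of_real (u * v) * \<psi> u) \<le> \<bar>t\<bar> * \<delta> + t\<^sup>2 / 2 * third_order"
        by (rule order_trans[OF bound]) (intro add_mono mult_right_mono divide_right_mono ut u2 \<delta>0 third0, auto)
    qed auto
    then show "onorm (\<lambda>y. y *\<^sub>R (exp (v * u\<^sup>2 / 2) *\<^sub>R (\<psi>' u + of_real (u * v) * \<psi> u))) \<le> B"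
      by (intro onorm_le) (simp only: norm_scaleR mult.commute[of B] real_norm_def mult_left_mono abs_ge_zero)
  qed auto
  then have chi: "cmod (\<kappa> t - \<kappa> 0) \<le> B * \<bar>t\<bar>" by simp
  have "\<kappa> 0 = Ex h" by (simp add: \<kappa>_def \<psi>_def)
  then have "\<psi> t - Ex h * of_real (exp (- (v * t\<^sup>2 / 2))) = exp (- (v * t\<^sup>2 / 2)) *\<^sub>R (\<kappa> t - \<kappa> 0)"
  proof -
    have "exp (- (v * t\<^sup>2 / 2)) * exp (v * t\<^sup>2 / 2) = 1" by (simp flip: exp_add)
    then have e1: "exp (- (v * t\<^sup>2 / 2)) *\<^sub>R \<kappa> t = \<psi> t"
      unfolding \<kappa>_def scaleR_scaleR by simp
    show ?thesis
      unfolding scaleR_diff_right e1 \<open>\<kappa> 0 = Ex h\<close>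
      unfolding scaleR_conv_of_real by (rule arg_cong[OF mult.commute])
  qed
  then have "cmod (\<psi> t - Ex h * of_real (exp (- (v * t\<^sup>2 / 2)))) = exp (- (v * t\<^sup>2 / 2)) * cmod (\<kappa> t - \<kappa> 0)"
    by simp
  also have "\<dots> \<le> exp (- (v * t\<^sup>2 / 2)) * (B * \<bar>t\<bar>)"
    using chi by (intro mult_left_mono) auto
  also have "\<dots> = (\<bar>t\<bar> * \<delta> + t\<^sup>2 / 2 * third_order) * \<bar>t\<bar>"
  proof -
    have "exp (- c) * (exp c * K * s) = K * s" for c K s :: real by (simp add: exp_minus)
    then show ?thesis unfolding B_def .
  qed
  also have "\<dots> = t\<^sup>2 * \<delta> + \<bar>t\<bar> ^ 3 / 2 * third_order"
  proof -
    have "(x * \<delta> + x\<^sup>2 / 2 * T) * x = x\<^sup>2 * \<delta> + x ^ 3 / 2 * T" for x T :: real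
      by (simp add: power3_eq_cube power2_eq_square algebra_simps)
    from this[of "\<bar>t\<bar>"] show ?thesis unfolding power2_abs .
  qed
  finally show ?thesis unfolding \<psi>_def \<delta>_def .
qed

end

section \<open>Second moments of sums of Walsh functions over vertex placements\<close>

lemma card_supersets_le:
  assumes "W \<subseteq> {1..n::nat}"
  shows "card {B. B \<subseteq> {1..n} \<and> card B = k \<and> W \<subseteq> B} \<le> n ^ (k - card W)"
proof -
  let ?A = "{B. B \<subseteq> {1..n} \<and> card B = k \<and> W \<subseteq> B}"
  let ?C = "{B. B \<subseteq> {1..n} \<and> card B = k - card W}"
  have "card ?A \<le> card ?C"
  proof (rule card_inj_on_le[where f = "\<lambda>B. B - W"])
    show "inj_on (\<lambda>B. B - W) ?A" by (rule inj_onI) blast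
    show "(\<lambda>B. B - W) ` ?A \<subseteq> ?C"
      using assms finite_subset[OF assms] by (auto simp: card_Diff_subset)
    show "finite ?C" by (rule finite_subset[of _ "Pow {1..n}"]) auto
  qed
  also have "card ?C = n choose (k - card W)" by (subst n_subsets) auto
  also have "\<dots> \<le> n ^ (k - card W)"
    by (cases "k - card W \<le> n") (auto intro: binomial_le_pow simp: binomial_eq_0)
  finally show ?thesis .
qed

lemma sum_inverse_powers_le:
  fixes Y :: "'x \<Rightarrow> nat set"
  assumes "finite X" "n \<ge> 1" and Y: "\<And>x. x \<in> X \<Longrightarrow> Y x \<subseteq> {1..n} \<and> card (Y x) \<le> m"
    and C: "\<And>B. card {x\<in>X. Y x = B} \<le> C"
  shows "(\<Sum>x\<in>X. 1 / real n ^ card (Y x)) \<le> real (m + 1) * real C"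
proof -
  let ?S = "\<lambda>k. {B. B \<subseteq> {1..n} \<and> card B = k}"
  have fin: "finite (?S k)" for k by (rule finite_subset[of _ "Pow {1..n}"]) auto
  have "(\<Sum>x\<in>X. 1 / real n ^ card (Y x)) = (\<Sum>B\<in>Y ` X. \<Sum>x\<in>{x\<in>X. Y x = B}. 1 / real n ^ card (Y x))"
    by (rule sum.image_gen[OF assms(1)])
  also have "\<dots> = (\<Sum>B\<in>Y ` X. real (card {x\<in>X. Y x = B}) * (1 / real n ^ card B))"
    by (rule sum.cong) auto
  also have "\<dots> \<le> (\<Sum>B\<in>Y ` X. real C * (1 / real n ^ card B))"
    using C by (intro sum_mono mult_right_mono) auto
  also have "\<dots> \<le> (\<Sum>B\<in>(\<Union>k\<in>{0..m}. ?S k). real C * (1 / real n ^ card B))"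
    using Y fin by (intro sum_mono2) auto
  also have "\<dots> = (\<Sum>k\<in>{0..m}. \<Sum>B\<in>?S k. real C * (1 / real n ^ card B))"
    by (rule sum.UNION_disjoint) (use fin in auto)
  also have "\<dots> = (\<Sum>k\<in>{0..m}. real C * (real (n choose k) / real n ^ k))"
    by (rule sum.cong) (auto simp: n_subsets)
  also have "\<dots> \<le> (\<Sum>k\<in>{0..m}. real C * 1)"
  proof (intro sum_mono mult_left_mono)
    fix k
    have "real (n choose k) \<le> real (n ^ k)"
      by (cases "k \<le> n") (auto intro: binomial_le_pow simp: binomial_eq_0 simp del: of_nat_power)
    then show "real (n choose k) / real n ^ k \<le> 1" using assms(2) by simp
  qed auto
  finally show ?thesis by simp
qed

text \<open>Only pairs of indices with the same set contribute; the product of their coefficients is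
  bounded by the mean of the squares, which leaves the number of indices with a given set.\<close>

lemma (in bernoulli_product) second_moment_le:
  assumes "finite X" and T: "\<And>x. x \<in> X \<Longrightarrow> T x \<subseteq> U"
  shows "Ex (\<lambda>w. (\<Sum>x\<in>X. c x * walsh (T x) w)\<^sup>2)
    \<le> (\<Sum>x\<in>X. (c x)\<^sup>2 * (\<Prod>e\<in>T x. var1 e) * real (card {y\<in>X. T y = T x}))"
proof -
  let ?v = "\<lambda>x. \<Prod>e\<in>T x. var1 e"
  have v0: "0 \<le> ?v x" if "x \<in> X" for x using T[OF that] var1_nonneg by (intro prod_nonneg) auto
  have "Ex (\<lambda>w. (\<Sum>x\<in>X. c x * walsh (T x) w)\<^sup>2) = Ex (\<lambda>w. \<Sum>x\<in>X. \<Sum>y\<in>X. c x * c y * (walsh (T x) w * walsh (T y) w))"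
    by (simp add: power2_eq_square sum_product algebra_simps)
  also have "\<dots> = (\<Sum>x\<in>X. \<Sum>y\<in>X. c x * c y * Ex (\<lambda>w. walsh (T x) w * walsh (T y) w))"
    by (simp add: Bochner_Integration.integral_sum)
  also have "\<dots> = (\<Sum>x\<in>X. \<Sum>y\<in>X. if T x = T y then c x * c y * ?v x else 0)"
    by (intro sum.cong refl) (auto simp: Ex_walsh_mult T)
  also have "\<dots> \<le> (\<Sum>x\<in>X. \<Sum>y\<in>X. (if T x = T y then (c x)\<^sup>2 / 2 * ?v x else 0) + (if T x = T y then (c y)\<^sup>2 / 2 * ?v y else 0))"
  proof (intro sum_mono)
    fix x y assume "x \<in> X" "y \<in> X"
    have "c x * c y \<le> (c x)\<^sup>2 / 2 + (c y)\<^sup>2 / 2"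
      using sum_squares_bound[of "c x" "c y"] by simp
    then have "c x * c y * ?v x \<le> ((c x)\<^sup>2 / 2 + (c y)\<^sup>2 / 2) * ?v x"
      by (rule mult_right_mono[OF _ v0[OF \<open>x \<in> X\<close>]])
    then show "(if T x = T y then c x * c y * ?v x else 0) \<le>
      (if T x = T y then (c x)\<^sup>2 / 2 * ?v x else 0) + (if T x = T y then (c y)\<^sup>2 / 2 * ?v y else 0)"
      by (auto simp: algebra_simps)
  qed
  also have "\<dots> = (\<Sum>x\<in>X. \<Sum>y\<in>X. if T x = T y then (c x)\<^sup>2 / 2 * ?v x else 0)
      + (\<Sum>x\<in>X. \<Sum>y\<in>X. if T x = T y then (c y)\<^sup>2 / 2 * ?v y else 0)"
    by (simp add: sum.distrib)
  also have "(\<Sum>x\<in>X. \<Sum>y\<in>X. if T x = T y then (c y)\<^sup>2 / 2 * ?v y else 0) =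
      (\<Sum>x\<in>X. \<Sum>y\<in>X. if T x = T y then (c x)\<^sup>2 / 2 * ?v x else 0)"
    by (subst sum.swap) (intro sum.cong refl, auto)
  also have "(\<Sum>x\<in>X. \<Sum>y\<in>X. if T x = T y then (c x)\<^sup>2 / 2 * ?v x else 0) =
      (\<Sum>x\<in>X. (c x)\<^sup>2 / 2 * ?v x * real (card {y\<in>X. T y = T x}))"
  proof (rule sum.cong[OF refl])
    fix x assume "x \<in> X"
    have "(\<Sum>y\<in>X. if T x = T y then (c x)\<^sup>2 / 2 * ?v x else 0) = (\<Sum>y\<in>{y\<in>X. T x = T y}. (c x)\<^sup>2 / 2 * ?v x)"
      by (rule sum.inter_filter[symmetric, OF assms(1)])
    then show "(\<Sum>y\<in>X. if T x = T y then (c x)\<^sup>2 / 2 * ?v x else 0) = (c x)\<^sup>2 / 2 * ?v x * real (card {y\<in>X. T y = T x})"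
      by (simp add: eq_commute[of "T x"] algebra_simps)
  qed
  finally show ?thesis by (simp add: sum.distrib[symmetric] algebra_simps)
qed

text \<open>The set \<open>Y x\<close> is the set of vertices occupied by \<open>x\<close>. For each value of \<open>card (Y x)\<close>, the number of indices with the
  same set \<open>T x\<close> is at most \<open>C * n ^ (card (Y x) - card (\<Union>(T x)))\<close>, since \<open>Y x\<close> must contain
  \<open>\<Union>(T x)\<close>; and there are about \<open>n ^ card (Y x)\<close> indices in all. So a bound on a single term, with
  these two powers inserted, suffices. With the labels, a sum of second moments, one for each marked edge, is treated in the
  same way.\<close>

lemma labelled_second_moment_le:
  fixes U :: "nat set set" and Y :: "'x \<Rightarrow> nat set" and lab :: "'x \<Rightarrow> 'l"
  assumes bp: "bernoulli_product U r" and "finite X" "finite L" "n \<ge> 1"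
    and T: "\<And>x. x \<in> X \<Longrightarrow> T x \<subseteq> U \<and> \<Union>(T x) \<subseteq> Y x"
    and Y: "\<And>x. x \<in> X \<Longrightarrow> Y x \<subseteq> {1..n} \<and> card (Y x) \<le> m"
    and C: "\<And>B. card {x\<in>X. Y x = B} \<le> C"
    and K: "\<And>x. x \<in> X \<Longrightarrow> (c x)\<^sup>2 * (\<Prod>e\<in>T x. bernoulli_product.var1 r e) * real n ^ (2 * card (Y x)) \<le> K * real n ^ card (\<Union>(T x))"
    and K0: "K \<ge> 0"
  shows "(\<Sum>l\<in>L. bernoulli_product.Ex U r (\<lambda>w. (\<Sum>x\<in>{x\<in>X. lab x = l}. c x * bernoulli_product.walsh r (T x) w)\<^sup>2))
    \<le> (real (m + 1) * real C)\<^sup>2 * K"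
proof -
  interpret bernoulli_product U r by (rule bp)
  let ?X = "\<lambda>l k. {x\<in>X. lab x = l \<and> card (Y x) = k}"
  let ?v = "\<lambda>x. \<Prod>e\<in>T x. var1 e"
  have v0: "0 \<le> ?v x" if "x \<in> X" for x using T[OF that] var1_nonneg by (intro prod_nonneg) auto
  have N: "real n > 0" using assms(4) by simp
  have cardY: "real (card {y \<in> ?X l (card (Y x)). T y = T x}) \<le> real C * (real n ^ card (Y x) / real n ^ card (\<Union>(T x)))"
    if x: "x \<in> X" for x l
  proof -
    let ?W = "\<Union>(T x)" and ?k = "card (Y x)"
    let ?B = "{B. B \<subseteq> {1..n} \<and> card B = ?k \<and> ?W \<subseteq> B}"
    have W: "?W \<subseteq> Y x" "?W \<subseteq> {1..n}" using T[OF x] Y[OF x] by auto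
    have cW: "card ?W \<le> ?k" using W Y[OF x] by (intro card_mono) (auto intro: finite_subset)
    have finB: "finite ?B" by (rule finite_subset[of _ "Pow {1..n}"]) auto
    have "{y \<in> ?X l ?k. T y = T x} \<subseteq> (\<Union>B\<in>?B. {y\<in>X. Y y = B})"
      using T Y by fastforce
    then have "card {y \<in> ?X l ?k. T y = T x} \<le> card (\<Union>B\<in>?B. {y\<in>X. Y y = B})"
      using finB \<open>finite X\<close> by (intro card_mono) auto
    also have "\<dots> \<le> (\<Sum>B\<in>?B. card {y\<in>X. Y y = B})" by (rule card_UN_le[OF finB])
    also have "\<dots> \<le> (\<Sum>B\<in>?B. C)" by (intro sum_mono C)
    also have "\<dots> = C * card ?B" by simp
    also have "\<dots> \<le> C * n ^ (?k - card ?W)"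
      by (intro mult_left_mono card_supersets_le W) auto
    finally have "real (card {y \<in> ?X l ?k. T y = T x}) \<le> real (C * n ^ (?k - card ?W))"
      by (simp only: of_nat_le_iff)
    also have "\<dots> = real C * (real n ^ ?k / real n ^ card ?W)"
      using cW N unfolding of_nat_mult of_nat_power by (subst power_diff) auto
    finally show ?thesis .
  qed
  have "(\<Sum>l\<in>L. Ex (\<lambda>w. (\<Sum>x\<in>{x\<in>X. lab x = l}. c x * walsh (T x) w)\<^sup>2))
     \<le> (\<Sum>l\<in>L. real (m + 1) * (\<Sum>k\<in>{0..m}. \<Sum>x\<in>?X l k. (c x)\<^sup>2 * ?v x * (real C * (real n ^ card (Y x) / real n ^ card (\<Union>(T x))))))"
  proof (rule sum_mono)
    fix l assume "l \<in> L"
    have "Ex (\<lambda>w. (\<Sum>x\<in>{x\<in>X. lab x = l}. c x * walsh (T x) w)\<^sup>2)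
       \<le> Ex (\<lambda>w. real (m + 1) * (\<Sum>k\<in>{0..m}. (\<Sum>x\<in>?X l k. c x * walsh (T x) w)\<^sup>2))"
    proof (rule Ex_mono)
      fix w
      have "{x\<in>X. lab x = l} = (\<Union>k\<in>{0..m}. ?X l k)" using Y by auto
      then have "(\<Sum>x\<in>{x\<in>X. lab x = l}. c x * walsh (T x) w) = (\<Sum>x\<in>(\<Union>k\<in>{0..m}. ?X l k). c x * walsh (T x) w)"
        by simp
      also have "\<dots> = (\<Sum>k\<in>{0..m}. \<Sum>x\<in>?X l k. c x * walsh (T x) w)"
        by (rule sum.UNION_disjoint) (use \<open>finite X\<close> in auto)
      finally have "(\<Sum>x\<in>{x\<in>X. lab x = l}. c x * walsh (T x) w)\<^sup>2 = (\<Sum>k\<in>{0..m}. \<Sum>x\<in>?X l k. c x * walsh (T x) w)\<^sup>2"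
        by simp
      also have "\<dots> \<le> (\<Sum>k\<in>{0..m}. (\<Sum>x\<in>?X l k. c x * walsh (T x) w)\<^sup>2) * real (card {0..m})"
        by (rule sum_squared_le_sum_of_squares)
      finally show "(\<Sum>x\<in>{x\<in>X. lab x = l}. c x * walsh (T x) w)\<^sup>2
        \<le> real (m + 1) * (\<Sum>k\<in>{0..m}. (\<Sum>x\<in>?X l k. c x * walsh (T x) w)\<^sup>2)"
        by (simp add: mult.commute)
    qed
    also have "\<dots> = real (m + 1) * (\<Sum>k\<in>{0..m}. Ex (\<lambda>w. (\<Sum>x\<in>?X l k. c x * walsh (T x) w)\<^sup>2))"
      by (simp add: Bochner_Integration.integral_sum)
    also have "\<dots> \<le> real (m + 1) * (\<Sum>k\<in>{0..m}. \<Sum>x\<in>?X l k. (c x)\<^sup>2 * ?v x * (real C * (real n ^ card (Y x) / real n ^ card (\<Union>(T x)))))"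
    proof (intro mult_left_mono sum_mono)
      fix k
      have "Ex (\<lambda>w. (\<Sum>x\<in>?X l k. c x * walsh (T x) w)\<^sup>2) \<le> (\<Sum>x\<in>?X l k. (c x)\<^sup>2 * ?v x * real (card {y\<in>?X l k. T y = T x}))"
        by (rule second_moment_le) (use \<open>finite X\<close> T in auto)
      also have "\<dots> \<le> (\<Sum>x\<in>?X l k. (c x)\<^sup>2 * ?v x * (real C * (real n ^ card (Y x) / real n ^ card (\<Union>(T x)))))"
      proof (intro sum_mono mult_left_mono)
        fix x assume x: "x \<in> ?X l k"
        then show "real (card {y\<in>?X l k. T y = T x}) \<le> real C * (real n ^ card (Y x) / real n ^ card (\<Union>(T x)))"
          using cardY[of x l] by auto
        show "0 \<le> (c x)\<^sup>2 * ?v x" using x v0 by auto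
      qed
      finally show "Ex (\<lambda>w. (\<Sum>x\<in>?X l k. c x * walsh (T x) w)\<^sup>2) \<le> (\<Sum>x\<in>?X l k. (c x)\<^sup>2 * ?v x * (real C * (real n ^ card (Y x) / real n ^ card (\<Union>(T x)))))" .
    qed auto
    finally show "Ex (\<lambda>w. (\<Sum>x\<in>{x\<in>X. lab x = l}. c x * walsh (T x) w)\<^sup>2) \<le>
      real (m + 1) * (\<Sum>k\<in>{0..m}. \<Sum>x\<in>?X l k. (c x)\<^sup>2 * ?v x * (real C * (real n ^ card (Y x) / real n ^ card (\<Union>(T x)))))" .
  qed
  also have "\<dots> \<le> (\<Sum>l\<in>L. real (m + 1) * (\<Sum>k\<in>{0..m}. \<Sum>x\<in>?X l k. real C * K * (1 / real n ^ card (Y x))))"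
  proof (intro sum_mono mult_left_mono)
    fix l k x assume "x \<in> ?X l k"
    then have x: "x \<in> X" by simp
    have "(c x)\<^sup>2 * ?v x * (real n ^ card (Y x) / real n ^ card (\<Union>(T x))) \<le> K * (1 / real n ^ card (Y x))"
      using K[OF x] N unfolding mult_2 power_add by (simp add: field_simps)
    then have "real C * ((c x)\<^sup>2 * ?v x * (real n ^ card (Y x) / real n ^ card (\<Union>(T x)))) \<le> real C * (K * (1 / real n ^ card (Y x)))"
      by (intro mult_left_mono) auto
    then show "(c x)\<^sup>2 * ?v x * (real C * (real n ^ card (Y x) / real n ^ card (\<Union>(T x)))) \<le> real C * K * (1 / real n ^ card (Y x))"
      by (simp add: mult_ac)
  qed auto
  also have "\<dots> = real (m + 1) * (real C * K) * (\<Sum>l\<in>L. \<Sum>k\<in>{0..m}. \<Sum>x\<in>?X l k. 1 / real n ^ card (Y x))"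
    by (simp only: sum_distrib_left mult.assoc)
  also have "\<dots> \<le> real (m + 1) * (real C * K) * (real (m + 1) * real C)"
  proof (rule mult_left_mono)
    have "(\<Sum>l\<in>L. \<Sum>k\<in>{0..m}. \<Sum>x\<in>?X l k. 1 / real n ^ card (Y x)) = (\<Sum>l\<in>L. \<Sum>x\<in>(\<Union>k\<in>{0..m}. ?X l k). 1 / real n ^ card (Y x))"
      by (intro sum.cong refl sum.UNION_disjoint[symmetric]) (use \<open>finite X\<close> in auto)
    also have "\<dots> = (\<Sum>x\<in>(\<Union>l\<in>L. \<Union>k\<in>{0..m}. ?X l k). 1 / real n ^ card (Y x))"
      by (rule sum.UNION_disjoint[symmetric]) (use \<open>finite X\<close> \<open>finite L\<close> in auto)
    also have "\<dots> \<le> (\<Sum>x\<in>X. 1 / real n ^ card (Y x))"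
      by (rule sum_mono2) (use \<open>finite X\<close> in auto)
    also have "\<dots> \<le> real (m + 1) * real C"
      by (rule sum_inverse_powers_le) (use assms in auto)
    finally show "(\<Sum>l\<in>L. \<Sum>k\<in>{0..m}. \<Sum>x\<in>?X l k. 1 / real n ^ card (Y x)) \<le> real (m + 1) * real C" .
  qed (use K0 in auto)
  finally show ?thesis by (simp add: power2_eq_square mult_ac)
qed

section \<open>The weight of a pair of overlapping copies\<close>

text \<open>Here \<open>S\<close> and \<open>S'\<close> are two copies sharing the edges \<open>D\<close>, and \<open>T\<close> is one of the sets in the
  expansion of \<open>walsh S * walsh S'\<close>. All powers of \<open>N\<close> are compared through \<open>\<psi> \<le> M\<close>, and one has to gain
  the factor \<open>\<epsilon>\<close>. If \<open>A\<close> is empty, the left-hand side is governed by \<open>\<psi> S * \<psi> S'\<close>: a vertex shared by \<open>D\<close> and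
  \<open>T\<close> gives a factor \<open>1 / N\<close>, and otherwise \<open>\<psi>\<close> splits over the disjoint parts \<open>D\<close> and \<open>S - S'\<close> (or \<open>S' - S\<close>),
  the second of which is small by \<open>cond1\<close>. If \<open>A\<close> is not empty, the left-hand side
  contains \<open>1 / (P A * Q A)\<close>. The factor \<open>1 / P A\<close> is harmless by \<open>cond1\<close>. To absorb \<open>1 / Q A\<close> one uses that a subset of \<open>S\<close>
  also has \<open>\<psi> \<le> M\<close>, so that edges of \<open>A\<close> with small \<open>1 - r e\<close> can be dropped from \<open>S\<close> first, provided
  that an edge of \<open>A\<close> remains.\<close>

lemma overlap_weight_le:
  fixes S S' A :: "'v set set" and r :: "'v set \<Rightarrow> real" and N \<epsilon> M :: real
  defines "D \<equiv> S \<inter> S'"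
  defines "T \<equiv> (S - S') \<union> (S' - S) \<union> A"
  defines "R \<equiv> D - A"
  defines "P \<equiv> \<lambda>B. prod r B"
  defines "Q \<equiv> \<lambda>B. \<Prod>e\<in>B. 1 - r e"
  defines "\<psi> \<equiv> \<lambda>B. Q B / (P B * N ^ card (\<Union>B))"
  assumes fin: "finite S" "finite S'" "\<And>e. e \<in> S \<union> S' \<Longrightarrow> finite e"
    and r: "\<And>e. e \<in> S \<union> S' \<Longrightarrow> 0 < r e \<and> r e < 1"
    and N1: "1 \<le> N" and N: "1 \<le> \<epsilon> * N"
    and \<psi>M: "\<And>B. B \<noteq> {} \<Longrightarrow> B \<subseteq> S \<or> B \<subseteq> S' \<Longrightarrow> \<psi> B \<le> M"
    and cond1: "\<And>B. B \<noteq> {} \<Longrightarrow> B \<subseteq> S \<or> B \<subseteq> S' \<Longrightarrow> 1 \<le> \<epsilon> * (N ^ card (\<Union>B) * P B)"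
    and cond2: "\<And>e. e \<in> S \<union> S' \<Longrightarrow> 1 / 2 \<le> r e \<Longrightarrow> 1 \<le> \<epsilon> * (N ^ card e * (1 - r e))"
    and A: "A \<subseteq> D" and D_ne: "D \<noteq> {}" and T_ne: "T \<noteq> {}"
  shows "Q T * (Q R)\<^sup>2 \<le> 4 ^ card A * \<epsilon> * M\<^sup>2 * (P T * (P D)\<^sup>2) * N ^ (card (\<Union>T) + 2 * card (\<Union>S \<inter> \<Union>S'))"
proof -
  let ?v = "\<lambda>B. card (\<Union>B)" and ?m = "card (\<Union>S \<inter> \<Union>S')"
  have lt_le: "0 < x \<Longrightarrow> 0 \<le> x" for x :: real by simp
  have N0: "0 < N" using N1 by simp
  have \<epsilon>0: "0 < \<epsilon>" using N N0 by (smt (verit) mult_nonpos_nonneg)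
  have finB: "finite B" "finite (\<Union>B)" if "B \<subseteq> S \<union> S'" for B
    using that fin finite_subset[OF that] by (auto intro: finite_Union)
  have P0: "0 < P B" if "B \<subseteq> S \<union> S'" for B unfolding P_def using that r by (intro prod_pos) auto
  have Q0: "0 < Q B" if "B \<subseteq> S \<union> S'" for B unfolding Q_def using that r by (intro prod_pos) auto
  have Q_le1: "Q B \<le> 1" if "B \<subseteq> S \<union> S'" for B
    unfolding Q_def
  proof (rule prod_le_1)
    fix e assume "e \<in> B"
    then show "0 \<le> 1 - r e \<and> 1 - r e \<le> 1" using that r[of e] by auto
  qed
  have PU: "P (B \<union> B') = P B * P B'" if "B \<subseteq> S \<union> S'" "B' \<subseteq> S \<union> S'" "B \<inter> B' = {}" for B B'
    unfolding P_def by (rule prod.union_disjoint) (use finB that in auto)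
  have QU: "Q (B \<union> B') = Q B * Q B'" if "B \<subseteq> S \<union> S'" "B' \<subseteq> S \<union> S'" "B \<inter> B' = {}" for B B'
    unfolding Q_def by (rule prod.union_disjoint) (use finB that in auto)
  have \<psi>0: "0 < \<psi> B" if "B \<subseteq> S \<union> S'" for B
    unfolding \<psi>_def using P0[OF that] Q0[OF that] N0 by simp
  have Q\<psi>: "Q B = \<psi> B * (P B * N ^ ?v B)" if "B \<subseteq> S \<union> S'" for B
    unfolding \<psi>_def using P0[OF that] N0 by simp
  have nn: "0 \<le> P S" "0 \<le> P S'" "0 \<le> Q S" "0 \<le> Q S'" "0 \<le> P A" "0 \<le> Q A" "0 \<le> \<psi> S" "0 \<le> \<psi> S'"
    using A by (auto intro!: lt_le P0 Q0 \<psi>0 simp: D_def)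
  have S_ne: "S \<noteq> {}" "S' \<noteq> {}" using D_ne by (auto simp: D_def)
  have M0: "0 < M"
    using \<psi>M[OF D_ne] \<psi>0[of D] by (force simp: D_def)
  define T1 where "T1 = S - S'"
  define T2 where "T2 = S' - S"
  have sub: "T1 \<subseteq> S \<union> S'" "T2 \<subseteq> S \<union> S'" "D \<subseteq> S \<union> S'" "A \<subseteq> S \<union> S'" "R \<subseteq> S \<union> S'" "S \<subseteq> S \<union> S'" "S' \<subseteq> S \<union> S'" "T \<subseteq> S \<union> S'"
    using A by (auto simp: T1_def T2_def D_def R_def T_def)
  have S_eq: "S = T1 \<union> D" "T1 \<inter> D = {}" and S'_eq: "S' = T2 \<union> D" "T2 \<inter> D = {}"
    by (auto simp: T1_def T2_def D_def)
  have D_eq: "D = R \<union> A" "R \<inter> A = {}" using A by (auto simp: R_def)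
  have T_eq: "T = T1 \<union> (T2 \<union> A)" "T1 \<inter> (T2 \<union> A) = {}" "T2 \<inter> A = {}"
    using A by (auto simp: T_def T1_def T2_def D_def)
  have PS: "P S = P T1 * P D" "P S' = P T2 * P D" "P D = P R * P A"
    using PU[of T1 D] PU[of T2 D] PU[of R A] sub S_eq S'_eq D_eq by auto
  have QS: "Q S = Q T1 * Q D" "Q S' = Q T2 * Q D" "Q D = Q R * Q A"
    using QU[of T1 D] QU[of T2 D] QU[of R A] sub S_eq S'_eq D_eq by auto
  have PT: "P T = P T1 * (P T2 * P A)" and QT: "Q T = Q T1 * (Q T2 * Q A)"
    using PU[of T1 "T2 \<union> A"] PU[of T2 A] QU[of T1 "T2 \<union> A"] QU[of T2 A] sub T_eq by auto
  have PP: "P T * (P D)\<^sup>2 = P S * P S' * P A" by (simp add: PT PS(1,2) power2_eq_square)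
  have QQ: "Q T * (Q R)\<^sup>2 * Q A = Q S * Q S'" by (simp add: QT QS power2_eq_square)
  have VD: "?v D \<le> ?m" by (rule card_mono) (use finB[of S] in \<open>auto simp: D_def\<close>)
  have vSS: "?v S + ?v S' = card (\<Union>S \<union> \<Union>S') + ?m"
    by (rule card_Un_Int) (use finB in auto)
  have pw: "N ^ i \<le> N ^ j" if "i \<le> j" for i j using that N1 by (rule power_increasing)
  have V_union: "\<Union>S \<union> \<Union>S' = \<Union>T \<union> \<Union>R"
    unfolding S_eq(1) S'_eq(1) using D_eq(1) T_eq(1) by auto
  show ?thesis
  proof (cases "A = {}")
    case True
    then have RD: "R = D" and Q_A: "Q A = 1" and PA: "P A = 1" by (auto simp: R_def Q_def P_def)
    have main: "\<psi> S * \<psi> S' * N ^ (?v S + ?v S') \<le> \<epsilon> * M\<^sup>2 * N ^ (?v T + 2 * ?m)"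
    proof (cases "\<Union>D \<inter> \<Union>T = {}")
      case False
      have "card (\<Union>T \<union> \<Union>D) + card (\<Union>T \<inter> \<Union>D) = ?v T + ?v D"
        by (rule card_Un_Int[symmetric]) (use finB sub in auto)
      moreover have "card (\<Union>T \<inter> \<Union>D) \<ge> 1"
        using False finB sub by (simp add: Suc_le_eq card_gt_0_iff Int_commute)
      ultimately have le: "Suc (?v S + ?v S') \<le> ?v T + 2 * ?m"
        using vSS VD V_union RD by simp
      have "\<psi> S * \<psi> S' \<le> M * M"
        by (intro mult_mono \<psi>M) (use S_eq S'_eq D_ne \<psi>0 sub M0 in \<open>auto intro: lt_le\<close>)
      then have "\<psi> S * \<psi> S' * N ^ (?v S + ?v S') \<le> M\<^sup>2 * N ^ (?v S + ?v S') * 1"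
        using N0 by (simp add: power2_eq_square)
      also have "\<dots> \<le> M\<^sup>2 * N ^ (?v S + ?v S') * (\<epsilon> * N)"
        by (intro mult_left_mono N) (use N0 in auto)
      also have "\<dots> = \<epsilon> * M\<^sup>2 * N ^ Suc (?v S + ?v S')" by (simp add: mult_ac)
      also have "\<dots> \<le> \<epsilon> * M\<^sup>2 * N ^ (?v T + 2 * ?m)"
        by (intro mult_left_mono pw le) (use \<epsilon>0 in auto)
      finally show ?thesis .
    next
      case True
      have le: "?v S + ?v S' \<le> ?v T + 2 * ?m"
        using vSS VD V_union RD card_Un_le[of "\<Union>T" "\<Union>D"] by simp
      have part: "\<psi> B \<le> \<epsilon> * M" if B: "B = B1 \<union> D" "B1 \<inter> D = {}" "B1 \<noteq> {}" "B \<subseteq> S \<or> B \<subseteq> S'" "\<Union>B1 \<inter> \<Union>D = {}" for B B1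
      proof -
        have s: "B1 \<subseteq> S \<union> S'" "B1 \<subseteq> S \<or> B1 \<subseteq> S'" using B by auto
        have "?v B = ?v B1 + ?v D"
          unfolding B(1) Union_Un_distrib by (rule card_Un_disjoint) (use finB s sub B in auto)
        then have "\<psi> B = \<psi> B1 * \<psi> D"
          unfolding \<psi>_def B(1) using PU[of B1 D] QU[of B1 D] s sub B by (simp add: power_add)
        also have "\<psi> B1 \<le> \<epsilon>"
        proof -
          have "Q B1 \<le> \<epsilon> * (N ^ ?v B1 * P B1)"
            using cond1[OF B(3) s(2)] Q_le1[OF s(1)] by simp
          then show ?thesis unfolding \<psi>_def using P0[OF s(1)] N0 by (simp add: field_simps)
        qed
        then have "\<psi> B1 * \<psi> D \<le> \<epsilon> * M"
          by (intro mult_mono \<psi>M D_ne) (use \<epsilon>0 \<psi>0 sub in \<open>auto simp: D_def intro: lt_le\<close>)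
        finally show ?thesis .
      qed
      have "\<psi> S * \<psi> S' \<le> (\<epsilon> * M) * M"
      proof (cases "T1 = {}")
        case False
        have "\<psi> S \<le> \<epsilon> * M"
          by (rule part[of S T1]) (use False S_eq True in \<open>auto simp: T_eq\<close>)
        moreover have "\<psi> S' \<le> M" by (rule \<psi>M) (use S'_eq D_ne in auto)
        ultimately show ?thesis using \<psi>0 sub M0 \<epsilon>0 by (intro mult_mono) (auto intro: lt_le)
      next
        case T1: True
        have "\<psi> S' \<le> \<epsilon> * M"
          by (rule part[of S' T2]) (use T1 T_ne \<open>A = {}\<close> S'_eq True in \<open>auto simp: T_eq\<close>)
        moreover have "\<psi> S \<le> M" by (rule \<psi>M) (use S_eq D_ne in auto)
        ultimately have "\<psi> S * \<psi> S' \<le> M * (\<epsilon> * M)"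
          using \<psi>0 sub M0 \<epsilon>0 by (intro mult_mono) (auto intro: lt_le)
        then show ?thesis by (simp add: mult_ac)
      qed
      then have "\<psi> S * \<psi> S' * N ^ (?v S + ?v S') \<le> (\<epsilon> * M) * M * N ^ (?v T + 2 * ?m)"
        by (rule mult_mono[OF _ pw[OF le]]) (use M0 \<epsilon>0 N0 in auto)
      then show ?thesis by (simp add: power2_eq_square mult_ac)
    qed
    have "Q T * (Q R)\<^sup>2 = \<psi> S * (P S * N ^ ?v S) * (\<psi> S' * (P S' * N ^ ?v S'))"
      using QQ Q_A Q\<psi>[OF sub(6)] Q\<psi>[OF sub(7)] by simp
    also have "\<dots> = (P S * P S') * (\<psi> S * \<psi> S' * N ^ (?v S + ?v S'))"
      by (simp add: power_add mult_ac)
    also have "\<dots> \<le> (P S * P S') * (\<epsilon> * M\<^sup>2 * N ^ (?v T + 2 * ?m))"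
      by (intro mult_left_mono main) (use nn M0 N0 \<epsilon>0 S_ne in \<open>auto\<close>)
    also have "\<dots> = 4 ^ card A * \<epsilon> * M\<^sup>2 * (P T * (P D)\<^sup>2) * N ^ (?v T + 2 * ?m)"
      using PA True by (simp add: PP)
    finally show ?thesis .
  next
    case A_ne: False
    have finA: "finite A" using finB sub by auto
    \<comment> \<open>The edges of \<open>B\<close> are dropped from \<open>S\<close>. If some edges of \<open>A\<close> have probability below one half, all the
      others are dropped and \<open>cond1\<close> applies to the rest; otherwise a single edge is kept and \<open>cond2\<close> applies to it.\<close>
    obtain B where B: "B \<subseteq> A" "A - B \<noteq> {}" "\<And>e. e \<in> B \<Longrightarrow> 1 / 2 \<le> r e"
      and B_bd: "4 ^ card B \<le> 4 ^ card A * (\<epsilon> * (N ^ ?v A * P (A - B) * Q (A - B)))"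
    proof (cases "\<exists>e\<in>A. r e < 1 / 2")
      case True
      define A0 where "A0 = {e\<in>A. r e < 1 / 2}"
      define B where "B = A - A0"
      have A0: "A0 \<subseteq> A" "A0 \<noteq> {}" "A - B = A0" "A0 \<subseteq> S \<union> S'" using True sub by (auto simp: A0_def B_def)
      have cAB: "card A = card B + card A0"
        unfolding B_def using finA A0 by (simp add: card_Diff_subset card_mono finite_subset)
      have q: "1 \<le> 4 ^ card A0 * Q A0"
      proof -
        have "(\<Prod>e\<in>A0. 1) \<le> (\<Prod>e\<in>A0. 4 * (1 - r e))"
          by (rule prod_mono) (auto simp: A0_def)
        then show ?thesis by (simp only: Q_def prod.distrib prod_constant power_one)
      qed
      have "1 \<le> \<epsilon> * (N ^ ?v A0 * P A0)"
        by (rule cond1) (use A0 A in \<open>auto simp: D_def\<close>)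
      also have "\<dots> \<le> \<epsilon> * (N ^ ?v A * P A0)"
        by (intro mult_left_mono mult_right_mono pw card_mono) (use A0 finB sub \<epsilon>0 P0[of A0] in \<open>auto intro: lt_le\<close>)
      finally have "1 * 1 \<le> (4 ^ card A0 * Q A0) * (\<epsilon> * (N ^ ?v A * P A0))"
        using q by (intro mult_mono) auto
      then have "4 ^ card B * 1 \<le> 4 ^ card B * ((4 ^ card A0 * Q A0) * (\<epsilon> * (N ^ ?v A * P A0)))"
        by (intro mult_left_mono) auto
      then have "4 ^ card B \<le> 4 ^ card A * (\<epsilon> * (N ^ ?v A * P (A - B) * Q (A - B)))"
        unfolding cAB A0(3) by (simp add: power_add mult_ac)
      then show ?thesis using A0 by (intro that[of B]) (auto simp: B_def A0_def)
    next
      case False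
      then obtain e where e: "e \<in> A" using A_ne by auto
      then have eS: "e \<in> S \<union> S'" using sub by auto
      define B where "B = A - {e}"
      have AB: "A - B = {e}" using e by (auto simp: B_def)
      have cAB: "card A = Suc (card B)" unfolding B_def by (rule card_Suc_Diff1[OF finA e, symmetric])
      have re: "1 / 2 \<le> r e" using False e by auto
      have "1 \<le> \<epsilon> * (N ^ card e * (1 - r e))" by (rule cond2[OF eS re])
      also have "\<dots> \<le> \<epsilon> * (N ^ ?v A * (1 - r e))"
        by (intro mult_left_mono mult_right_mono pw card_mono) (use e finB sub \<epsilon>0 r[OF eS] in \<open>auto intro: lt_le\<close>)
      finally have "1 * 1 \<le> (4 * r e) * (\<epsilon> * (N ^ ?v A * (1 - r e)))"
        using re by (intro mult_mono) auto
      then have "4 ^ card B * 1 \<le> 4 ^ card B * ((4 * r e) * (\<epsilon> * (N ^ ?v A * (1 - r e))))"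
        by (intro mult_left_mono) auto
      then have "4 ^ card B \<le> 4 ^ card A * (\<epsilon> * (N ^ ?v A * P (A - B) * Q (A - B)))"
        unfolding cAB AB by (simp add: P_def Q_def mult_ac)
      then show ?thesis using False AB by (intro that[of B]) (auto simp: B_def)
    qed
    have Bs: "B \<subseteq> S \<union> S'" "S - B \<subseteq> S \<union> S'" "A - B \<subseteq> S \<union> S'" "B \<subseteq> S" using B sub A by (auto simp: D_def)
    have SB_ne: "S - B \<noteq> {}" using B A by (auto simp: D_def)
    have nnB: "0 \<le> P B" "0 \<le> Q B" "0 \<le> P (S - B)" "0 \<le> Q (S - B)" "0 \<le> P (A - B)" "0 \<le> Q (A - B)"
      using Bs by (auto intro!: lt_le P0 Q0)
    have SB: "P S = P (S - B) * P B" "Q S = Q (S - B) * Q B"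
      using PU[of "S - B" B] QU[of "S - B" B] Bs by (auto simp: Un_absorb2)
    have AB: "P A = P (A - B) * P B" "Q A = Q (A - B) * Q B"
      using PU[of "A - B" B] QU[of "A - B" B] Bs B by (auto simp: Un_absorb2)
    have PB: "1 \<le> 2 ^ card B * P B"
    proof -
      have "(\<Prod>e\<in>B. 1) \<le> (\<Prod>e\<in>B. 2 * r e)"
        by (rule prod_mono) (use B(3) in force)
      then show ?thesis by (simp only: P_def prod.distrib prod_constant power_one)
    qed
    have "Q (S - B) \<le> M * (P (S - B) * N ^ ?v (S - B))"
      unfolding Q\<psi>[OF Bs(2)]
      by (intro mult_right_mono \<psi>M) (use nn nnB SB_ne M0 N0 \<epsilon>0 S_ne SB_ne in auto)
    also have "\<dots> \<le> M * (P (S - B) * N ^ ?v S)"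
      by (intro mult_left_mono pw card_mono) (use finB(2)[of S] nnB M0 in auto)
    finally have "Q S * 1 \<le> (M * (P (S - B) * N ^ ?v S) * Q B) * (2 ^ card B * P B)"
      unfolding SB using PB nnB M0 N0
      by (intro mult_mono mult_right_mono) auto
    then have QSle: "Q S \<le> M * P S * N ^ ?v S * (2 ^ card B * Q B)"
      unfolding SB by (simp add: mult_ac)
    have QS'le: "Q S' \<le> M * P S' * N ^ ?v S'"
      unfolding Q\<psi>[OF sub(7)] mult.assoc
      by (intro mult_right_mono \<psi>M) (use nn nnB M0 N0 \<epsilon>0 S_ne in \<open>auto\<close>)
    have expo: "?v A + (?v S + ?v S') \<le> ?v T + 2 * ?m"
    proof -
      have f: "finite (\<Union>T)" "finite (\<Union>R)" "finite (\<Union>A)" "finite (\<Union>D)" using finB sub by auto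
      have "\<Union>T \<union> \<Union>R = \<Union>T \<union> (\<Union>R - \<Union>T)" by auto
      then have 1: "card (\<Union>S \<union> \<Union>S') \<le> ?v T + card (\<Union>R - \<Union>T)"
        unfolding V_union by (metis card_Un_le)
      have "card (\<Union>A \<union> (\<Union>R - \<Union>T)) = ?v A + card (\<Union>R - \<Union>T)"
        by (rule card_Un_disjoint) (use f T_eq in auto)
      moreover have "card (\<Union>A \<union> (\<Union>R - \<Union>T)) \<le> ?v D"
        by (rule card_mono) (use f D_eq in auto)
      ultimately show ?thesis using 1 VD vSS by simp
    qed
    have half: "2 ^ card B * Q B * N ^ (?v S + ?v S') \<le> 4 ^ card A * \<epsilon> * (P A * Q A) * N ^ (?v T + 2 * ?m)"
    proof -
      have "2 ^ card B * Q B * 2 ^ card B = 4 ^ card B * Q B"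
        by (simp add: mult_ac flip: power_mult_distrib)
      also have "\<dots> \<le> 4 ^ card A * (\<epsilon> * (N ^ ?v A * P (A - B) * Q (A - B))) * Q B"
        by (intro mult_right_mono B_bd) (use Q0[OF Bs(1)] in simp)
      also have "\<dots> = 4 ^ card A * \<epsilon> * N ^ ?v A * (P (A - B) * Q A) * 1"
        unfolding AB by (simp add: mult_ac)
      also have "\<dots> \<le> 4 ^ card A * \<epsilon> * N ^ ?v A * (P (A - B) * Q A) * (2 ^ card B * P B)"
        by (intro mult_left_mono PB) (use nn nnB M0 N0 \<epsilon>0 S_ne in \<open>auto\<close>)
      also have "\<dots> = (4 ^ card A * \<epsilon> * (P A * Q A) * N ^ ?v A) * 2 ^ card B"
        unfolding AB by (simp add: mult_ac)
      finally have "2 ^ card B * Q B \<le> 4 ^ card A * \<epsilon> * (P A * Q A) * N ^ ?v A"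
        by (rule mult_right_le_imp_le) simp
      then have "2 ^ card B * Q B * N ^ (?v S + ?v S') \<le> 4 ^ card A * \<epsilon> * (P A * Q A) * N ^ ?v A * N ^ (?v S + ?v S')"
        by (rule mult_right_mono) (use N0 in auto)
      also have "\<dots> = 4 ^ card A * \<epsilon> * (P A * Q A) * N ^ (?v A + (?v S + ?v S'))"
        by (simp add: power_add mult_ac)
      also have "\<dots> \<le> 4 ^ card A * \<epsilon> * (P A * Q A) * N ^ (?v T + 2 * ?m)"
        by (intro mult_left_mono pw expo) (use nn nnB M0 N0 \<epsilon>0 S_ne in \<open>auto\<close>)
      finally show ?thesis .
    qed
    have "Q T * (Q R)\<^sup>2 * Q A \<le> (M * P S * N ^ ?v S * (2 ^ card B * Q B)) * (M * P S' * N ^ ?v S')"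
      unfolding QQ by (intro mult_mono QSle QS'le)
        (use nn nnB M0 N0 \<epsilon>0 S_ne in \<open>auto\<close>)
    also have "\<dots> = M\<^sup>2 * (P S * P S') * (2 ^ card B * Q B * N ^ (?v S + ?v S'))"
      by (simp add: power_add power2_eq_square mult_ac)
    also have "\<dots> \<le> M\<^sup>2 * (P S * P S') * (4 ^ card A * \<epsilon> * (P A * Q A) * N ^ (?v T + 2 * ?m))"
      by (intro mult_left_mono half) (use nn nnB M0 N0 \<epsilon>0 S_ne in \<open>auto\<close>)
    also have "\<dots> = (4 ^ card A * \<epsilon> * M\<^sup>2 * (P T * (P D)\<^sup>2) * N ^ (?v T + 2 * ?m)) * Q A"
      unfolding PP by (simp add: mult_ac)
    finally show ?thesis using Q0[OF sub(4)] by simp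
  qed
qed

section \<open>Walsh expansion of the error terms\<close>

context walsh_polynomial
begin

abbreviation (input) I_at :: "'e \<Rightarrow> 'i set" where "I_at e \<equiv> {i\<in>I. e \<in> S i}"

text \<open>A term of \<open>Y e * D e\<close>, expanded by \<open>walsh_mult\<close>: the edge \<open>e\<close>, the two indices and the set of common
  coordinates, other than \<open>e\<close>, where the linear term is chosen.\<close>

definition quads :: "('e \<times> 'i \<times> 'i \<times> 'e set) set" where
  "quads = (SIGMA e:U. SIGMA i:I_at e. SIGMA j:I_at e. Pow (S i \<inter> S j - {e}))"

definition diff_set :: "'i \<Rightarrow> 'i \<Rightarrow> 'e set" where
  "diff_set i j = (S i - S j) \<union> (S j - S i)"

definition contr :: "'e \<Rightarrow> 'i \<Rightarrow> 'i \<Rightarrow> 'e set \<Rightarrow> real" where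
  "contr e i j A = (\<Prod>f\<in>A. 1 - 2 * r f) * (\<Prod>f\<in>S i \<inter> S j - {e} - A. var1 f)"

lemma finite_quads: "finite quads"
  unfolding quads_def using finite_U finite_I finite_S by (intro finite_SigmaI) auto

lemma product_at_edge:
  "(\<Sum>i\<in>I_at e. b i * walsh (S i - {e}) w) * (\<Sum>j\<in>I_at e. b' j * walsh (S j - {e}) w) =
   (\<Sum>i\<in>I_at e. \<Sum>j\<in>I_at e. \<Sum>A\<in>Pow (S i \<inter> S j - {e}). b i * b' j * contr e i j A * walsh (diff_set i j \<union> A) w)"
  unfolding sum_product
proof (intro sum.cong refl)
  fix i j assume i: "i \<in> I_at e" and j: "j \<in> I_at e"
  have fin: "finite (S i - {e})" "finite (S j - {e})" using i j finite_S by auto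
  have sets: "(S i - {e}) \<inter> (S j - {e}) = S i \<inter> S j - {e}"
      "(S i - {e}) - (S j - {e}) = S i - S j" "(S j - {e}) - (S i - {e}) = S j - S i"
    using i j by auto
  have "b i * walsh (S i - {e}) w * (b' j * walsh (S j - {e}) w) = b i * b' j * (walsh (S i - {e}) w * walsh (S j - {e}) w)"
    by (simp add: mult_ac)
  also have "\<dots> = (\<Sum>A\<in>Pow (S i \<inter> S j - {e}). b i * b' j * (contr e i j A * walsh (diff_set i j \<union> A) w))"
    unfolding walsh_mult[OF fin] sets contr_def diff_set_def by (rule sum_distrib_left)
  finally show "b i * walsh (S i - {e}) w * (b' j * walsh (S j - {e}) w) =
    (\<Sum>A\<in>Pow (S i \<inter> S j - {e}). b i * b' j * contr e i j A * walsh (diff_set i j \<union> A) w)"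
    by (simp add: mult.assoc)
qed

lemma sum_quads: "(\<Sum>(e, i, j, A)\<in>quads. g e i j A) =
   (\<Sum>e\<in>U. \<Sum>i\<in>I_at e. \<Sum>j\<in>I_at e. \<Sum>A\<in>Pow (S i \<inter> S j - {e}). g e i j A)"
proof -
  have "(\<Sum>e\<in>U. \<Sum>i\<in>I_at e. \<Sum>j\<in>I_at e. \<Sum>A\<in>Pow (S i \<inter> S j - {e}). g e i j A) =
     (\<Sum>e\<in>U. \<Sum>i\<in>I_at e. \<Sum>(j, A)\<in>(SIGMA j:I_at e. Pow (S i \<inter> S j - {e})). g e i j A)"
    by (intro sum.cong refl sum.Sigma) (use finite_I finite_S in auto)
  also have "\<dots> = (\<Sum>e\<in>U. \<Sum>(i, j, A)\<in>(SIGMA i:I_at e. SIGMA j:I_at e. Pow (S i \<inter> S j - {e})). g e i j A)"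
    by (intro sum.cong refl sum.Sigma) (use finite_I finite_S in auto)
  also have "\<dots> = (\<Sum>(e, i, j, A)\<in>quads. g e i j A)"
    unfolding quads_def by (rule sum.Sigma) (use finite_U finite_I finite_S in auto)
  finally show ?thesis by simp
qed

lemma sum_quads_at:
  assumes "e \<in> U"
  shows "(\<Sum>(e', i, j, A)\<in>{x\<in>quads. fst x = e}. g e' i j A) =
   (\<Sum>i\<in>I_at e. \<Sum>j\<in>I_at e. \<Sum>A\<in>Pow (S i \<inter> S j - {e}). g e i j A)"
proof -
  have "(\<Sum>(e', i, j, A)\<in>{x\<in>quads. fst x = e}. g e' i j A) =
     (\<Sum>x\<in>quads. if fst x = e then case x of (e', i, j, A) \<Rightarrow> g e' i j A else 0)"
    by (rule sum.inter_filter[OF finite_quads])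
  also have "\<dots> = (\<Sum>(e', i, j, A)\<in>quads. if e' = e then g e' i j A else 0)"
    by (intro sum.cong) auto
  also have "\<dots> = (\<Sum>e'\<in>U. if e' = e then (\<Sum>i\<in>I_at e'. \<Sum>j\<in>I_at e'. \<Sum>A\<in>Pow (S i \<inter> S j - {e'}). g e' i j A) else 0)"
    unfolding sum_quads by (intro sum.cong) auto
  also have "\<dots> = (\<Sum>i\<in>I_at e. \<Sum>j\<in>I_at e. \<Sum>A\<in>Pow (S i \<inter> S j - {e}). g e i j A)"
    using assms finite_U by simp
  finally show ?thesis .
qed

lemma diff_set_sub: "x = (e, i, j, A) \<Longrightarrow> x \<in> quads \<Longrightarrow> diff_set i j \<union> A \<subseteq> U \<and> e \<notin> diff_set i j \<union> A \<and> finite (diff_set i j \<union> A)"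
  unfolding quads_def diff_set_def using S_sub finite_S by (auto intro: finite_subset)

definition gcoef :: "('e \<times> 'i \<times> 'i \<times> 'e set) \<Rightarrow> real" where
  "gcoef = (\<lambda>(e, i, j, A). var1 e * (a i / real (card (S i))) * a j * contr e i j A)"

definition gset :: "('e \<times> 'i \<times> 'i \<times> 'e set) \<Rightarrow> 'e set" where
  "gset = (\<lambda>(e, i, j, A). diff_set i j \<union> A)"

lemma Ex_walsh_empty: "Ex (walsh {}) = 1"
proof -
  have "walsh {} = (\<lambda>_. 1)" by auto
  then show ?thesis by simp
qed

text \<open>The terms with the empty set are constant, so they make up the mean.\<close>

lemma Gam_centered:
  "Gam w - Ex (\<lambda>w. (G w)\<^sup>2) = (\<Sum>x\<in>{x\<in>quads. gset x \<noteq> {}}. gcoef x * walsh (gset x) w)"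
proof -
  have Gam: "Gam w = (\<Sum>x\<in>quads. gcoef x * walsh (gset x) w)" for w
  proof -
    have "Gam w = (\<Sum>e\<in>U. \<Sum>i\<in>I_at e. \<Sum>j\<in>I_at e. \<Sum>A\<in>Pow (S i \<inter> S j - {e}).
        var1 e * ((a i / real (card (S i))) * a j * contr e i j A * walsh (diff_set i j \<union> A) w))"
      unfolding Gam_def Y_def D_def product_at_edge
      unfolding sum_distrib_left ..
    also have "\<dots> = (\<Sum>(e, i, j, A)\<in>quads. var1 e * ((a i / real (card (S i))) * a j * contr e i j A * walsh (diff_set i j \<union> A) w))"
      by (rule sum_quads[symmetric])
    also have "\<dots> = (\<Sum>x\<in>quads. gcoef x * walsh (gset x) w)"
      by (intro sum.cong refl) (auto simp: gcoef_def gset_def mult_ac)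
    finally show ?thesis .
  qed
  have split: "(\<Sum>x\<in>quads. h x) = (\<Sum>x\<in>{x\<in>quads. gset x \<noteq> {}}. h x) + (\<Sum>x\<in>{x\<in>quads. gset x = {}}. h x)" for h :: "_ \<Rightarrow> real"
    by (subst sum.union_disjoint[symmetric]) (auto intro!: sum.cong simp: finite_quads)
  have E0: "Ex (walsh (gset x)) = (if gset x = {} then 1 else 0)" if "x \<in> quads" for x
  proof -
    have "gset x \<subseteq> U" using diff_set_sub[OF _ that] by (cases x) (auto simp: gset_def)
    then show ?thesis using Ex_walsh[of "gset x"] Ex_walsh_empty by auto
  qed
  have "Ex Gam = (\<Sum>x\<in>quads. gcoef x * Ex (walsh (gset x)))"
    unfolding Gam by (simp add: Bochner_Integration.integral_sum)
  also have "\<dots> = (\<Sum>x\<in>{x\<in>quads. gset x = {}}. gcoef x)"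
    unfolding split by (simp add: E0 Ex_walsh_empty)
  finally have "Ex (\<lambda>w. (G w)\<^sup>2) = (\<Sum>x\<in>{x\<in>quads. gset x = {}}. gcoef x)"
    unfolding Ex_G_squared .
  moreover have "Gam w = (\<Sum>x\<in>{x\<in>quads. gset x \<noteq> {}}. gcoef x * walsh (gset x) w) + (\<Sum>x\<in>{x\<in>quads. gset x = {}}. gcoef x)"
    unfolding Gam split by simp
  ultimately show ?thesis by simp
qed

text \<open>This turns the weight \<open>var1 e\<close> into one more factor \<open>xi e\<close>, so that the weighted moments below become
  second moments of sums of Walsh functions.\<close>

lemma var1_Ex_squared:
  assumes "e \<in> U" and h: "\<And>w b. h (w(e := b)) = h w"
  shows "var1 e * Ex (\<lambda>w. (h w)\<^sup>2) = Ex (\<lambda>w. (xi e w * h w)\<^sup>2 :: real)"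
proof -
  have "Ex (\<lambda>w. (xi e w * h w)\<^sup>2) = Ex (\<lambda>w. xi e w *\<^sub>R (xi e w * (h w)\<^sup>2))"
    by (simp add: power2_eq_square mult_ac)
  also have "\<dots> = var1 e *\<^sub>R Ex (diff_at e (\<lambda>w. xi e w * (h w)\<^sup>2))"
    by (rule Ex_xi_mult[OF assms(1)])
  also have "diff_at e (\<lambda>w. xi e w * (h w)\<^sup>2) = (\<lambda>w. (h w)\<^sup>2)"
    by (auto simp: diff_at_def h xi_upd algebra_simps)
  finally show ?thesis by simp
qed

definition dcoef :: "('e \<times> 'i \<times> 'i \<times> 'e set) \<Rightarrow> real" where
  "dcoef = (\<lambda>(e, i, j, A). a i * a j * contr e i j A)"

definition dset :: "('e \<times> 'i \<times> 'i \<times> 'e set) \<Rightarrow> 'e set" where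
  "dset = (\<lambda>(e, i, j, A). insert e (diff_set i j \<union> A))"

lemma D_fourth_moment:
  assumes "e \<in> U"
  shows "var1 e * Ex (\<lambda>w. (D e w) ^ 4) = Ex (\<lambda>w. (\<Sum>x\<in>{x\<in>quads. fst x = e}. dcoef x * walsh (dset x) w)\<^sup>2)"
proof -
  have D2: "xi e w * (D e w)\<^sup>2 = (\<Sum>x\<in>{x\<in>quads. fst x = e}. dcoef x * walsh (dset x) w)" for w
  proof -
    have "xi e w * (D e w)\<^sup>2 = (\<Sum>i\<in>I_at e. \<Sum>j\<in>I_at e. \<Sum>A\<in>Pow (S i \<inter> S j - {e}).
        xi e w * (a i * a j * contr e i j A * walsh (diff_set i j \<union> A) w))"
      unfolding power2_eq_square D_def product_at_edge
      unfolding sum_distrib_left ..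
    also have "\<dots> = (\<Sum>(e', i, j, A)\<in>{x\<in>quads. fst x = e}. xi e' w * (a i * a j * contr e' i j A * walsh (diff_set i j \<union> A) w))"
      by (rule sum_quads_at[OF assms, symmetric])
    also have "\<dots> = (\<Sum>x\<in>{x\<in>quads. fst x = e}. dcoef x * walsh (dset x) w)"
    proof (intro sum.cong refl)
      fix x assume "x \<in> {x\<in>quads. fst x = e}"
      then obtain i j A where x: "x = (e, i, j, A)" "x \<in> quads" by (cases x) auto
      note s = diff_set_sub[OF x]
      have "walsh (dset x) w = xi e w * walsh (diff_set i j \<union> A) w"
        using s walsh_insert[of "diff_set i j \<union> A" e w] by (simp add: x(1) dset_def)
      then show "(case x of (e', i, j, A) \<Rightarrow> xi e' w * (a i * a j * contr e' i j A * walsh (diff_set i j \<union> A) w)) = dcoef x * walsh (dset x) w"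
        by (simp add: x(1) dcoef_def mult_ac)
    qed
    finally show ?thesis .
  qed
  have "var1 e * Ex (\<lambda>w. ((D e w)\<^sup>2)\<^sup>2) = Ex (\<lambda>w. (xi e w * (D e w)\<^sup>2)\<^sup>2)"
    by (rule var1_Ex_squared[OF assms]) (simp add: D_def walsh_upd)
  then show ?thesis unfolding D2 by simp
qed

lemma Y_second_moment:
  assumes "e \<in> U"
  shows "var1 e * Ex (\<lambda>w. (Y e w)\<^sup>2) =
    Ex (\<lambda>w. (\<Sum>x\<in>{x\<in>(SIGMA e:U. I_at e). fst x = e}. a (snd x) / real (card (S (snd x))) * walsh (S (snd x)) w)\<^sup>2)"
proof -
  have "xi e w * Y e w = (\<Sum>x\<in>{x\<in>(SIGMA e:U. I_at e). fst x = e}. a (snd x) / real (card (S (snd x))) * walsh (S (snd x)) w)" for w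
  proof -
    have "(\<Sum>x\<in>{x\<in>(SIGMA e:U. I_at e). fst x = e}. a (snd x) / real (card (S (snd x))) * walsh (S (snd x)) w) =
        (\<Sum>i\<in>I_at e. a i / real (card (S i)) * walsh (S i) w)"
      by (rule sum.reindex_bij_witness[of _ "\<lambda>i. (e, i)" snd]) (use assms in auto)
    also have "\<dots> = (\<Sum>i\<in>I_at e. a i / real (card (S i)) * (xi e w * walsh (S i - {e}) w))"
      by (intro sum.cong refl) (auto simp: walsh_remove[of "S _" e] finite_S)
    also have "\<dots> = xi e w * Y e w"
      unfolding Y_def sum_distrib_left by (intro sum.cong refl) (simp add: mult_ac)
    finally show ?thesis by simp
  qed
  moreover have "var1 e * Ex (\<lambda>w. (Y e w)\<^sup>2) = Ex (\<lambda>w. (xi e w * Y e w)\<^sup>2)"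
    by (rule var1_Ex_squared[OF assms]) (rule Y_upd)
  ultimately show ?thesis by simp
qed

text \<open>By \<open>\<bar>y\<bar> * d\<^sup>2 \<le> \<eta> / 2 * y\<^sup>2 + d ^ 4 / (2 * \<eta>)\<close>. The fourth moments will be of the order \<open>\<epsilon>\<close>, and \<open>\<eta>\<close> of the
  order \<open>sqrt \<epsilon>\<close>.\<close>

lemma third_order_le:
  assumes "\<eta> > 0"
  shows "third_order \<le> \<eta> / 2 * (\<Sum>e\<in>U. var1 e * Ex (\<lambda>w. (Y e w)\<^sup>2)) + 1 / (2 * \<eta>) * (\<Sum>e\<in>U. var1 e * Ex (\<lambda>w. (D e w) ^ 4))"
proof -
  have "third_order \<le> (\<Sum>e\<in>U. var1 e * (\<eta> / 2 * Ex (\<lambda>w. (Y e w)\<^sup>2) + 1 / (2 * \<eta>) * Ex (\<lambda>w. (D e w) ^ 4)))"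
    unfolding third_order_def
  proof (intro sum_mono mult_left_mono var1_nonneg)
    fix e
    have pt: "\<bar>y\<bar> * d\<^sup>2 \<le> \<eta> / 2 * y\<^sup>2 + 1 / (2 * \<eta>) * d ^ 4" for y d :: real
    proof -
      have "0 \<le> (\<eta> * \<bar>y\<bar> - d\<^sup>2)\<^sup>2 / (2 * \<eta>)" using assms by simp
      also have "\<dots> = \<eta> / 2 * y\<^sup>2 + 1 / (2 * \<eta>) * d ^ 4 - \<bar>y\<bar> * d\<^sup>2"
        using assms by (simp add: power2_diff power_mult_distrib field_simps power2_eq_square power4_eq_xxxx)
      finally show ?thesis by simp
    qed
    have "Ex (\<lambda>w. \<bar>Y e w\<bar> * (D e w)\<^sup>2) \<le> Ex (\<lambda>w. \<eta> / 2 * (Y e w)\<^sup>2 + 1 / (2 * \<eta>) * (D e w) ^ 4)"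
      by (rule Ex_mono) (rule pt)
    also have "\<dots> = \<eta> / 2 * Ex (\<lambda>w. (Y e w)\<^sup>2) + 1 / (2 * \<eta>) * Ex (\<lambda>w. (D e w) ^ 4)"
      by (subst Bochner_Integration.integral_add) simp_all
    finally show "Ex (\<lambda>w. \<bar>Y e w\<bar> * (D e w)\<^sup>2) \<le> \<eta> / 2 * Ex (\<lambda>w. (Y e w)\<^sup>2) + 1 / (2 * \<eta>) * Ex (\<lambda>w. (D e w) ^ 4)" .
  qed
  also have "\<dots> = \<eta> / 2 * (\<Sum>e\<in>U. var1 e * Ex (\<lambda>w. (Y e w)\<^sup>2)) + 1 / (2 * \<eta>) * (\<Sum>e\<in>U. var1 e * Ex (\<lambda>w. (D e w) ^ 4))"
    unfolding sum_distrib_left sum.distrib[symmetric] by (intro sum.cong refl) (simp only: ring_distribs mult_ac)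
  finally show ?thesis .
qed

end

section \<open>Random placements of a fixed edge set\<close>

definition wP :: "(nat \<Rightarrow> real) \<Rightarrow> 'b set set \<Rightarrow> real" where
  "wP p F = (\<Prod>e\<in>F. p (card e))"

definition wQ :: "(nat \<Rightarrow> real) \<Rightarrow> 'b set set \<Rightarrow> real" where
  "wQ p F = (\<Prod>e\<in>F. 1 - p (card e))"

text \<open>Up to constants and a factor common to all \<open>F\<close>, the variance of the part of the count that belongs to \<open>F\<close>.\<close>

definition psi :: "nat \<Rightarrow> (nat \<Rightarrow> real) \<Rightarrow> 'b set set \<Rightarrow> real" where
  "psi n p F = wQ p F / (wP p F * real n ^ card (\<Union>F))"

definition img :: "('a \<Rightarrow> 'b) \<Rightarrow> 'a set set \<Rightarrow> 'b set set" where
  "img \<phi> F = (`) \<phi> ` F"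

lemma Union_img: "\<Union>(img \<phi> F) = \<phi> ` \<Union>F"
  by (auto simp: img_def)

locale placement =
  fixes V :: "'a set" and E :: "'a set set" and n :: nat and p :: "nat \<Rightarrow> real"
  assumes finite_V: "finite V" and E_sub: "E \<subseteq> Pow V - {{}}" and E_ne: "E \<noteq> {}"
    and n_large: "2 * card V \<le> n" and p_bounds: "\<And>k. 1 \<le> k \<Longrightarrow> k \<le> n \<Longrightarrow> 0 < p k \<and> p k < 1"
begin

definition U :: "nat set set" where "U = Pow {1..n} - {{}}"

definition emb :: "('a \<Rightarrow> nat) set" where
  "emb = {\<phi> \<in> V \<rightarrow>\<^sub>E {1..n}. inj_on \<phi> V}"

lemma U_p: "e \<in> U \<Longrightarrow> 0 < p (card e) \<and> p (card e) < 1"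
proof -
  assume e: "e \<in> U"
  then have e': "finite e" "e \<noteq> {}" "e \<subseteq> {1..n}"
    by (auto simp: U_def intro: finite_subset)
  moreover have "card e \<le> card {1..n}" using e' by (intro card_mono) auto
  ultimately show ?thesis using p_bounds[of "card e"] by (simp add: Suc_le_eq card_gt_0_iff)
qed

lemma finite_E: "finite E"
  using E_sub finite_V by (meson finite_Diff finite_Pow_iff finite_subset)

lemma card_V_pos: "card V \<ge> 1"
proof -
  obtain e where "e \<in> E" using E_ne by auto
  then have "V \<noteq> {}" using E_sub by auto
  then show ?thesis using finite_V by (simp add: Suc_le_eq card_gt_0_iff)
qed

lemma n_pos: "n \<ge> 1" using card_V_pos n_large by simp

lemma E_p: "e \<in> E \<Longrightarrow> 0 < p (card e) \<and> p (card e) < 1"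
proof -
  assume e: "e \<in> E"
  have "finite e" "e \<noteq> {}" "card e \<le> card V"
    using e E_sub finite_V by (auto intro: finite_subset intro!: card_mono)
  then show ?thesis using p_bounds[of "card e"] n_large by (simp add: Suc_le_eq card_gt_0_iff)
qed

sublocale bernoulli_product U "\<lambda>e. p (card e)"
  by unfold_locales (use U_p in \<open>auto simp: U_def less_imp_le\<close>)

lemma finite_emb: "finite emb"
  unfolding emb_def using finite_V by (intro finite_subset[OF _ finite_PiE[of V "\<lambda>_. {1..n}"]]) auto

lemma emb_inj: "\<phi> \<in> emb \<Longrightarrow> inj_on \<phi> V" by (simp add: emb_def)

lemma emb_image: "\<phi> \<in> emb \<Longrightarrow> \<phi> ` V \<subseteq> {1..n} \<and> card (\<phi> ` V) = card V"
  by (auto simp: emb_def card_image PiE_iff)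

lemma img_inj: "\<phi> \<in> emb \<Longrightarrow> inj_on ((`) \<phi>) (Pow V)"
  using emb_inj inj_on_image_Pow by blast

lemma img_sub: "\<phi> \<in> emb \<Longrightarrow> F \<subseteq> E \<Longrightarrow> img \<phi> F \<subseteq> U"
  using emb_image[of \<phi>] E_sub unfolding img_def U_def by blast

lemma img_Union_sub: "F \<subseteq> E \<Longrightarrow> \<Union>(img \<phi> F) \<subseteq> \<phi> ` V"
  unfolding Union_img using E_sub by blast

lemma img_weights:
  assumes "\<phi> \<in> emb" "F \<subseteq> E"
  shows "wP p (img \<phi> F) = wP p F" "wQ p (img \<phi> F) = wQ p F" "card (\<Union>(img \<phi> F)) = card (\<Union>F)" "psi n p (img \<phi> F) = psi n p F"
proof -
  have i: "inj_on ((`) \<phi>) F" using img_inj[OF assms(1)] assms(2) E_sub by (auto intro: inj_on_subset)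
  have c: "card (\<phi> ` e) = card e" if "e \<in> F" for e
    using that assms(2) E_sub by (intro card_image inj_on_subset[OF emb_inj[OF assms(1)]]) auto
  show P: "wP p (img \<phi> F) = wP p F" unfolding wP_def img_def prod.reindex[OF i] by (simp add: c)
  show Q: "wQ p (img \<phi> F) = wQ p F" unfolding wQ_def img_def prod.reindex[OF i] by (simp add: c)
  show R: "card (\<Union>(img \<phi> F)) = card (\<Union>F)"
    unfolding Union_img using assms E_sub by (intro card_image inj_on_subset[OF emb_inj[OF assms(1)]]) auto
  show "psi n p (img \<phi> F) = psi n p F" unfolding psi_def P Q R ..
qed

lemma wP_pos: "F \<subseteq> E \<Longrightarrow> 0 < wP p F" unfolding wP_def using E_p by (intro prod_pos) auto
lemma wQ_pos: "F \<subseteq> E \<Longrightarrow> 0 < wQ p F" unfolding wQ_def using E_p by (intro prod_pos) auto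

lemma prod_var1: "(\<Prod>e\<in>T. var1 e) = wP p T * wQ p T"
  by (simp add: var1_def wP_def wQ_def prod.distrib)

end

text \<open>A crude bound for the number of pairs of placements, with marked edges, that cover a given
  vertex set.\<close>

definition pair_count :: "'a set \<Rightarrow> 'a set set \<Rightarrow> nat" where
  "pair_count V E = 2 ^ (2 * card V) * ((((2 * card V) ^ card V * 2 ^ card E) * ((2 * card V) ^ card V * 2 ^ card E)) * 2 ^ (2 ^ (2 * card V)))"

lemma card_marked_pairs_le:
  assumes "finite V" "finite E" "finite B" "card B \<le> 2 * card V"
  shows "finite (Pow B \<times> (((V \<rightarrow>\<^sub>E B) \<times> Pow E) \<times> ((V \<rightarrow>\<^sub>E B) \<times> Pow E)) \<times> Pow (Pow B))"
    "card (Pow B \<times> (((V \<rightarrow>\<^sub>E B) \<times> Pow E) \<times> ((V \<rightarrow>\<^sub>E B) \<times> Pow E)) \<times> Pow (Pow B)) \<le> pair_count V E"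
proof -
  show "finite (Pow B \<times> (((V \<rightarrow>\<^sub>E B) \<times> Pow E) \<times> ((V \<rightarrow>\<^sub>E B) \<times> Pow E)) \<times> Pow (Pow B))"
    using assms by (intro finite_cartesian_product finite_PiE finite_Pow_iff[THEN iffD2]) auto
  show "card (Pow B \<times> (((V \<rightarrow>\<^sub>E B) \<times> Pow E) \<times> ((V \<rightarrow>\<^sub>E B) \<times> Pow E)) \<times> Pow (Pow B)) \<le> pair_count V E"
    unfolding card_cartesian_product card_Pow[OF assms(2)] card_Pow[OF assms(3)]
      card_funcsetE[OF assms(1)] card_Pow[OF finite_Pow_iff[THEN iffD2, OF assms(3)]] pair_count_def
    using assms(4) by (intro mult_le_mono power_mono power_increasing) auto
qed

text \<open>A combination of the sums over placements of the sets in \<open>Fs\<close>, with coefficients of the size they have in the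
  standardised count: there \<open>M\<close> is the largest \<open>psi\<close>. All smallness is measured by \<open>\<epsilon>\<close>; the
  constants in the conclusions depend on \<open>V\<close>, \<open>E\<close> and \<open>K\<close> only.\<close>

locale placement_family = placement V E n p
  for V :: "'a set" and E n p +
  fixes Fs :: "'a set set set" and coef :: "'a set set \<Rightarrow> real" and K M \<epsilon> :: real
  assumes Fs_sub: "Fs \<subseteq> Pow E - {{}}" and K_nonneg: "0 \<le> K"
    and coef_bound: "\<And>F. F \<in> Fs \<Longrightarrow> (coef F)\<^sup>2 * (wP p F)\<^sup>2 * M * real n ^ (2 * card V) \<le> K"
    and psi_le: "\<And>B. B \<noteq> {} \<Longrightarrow> B \<subseteq> E \<Longrightarrow> psi n p B \<le> M"
    and dense: "\<And>B. B \<noteq> {} \<Longrightarrow> B \<subseteq> E \<Longrightarrow> 1 \<le> \<epsilon> * (real n ^ card (\<Union>B) * wP p B)"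
    and good: "\<And>F e. F \<in> Fs \<Longrightarrow> e \<in> F \<Longrightarrow> 1 / 2 \<le> p (card e) \<Longrightarrow> 1 \<le> \<epsilon> * (real n ^ card e * (1 - p (card e)))"
    and eps_n: "1 \<le> \<epsilon> * real n"
begin

lemma Fs_E: "F \<in> Fs \<Longrightarrow> F \<subseteq> E" "F \<in> Fs \<Longrightarrow> F \<noteq> {}"
  using Fs_sub by auto

sublocale walsh_polynomial U "\<lambda>e. p (card e)" "emb \<times> Fs" "\<lambda>i. coef (snd i)" "\<lambda>i. img (fst i) (snd i)"
proof unfold_locales
  have "finite Fs" using Fs_sub finite_E by (meson finite_Diff finite_Pow_iff finite_subset)
  then show "finite (emb \<times> Fs)" using finite_emb by simp
  show "\<And>i. i \<in> emb \<times> Fs \<Longrightarrow> img (fst i) (snd i) \<subseteq> U" using img_sub Fs_E by (metis mem_Times_iff)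
  show "\<And>i. i \<in> emb \<times> Fs \<Longrightarrow> img (fst i) (snd i) \<noteq> {}" using Fs_E by (auto simp: img_def)
qed

lemma eps_pos: "0 < \<epsilon>"
  using eps_n n_pos by (smt (verit) mult_nonpos_nonneg of_nat_0_le_iff)

lemma M_pos: "0 < M"
proof -
  have "0 < psi n p E" unfolding psi_def using wP_pos[of E] wQ_pos[of E] n_pos by simp
  then show ?thesis using psi_le[of E] E_ne by simp
qed

text \<open>\<open>overlap_weight_le\<close> in the form needed for \<open>labelled_second_moment_le\<close>: the two placements together
  occupy \<open>2 * card V\<close> vertices minus the shared ones, which are at least the vertices common to \<open>\<Union>S\<close> and \<open>\<Union>S'\<close>.\<close>

lemma pair_bound:
  assumes i: "i \<in> emb \<times> Fs" and j: "j \<in> emb \<times> Fs"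
  defines "S \<equiv> img (fst i) (snd i)" and "S' \<equiv> img (fst j) (snd j)"
  assumes A: "A \<subseteq> S \<inter> S'" and D_ne: "S \<inter> S' \<noteq> {}"
  defines "T \<equiv> (S - S') \<union> (S' - S) \<union> A"
  assumes T_ne: "T \<noteq> {}" and c: "\<bar>c\<bar> \<le> \<bar>coef (snd i) * coef (snd j)\<bar> * (\<Prod>e\<in>S \<inter> S' - A. var1 e)"
  shows "c\<^sup>2 * (\<Prod>e\<in>T. var1 e) * real n ^ (2 * card (fst i ` V \<union> fst j ` V)) \<le> 4 ^ card E * \<epsilon> * K\<^sup>2 * real n ^ card (\<Union>T)"
proof -
  define \<phi> where "\<phi> = fst i"
  define F where "F = snd i"
  define \<phi>' where "\<phi>' = fst j"
  define F' where "F' = snd j"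
  have \<phi>: "\<phi> \<in> emb" "\<phi>' \<in> emb" and F: "F \<in> Fs" "F' \<in> Fs" "F \<subseteq> E" "F' \<subseteq> E"
    using i j Fs_E by (auto simp: \<phi>_def \<phi>'_def F_def F'_def mem_Times_iff)
  have S: "S = img \<phi> F" "S' = img \<phi>' F'" by (simp_all add: S_def S'_def \<phi>_def \<phi>'_def F_def F'_def)
  define D where "D = S \<inter> S'"
  define R where "R = D - A"
  define N where "N = real n"
  let ?P = "wP p" and ?Q = "wQ p"
  let ?m = "card (\<Union>S \<inter> \<Union>S')"
  have N1: "1 \<le> N" using n_pos by (simp add: N_def)
  have SU: "S \<subseteq> U" "S' \<subseteq> U" using img_sub \<phi> F by (auto simp: S)
  have finS: "finite S" "finite S'" using finite_subset[OF SU(1) finite_U] finite_subset[OF SU(2) finite_U] .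
  have sub_img: "\<exists>B'\<subseteq>E. B' \<noteq> {} \<and> wP p B = wP p B' \<and> psi n p B = psi n p B' \<and> card (\<Union>B) = card (\<Union>B')"
    if B: "B \<noteq> {}" "B \<subseteq> S \<or> B \<subseteq> S'" for B
  proof -
    obtain \<theta> H where "\<theta> \<in> emb" "H \<subseteq> E" "B \<subseteq> img \<theta> H" using B \<phi> F S by blast
    then obtain B' where "B' \<subseteq> H" "B = img \<theta> B'" by (auto simp: img_def subset_image_iff)
    then show ?thesis using img_weights[OF \<open>\<theta> \<in> emb\<close>, of B'] \<open>H \<subseteq> E\<close> B(1)
      by (intro exI[of _ B']) (auto simp: img_def)
  qed
  have good': "1 \<le> \<epsilon> * (N ^ card e * (1 - p (card e)))" if e: "e \<in> S \<union> S'" "1 / 2 \<le> p (card e)" for e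
  proof -
    obtain \<theta> H f where th: "\<theta> \<in> emb" "H \<in> Fs" "f \<in> H" "e = \<theta> ` f" using e(1) \<phi> F S by (auto simp: img_def)
    then have "f \<subseteq> V" using Fs_E E_sub by blast
    then have "card e = card f" using th by (auto intro!: card_image inj_on_subset[OF emb_inj])
    then show ?thesis using good[OF th(2,3)] e(2) by (simp add: N_def)
  qed
  have psiB: "psi n p B \<le> M" and denseB: "1 \<le> \<epsilon> * (real n ^ card (\<Union>B) * wP p B)"
    if B: "B \<noteq> {}" "B \<subseteq> S \<or> B \<subseteq> S'" for B
  proof -
    obtain B' where B': "B' \<subseteq> E" "B' \<noteq> {}" "wP p B = wP p B'" "psi n p B = psi n p B'" "card (\<Union>B) = card (\<Union>B')"
      using sub_img[OF B] by blast
    show "psi n p B \<le> M" unfolding B'(4) by (rule psi_le[OF B'(2,1)])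
    show "1 \<le> \<epsilon> * (real n ^ card (\<Union>B) * wP p B)" unfolding B'(3,5) by (rule dense[OF B'(2,1)])
  qed
  have tau: "?Q T * (?Q R)\<^sup>2 \<le> 4 ^ card A * \<epsilon> * M\<^sup>2 * (?P T * (?P D)\<^sup>2) * N ^ (card (\<Union>T) + 2 * ?m)"
    unfolding T_def R_def D_def wP_def wQ_def
  proof (rule overlap_weight_le)
    show "\<And>e. e \<in> S \<union> S' \<Longrightarrow> finite e" using SU by (auto simp: U_def intro: finite_subset)
    show "\<And>e. e \<in> S \<union> S' \<Longrightarrow> 0 < p (card e) \<and> p (card e) < 1" using SU U_p by blast
    show "1 \<le> \<epsilon> * N" using eps_n by (simp add: N_def)
    show "(\<Prod>e\<in>B. 1 - p (card e)) / ((\<Prod>e\<in>B. p (card e)) * N ^ card (\<Union>B)) \<le> M" if "B \<noteq> {}" "B \<subseteq> S \<or> B \<subseteq> S'" for B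
      using psiB[OF that] by (simp only: psi_def wP_def wQ_def N_def)
    show "1 \<le> \<epsilon> * (N ^ card (\<Union>B) * (\<Prod>e\<in>B. p (card e)))" if "B \<noteq> {}" "B \<subseteq> S \<or> B \<subseteq> S'" for B
      using denseB[OF that] by (simp only: wP_def N_def)
  qed (use finS N1 A D_ne T_ne good' in \<open>auto simp: T_def\<close>)
  have cA: "card A \<le> card E"
  proof -
    have "card A \<le> card S" using A finS by (intro card_mono) auto
    also have "\<dots> \<le> card F" unfolding S img_def using F finite_E by (intro card_image_le) (auto intro: finite_subset)
    also have "\<dots> \<le> card E" using F finite_E by (intro card_mono) auto
    finally show ?thesis .
  qed
  have W: "0 < ?P B" "0 < ?Q B" if "B \<subseteq> S \<union> S'" for B
  proof -
    have BU: "B \<subseteq> U" using that SU by blast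
    have "0 < p (card e)" "0 < 1 - p (card e)" if "e \<in> B" for e using U_p[of e] that BU by auto
    then show "0 < ?P B" "0 < ?Q B" unfolding wP_def wQ_def by (auto intro!: prod_pos)
  qed
  have subs: "T \<subseteq> S \<union> S'" "R \<subseteq> S \<union> S'" "D \<subseteq> S \<union> S'" "A \<subseteq> S \<union> S'" using A by (auto simp: T_def R_def D_def)
  have PP: "?P T * ?P D * ?P R = ?P S * ?P S'"
  proof -
    have fin: "finite (S - S')" "finite (S' - S)" "finite D" "finite A" "finite R"
      using finS A by (auto simp: D_def R_def intro: finite_subset)
    have "?P S = ?P (S - S') * ?P D" "?P S' = ?P (S' - S) * ?P D"
      unfolding wP_def D_def using finS by (subst prod.union_disjoint[symmetric]; auto intro!: prod.cong)+
    moreover have "?P T = ?P (S - S') * ?P (S' - S) * ?P A"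
      unfolding wP_def T_def using fin A by (subst prod.union_disjoint; (subst prod.union_disjoint)?) auto
    moreover have "?P D = ?P A * ?P R"
      unfolding wP_def R_def using fin A by (subst prod.union_disjoint[symmetric]) (auto intro!: prod.cong simp: D_def)
    ultimately show ?thesis by (simp add: mult_ac)
  qed
  have expo: "2 * ?m + 2 * card (\<phi> ` V \<union> \<phi>' ` V) \<le> 4 * card V"
  proof -
    have "card (\<phi> ` V \<union> \<phi>' ` V) + card (\<phi> ` V \<inter> \<phi>' ` V) = card (\<phi> ` V) + card (\<phi>' ` V)"
      by (rule card_Un_Int[symmetric]) (use finite_V in auto)
    moreover have "?m \<le> card (\<phi> ` V \<inter> \<phi>' ` V)"
      unfolding S using finite_V by (intro card_mono Int_mono img_Union_sub F) auto
    ultimately show ?thesis using emb_image \<phi> by simp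
  qed
  have cs: "c\<^sup>2 \<le> (coef F)\<^sup>2 * (coef F')\<^sup>2 * (?P R * ?Q R)\<^sup>2"
  proof -
    have "0 \<le> ?P R * ?Q R" using W[OF subs(2)] by simp
    then have "\<bar>c\<bar> \<le> \<bar>coef F * coef F' * (?P R * ?Q R)\<bar>"
    proof -
      have "\<bar>y\<bar> \<le> \<bar>x\<bar> * z \<Longrightarrow> 0 \<le> z \<Longrightarrow> \<bar>y\<bar> \<le> \<bar>x * z\<bar>" for x y z :: real by (simp add: abs_mult)
      from this[OF c] show ?thesis
        using \<open>0 \<le> ?P R * ?Q R\<close> unfolding prod_var1 R_def D_def F_def F'_def .
    qed
    then show ?thesis by (simp only: power_mult_distrib[symmetric] abs_le_square_iff)
  qed
  have "c\<^sup>2 * (?P T * ?Q T) * N ^ (2 * card (\<phi> ` V \<union> \<phi>' ` V))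
      \<le> (coef F)\<^sup>2 * (coef F')\<^sup>2 * (?P R * ?Q R)\<^sup>2 * (?P T * ?Q T) * N ^ (2 * card (\<phi> ` V \<union> \<phi>' ` V))"
    using W[OF subs(1)] N1 cs by (intro mult_right_mono) auto
  also have "\<dots> = (coef F)\<^sup>2 * (coef F')\<^sup>2 * (?P R)\<^sup>2 * ?P T * N ^ (2 * card (\<phi> ` V \<union> \<phi>' ` V)) * (?Q T * (?Q R)\<^sup>2)"
    by (simp add: power_mult_distrib mult_ac)
  also have "\<dots> \<le> (coef F)\<^sup>2 * (coef F')\<^sup>2 * (?P R)\<^sup>2 * ?P T * N ^ (2 * card (\<phi> ` V \<union> \<phi>' ` V)) *
      (4 ^ card A * \<epsilon> * M\<^sup>2 * (?P T * (?P D)\<^sup>2) * N ^ (card (\<Union>T) + 2 * ?m))"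
    using W[OF subs(1)] N1 by (intro mult_left_mono tau) auto
  also have "\<dots> = (coef F)\<^sup>2 * (coef F')\<^sup>2 * (?P T * ?P D * ?P R)\<^sup>2 * 4 ^ card A * \<epsilon> * M\<^sup>2 * N ^ card (\<Union>T) *
      N ^ (2 * ?m + 2 * card (\<phi> ` V \<union> \<phi>' ` V))"
    by (simp add: power_add power_mult_distrib power2_eq_square mult_ac)
  also have "\<dots> \<le> (coef F)\<^sup>2 * (coef F')\<^sup>2 * (?P T * ?P D * ?P R)\<^sup>2 * 4 ^ card A * \<epsilon> * M\<^sup>2 * N ^ card (\<Union>T) * N ^ (4 * card V)"
    using eps_pos N1 by (intro mult_left_mono power_increasing expo) auto
  also have "\<dots> = 4 ^ card A * \<epsilon> * N ^ card (\<Union>T) * (((coef F)\<^sup>2 * (?P S)\<^sup>2 * M * N ^ (2 * card V)) * ((coef F')\<^sup>2 * (?P S')\<^sup>2 * M * N ^ (2 * card V)))"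
  proof -
    have "4 * card V = 2 * card V + 2 * card V" by simp
    then have "N ^ (4 * card V) = N ^ (2 * card V) * N ^ (2 * card V)" by (simp only: power_add)
    then show ?thesis unfolding PP by (simp only:) (simp add: power_mult_distrib power2_eq_square mult_ac)
  qed
  also have "\<dots> \<le> 4 ^ card A * \<epsilon> * N ^ card (\<Union>T) * (K * K)"
  proof (intro mult_left_mono mult_mono)
    show "(coef F)\<^sup>2 * (?P S)\<^sup>2 * M * N ^ (2 * card V) \<le> K" "(coef F')\<^sup>2 * (?P S')\<^sup>2 * M * N ^ (2 * card V) \<le> K"
      using coef_bound F img_weights(1) \<phi> by (auto simp: S N_def)
  qed (use K_nonneg M_pos N1 eps_pos in auto)
  also have "\<dots> \<le> 4 ^ card E * \<epsilon> * N ^ card (\<Union>T) * (K * K)"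
    using cA eps_pos N1 K_nonneg by (intro mult_right_mono power_increasing) auto
  finally show ?thesis unfolding prod_var1 N_def \<phi>_def \<phi>'_def by (simp add: power2_eq_square mult_ac)
qed

definition cover :: "(nat set \<times> (('a \<Rightarrow> nat) \<times> 'a set set) \<times> (('a \<Rightarrow> nat) \<times> 'a set set) \<times> nat set set) \<Rightarrow> nat set" where
  "cover = (\<lambda>(e, i, j, A). fst i ` V \<union> fst j ` V)"

lemma emb_PiE: "\<phi> \<in> emb \<Longrightarrow> \<phi> ` V \<subseteq> B \<Longrightarrow> \<phi> \<in> V \<rightarrow>\<^sub>E B"
  unfolding emb_def by (auto simp: PiE_iff)

lemma cover_bounds: "x \<in> quads \<Longrightarrow> cover x \<subseteq> {1..n} \<and> card (cover x) \<le> 2 * card V"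
proof -
  assume "x \<in> quads"
  then obtain e i j A where x: "x = (e, i, j, A)" "i \<in> emb \<times> Fs" "j \<in> emb \<times> Fs" by (auto simp: quads_def)
  then have "fst i \<in> emb" "fst j \<in> emb" by auto
  then show ?thesis using emb_image[of "fst i"] emb_image[of "fst j"] card_Un_le[of "fst i ` V" "fst j ` V"]
    by (auto simp: x(1) cover_def)
qed

lemma cover_count: "card {x \<in> quads. cover x = B} \<le> pair_count V E"
proof (cases "{x \<in> quads. cover x = B} = {}")
  case False
  then obtain x where "x \<in> quads" "cover x = B" by auto
  then have B: "finite B" "card B \<le> 2 * card V" using cover_bounds[of x] by (auto intro: finite_subset)
  let ?T = "Pow B \<times> (((V \<rightarrow>\<^sub>E B) \<times> Pow E) \<times> ((V \<rightarrow>\<^sub>E B) \<times> Pow E)) \<times> Pow (Pow B)"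
  note T = card_marked_pairs_le[OF finite_V finite_E B]
  have "card {x \<in> quads. cover x = B} \<le> card ?T"
  proof (rule card_inj_on_le[where f = "\<lambda>(e, i, j, A). (e, (i, j), A)"])
    show "inj_on (\<lambda>(e, i, j, A). (e, (i, j), A)) {x \<in> quads. cover x = B}" by (rule inj_onI) auto
    show "(\<lambda>(e, i, j, A). (e, (i, j), A)) ` {x \<in> quads. cover x = B} \<subseteq> ?T"
    proof
      fix y assume "y \<in> (\<lambda>(e, i, j, A). (e, (i, j), A)) ` {x \<in> quads. cover x = B}"
      then obtain e \<phi> F \<phi>' F' A where y: "y = (e, ((\<phi>, F), (\<phi>', F')), A)"
        and q: "(e, (\<phi>, F), (\<phi>', F'), A) \<in> quads" and c: "cover (e, (\<phi>, F), (\<phi>', F'), A) = B"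
        by (auto split: prod.splits)
      have m: "\<phi> \<in> emb" "\<phi>' \<in> emb" "F \<subseteq> E" "F' \<subseteq> E" "e \<in> img \<phi> F" "A \<subseteq> img \<phi> F"
        using q Fs_E(1)[of F] Fs_E(1)[of F'] by (auto simp: quads_def)
      have sub: "\<phi> ` V \<subseteq> B" "\<phi>' ` V \<subseteq> B" using c by (auto simp: cover_def)
      have "img \<phi> F \<subseteq> Pow B" using img_Union_sub[OF m(3), of \<phi>] sub(1) by blast
      then show "y \<in> ?T" unfolding y using m emb_PiE sub by auto
    qed
    show "finite ?T" by (rule T(1))
  qed
  then show ?thesis using T(2) by simp
next
  case True
  then show ?thesis by (simp only: card.empty)
qed

definition clt_const :: real where
  "clt_const = (real (2 * card V + 1) * real (pair_count V E))\<^sup>2 * (K + 4 ^ card E * K\<^sup>2)"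

lemma abs_prod_le_one:
  assumes "A \<subseteq> U" shows "\<bar>\<Prod>f\<in>A. 1 - 2 * p (card f)\<bar> \<le> 1"
  unfolding abs_prod
proof (rule prod_le_1)
  fix f assume "f \<in> A"
  then show "0 \<le> \<bar>1 - 2 * p (card f)\<bar> \<and> \<bar>1 - 2 * p (card f)\<bar> \<le> 1" using U_p[of f] assms by (auto simp: abs_le_iff)
qed

lemma quads_cases:
  assumes "x \<in> quads"
  obtains e i j A where "x = (e, i, j, A)" "i \<in> emb \<times> Fs" "j \<in> emb \<times> Fs" "e \<in> img (fst i) (snd i)" "e \<in> img (fst j) (snd j)"
    "A \<subseteq> img (fst i) (snd i) \<inter> img (fst j) (snd j) - {e}" "e \<in> U"
  using assms unfolding quads_def by blast

lemma cover_diff_set: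
  assumes "i \<in> emb \<times> Fs" "j \<in> emb \<times> Fs" "A \<subseteq> img (fst i) (snd i) \<inter> img (fst j) (snd j)"
  shows "diff_set i j \<union> A \<subseteq> U" "\<Union>(diff_set i j \<union> A) \<subseteq> fst i ` V \<union> fst j ` V"
proof -
  have F: "snd i \<subseteq> E" "snd j \<subseteq> E" using assms Fs_E(1) by (metis mem_Times_iff)+
  have s: "diff_set i j \<union> A \<subseteq> img (fst i) (snd i) \<union> img (fst j) (snd j)"
    using assms(3) by (auto simp: diff_set_def)
  then show "diff_set i j \<union> A \<subseteq> U" using S_sub[OF assms(1)] S_sub[OF assms(2)] by blast
  show "\<Union>(diff_set i j \<union> A) \<subseteq> fst i ` V \<union> fst j ` V"
  proof (rule order_trans[OF Union_mono[OF s]])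
    show "\<Union>(img (fst i) (snd i) \<union> img (fst j) (snd j)) \<subseteq> fst i ` V \<union> fst j ` V"
      unfolding Union_Un_distrib by (intro Un_mono img_Union_sub F)
  qed
qed

text \<open>In the expansion of \<open>Gam\<close> the marked edge \<open>e\<close> belongs to the common edges where the constant term
  is chosen; in that of the fourth moments, the factor \<open>xi e\<close> moves it to those where the linear
  term is chosen. Both are instances of \<open>pair_bound\<close>.\<close>

lemma second_moments:
  defines "c0 \<equiv> (real (2 * card V + 1) * real (pair_count V E))\<^sup>2"
  shows Gam_variance: "Ex (\<lambda>w. (Gam w - Ex (\<lambda>w. (G w)\<^sup>2))\<^sup>2) \<le> c0 * (4 ^ card E * \<epsilon> * K\<^sup>2)"
    and D_moment: "(\<Sum>e\<in>U. var1 e * Ex (\<lambda>w. (D e w) ^ 4)) \<le> c0 * (4 ^ card E * \<epsilon> * K\<^sup>2)"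
proof -
  have K0: "0 \<le> 4 ^ card E * \<epsilon> * K\<^sup>2" using eps_pos by simp
  have contr: "\<bar>contr e i j A\<bar> \<le> (\<Prod>f\<in>img (fst i) (snd i) \<inter> img (fst j) (snd j) - {e} - A. var1 f)"
    if ij: "i \<in> emb \<times> Fs" "j \<in> emb \<times> Fs" "A \<subseteq> img (fst i) (snd i) \<inter> img (fst j) (snd j) - {e}" for e i j A
  proof -
    have iU: "img (fst i) (snd i) \<subseteq> U" using ij S_sub[of i] by simp
    have v0: "0 \<le> (\<Prod>f\<in>img (fst i) (snd i) \<inter> img (fst j) (snd j) - {e} - A. var1 f)"
      using iU by (intro prod_nonneg var1_nonneg) auto
    have "\<bar>\<Prod>f\<in>A. 1 - 2 * p (card f)\<bar> * (\<Prod>f\<in>img (fst i) (snd i) \<inter> img (fst j) (snd j) - {e} - A. var1 f)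
       \<le> 1 * (\<Prod>f\<in>img (fst i) (snd i) \<inter> img (fst j) (snd j) - {e} - A. var1 f)"
      by (intro mult_right_mono abs_prod_le_one v0) (use ij iU in auto)
    then show ?thesis unfolding contr_def abs_mult using v0 by simp
  qed
  show "Ex (\<lambda>w. (Gam w - Ex (\<lambda>w. (G w)\<^sup>2))\<^sup>2) \<le> c0 * (4 ^ card E * \<epsilon> * K\<^sup>2)"
  proof -
    let ?X = "{x \<in> quads. gset x \<noteq> {}}"
    have "(\<Sum>l\<in>{()}. Ex (\<lambda>w. (\<Sum>x\<in>{x\<in>?X. () = l}. gcoef x * walsh (gset x) w)\<^sup>2)) \<le> c0 * (4 ^ card E * \<epsilon> * K\<^sup>2)"
      unfolding c0_def
    proof (rule labelled_second_moment_le[where Y = cover, OF bernoulli_product_axioms])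
      show "finite ?X" using finite_quads by simp
      show "n \<ge> 1" by (rule n_pos)
      show "0 \<le> 4 ^ card E * \<epsilon> * K\<^sup>2" by (rule K0)
      fix x assume "x \<in> ?X"
      then have x: "x \<in> quads" "gset x \<noteq> {}" by auto
      show "cover x \<subseteq> {1..n} \<and> card (cover x) \<le> 2 * card V" by (rule cover_bounds[OF x(1)])
      obtain e i j A where q: "x = (e, i, j, A)" "i \<in> emb \<times> Fs" "j \<in> emb \<times> Fs" "e \<in> img (fst i) (snd i)" "e \<in> img (fst j) (snd j)"
        "A \<subseteq> img (fst i) (snd i) \<inter> img (fst j) (snd j) - {e}" "e \<in> U" by (rule quads_cases[OF x(1)])
      have A': "A \<subseteq> img (fst i) (snd i) \<inter> img (fst j) (snd j)" using q(6) by auto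
      show "gset x \<subseteq> U \<and> \<Union>(gset x) \<subseteq> cover x"
        using cover_diff_set[OF q(2,3) A'] by (simp add: q(1) gset_def cover_def)
      let ?D = "img (fst i) (snd i) \<inter> img (fst j) (snd j)"
      have finD: "finite ?D" using q(2) finite_S[of i] by auto
      have R: "(\<Prod>f\<in>?D - A. var1 f) = var1 e * (\<Prod>f\<in>?D - {e} - A. var1 f)"
      proof -
        have "?D - A - {e} = ?D - {e} - A" by auto
        then show ?thesis using q finD by (subst prod.remove[of _ e]) auto
      qed
      have gle: "\<bar>gcoef x\<bar> \<le> \<bar>coef (snd i) * coef (snd j)\<bar> * (\<Prod>f\<in>?D - A. var1 f)"
      proof -
        have "card (img (fst i) (snd i)) \<ge> 1" using q(4) finite_S[of i] q(2) by (auto simp: Suc_le_eq card_gt_0_iff)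
        then have "\<bar>coef (snd i)\<bar> / real (card (img (fst i) (snd i))) \<le> \<bar>coef (snd i)\<bar> / 1"
          by (intro divide_left_mono) auto
        then have "var1 e * (\<bar>coef (snd i)\<bar> / real (card (img (fst i) (snd i)))) * \<bar>coef (snd j)\<bar> * \<bar>contr e i j A\<bar>
           \<le> var1 e * \<bar>coef (snd i)\<bar> * \<bar>coef (snd j)\<bar> * (\<Prod>f\<in>?D - {e} - A. var1 f)"
          using var1_nonneg[OF q(7)] contr[OF q(2,3,6)]
          by (intro mult_mono mult_left_mono mult_right_mono) auto
        then show ?thesis unfolding R q(1) gcoef_def using var1_nonneg[OF q(7)] by (simp add: abs_mult mult_ac)
      qed
      have gs: "gset x = (img (fst i) (snd i) - img (fst j) (snd j)) \<union> (img (fst j) (snd j) - img (fst i) (snd i)) \<union> A"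
        by (simp add: q(1) gset_def diff_set_def)
      show "(gcoef x)\<^sup>2 * (\<Prod>e\<in>gset x. var1 e) * real n ^ (2 * card (cover x)) \<le> 4 ^ card E * \<epsilon> * K\<^sup>2 * real n ^ card (\<Union>(gset x))"
        using pair_bound[OF q(2,3) A' _ _ gle] x(2) q(4,5) unfolding gs by (auto simp: q(1) cover_def)
    next
      fix B
      have "card {x \<in> ?X. cover x = B} \<le> card {x \<in> quads. cover x = B}"
        by (rule card_mono) (use finite_quads in auto)
      then show "card {x \<in> ?X. cover x = B} \<le> pair_count V E" using cover_count[of B] by simp
    qed simp
    then show ?thesis unfolding Gam_centered by simp
  qed
  show "(\<Sum>e\<in>U. var1 e * Ex (\<lambda>w. (D e w) ^ 4)) \<le> c0 * (4 ^ card E * \<epsilon> * K\<^sup>2)"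
  proof -
    have "(\<Sum>l\<in>U. Ex (\<lambda>w. (\<Sum>x\<in>{x\<in>quads. fst x = l}. dcoef x * walsh (dset x) w)\<^sup>2)) \<le> c0 * (4 ^ card E * \<epsilon> * K\<^sup>2)"
      unfolding c0_def
    proof (rule labelled_second_moment_le[where Y = cover, OF bernoulli_product_axioms])
      show "finite quads" by (rule finite_quads)
      show "finite U" by (rule finite_U)
      show "n \<ge> 1" by (rule n_pos)
      show "0 \<le> 4 ^ card E * \<epsilon> * K\<^sup>2" by (rule K0)
      show "\<And>B. card {x \<in> quads. cover x = B} \<le> pair_count V E" by (rule cover_count)
      fix x assume x: "x \<in> quads"
      show "cover x \<subseteq> {1..n} \<and> card (cover x) \<le> 2 * card V" by (rule cover_bounds[OF x])
      obtain e i j A where q: "x = (e, i, j, A)" "i \<in> emb \<times> Fs" "j \<in> emb \<times> Fs" "e \<in> img (fst i) (snd i)" "e \<in> img (fst j) (snd j)"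
        "A \<subseteq> img (fst i) (snd i) \<inter> img (fst j) (snd j) - {e}" "e \<in> U" by (rule quads_cases[OF x])
      have A': "insert e A \<subseteq> img (fst i) (snd i) \<inter> img (fst j) (snd j)" using q by auto
      have ds: "dset x = diff_set i j \<union> insert e A" by (simp add: q(1) dset_def)
      show "dset x \<subseteq> U \<and> \<Union>(dset x) \<subseteq> cover x"
        using cover_diff_set[OF q(2,3) A'] unfolding ds by (simp add: q(1) cover_def)
      let ?D = "img (fst i) (snd i) \<inter> img (fst j) (snd j)"
      have DA: "?D - {e} - A = ?D - insert e A" by auto
      have gle: "\<bar>dcoef x\<bar> \<le> \<bar>coef (snd i) * coef (snd j)\<bar> * (\<Prod>f\<in>?D - insert e A. var1 f)"
        unfolding q(1) dcoef_def using contr[OF q(2,3,6)] unfolding DA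
        by (simp add: abs_mult mult_left_mono)
      show "(dcoef x)\<^sup>2 * (\<Prod>e\<in>dset x. var1 e) * real n ^ (2 * card (cover x)) \<le> 4 ^ card E * \<epsilon> * K\<^sup>2 * real n ^ card (\<Union>(dset x))"
        using pair_bound[OF q(2,3) A' _ _ gle] q(4,5) unfolding ds diff_set_def by (auto simp: q(1) cover_def)
    qed
    then show ?thesis by (simp add: D_fourth_moment)
  qed
qed

lemma Y_moment:
  "(\<Sum>e\<in>U. var1 e * Ex (\<lambda>w. (Y e w)\<^sup>2)) \<le> (real (2 * card V + 1) * real (pair_count V E))\<^sup>2 * K"
proof -
  let ?X = "SIGMA e:U. {i \<in> emb \<times> Fs. e \<in> img (fst i) (snd i)}"
  have "(\<Sum>l\<in>U. Ex (\<lambda>w. (\<Sum>x\<in>{x\<in>?X. fst x = l}. coef (snd (snd x)) / real (card (img (fst (snd x)) (snd (snd x)))) *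
      walsh (img (fst (snd x)) (snd (snd x))) w)\<^sup>2)) \<le> (real (2 * card V + 1) * real (pair_count V E))\<^sup>2 * K"
  proof (rule labelled_second_moment_le[where Y = "\<lambda>x. fst (snd x) ` V", OF bernoulli_product_axioms])
    show "finite ?X" using finite_U finite_I by (intro finite_SigmaI) auto
    show "finite U" by (rule finite_U)
    show "n \<ge> 1" by (rule n_pos)
    show "0 \<le> K" by (rule K_nonneg)
    fix x assume "x \<in> ?X"
    then obtain e \<phi> F where x: "x = (e, \<phi>, F)" "\<phi> \<in> emb" "F \<in> Fs" "e \<in> img \<phi> F" by auto
    have F: "F \<subseteq> E" "F \<noteq> {}" using x Fs_E by auto
    show "fst (snd x) ` V \<subseteq> {1..n} \<and> card (fst (snd x) ` V) \<le> 2 * card V"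
      using emb_image[OF x(2)] by (simp add: x(1))
    show "img (fst (snd x)) (snd (snd x)) \<subseteq> U \<and> \<Union>(img (fst (snd x)) (snd (snd x))) \<subseteq> fst (snd x) ` V"
      using img_sub[OF x(2) F(1)] img_Union_sub[OF F(1)] by (simp add: x(1))
    have c1: "card (img \<phi> F) \<ge> 1" using x(4) finite_S[of "(\<phi>, F)"] x by (auto simp: Suc_le_eq card_gt_0_iff)
    then have "(coef F / real (card (img \<phi> F)))\<^sup>2 \<le> (coef F)\<^sup>2 / 1"
      unfolding power_divide by (intro divide_left_mono) auto
    then have c2: "(coef F / real (card (img \<phi> F)))\<^sup>2 * (wP p F * wQ p F) * real n ^ (2 * card V) \<le> (coef F)\<^sup>2 * (wP p F * wQ p F) * real n ^ (2 * card V)"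
      using wP_pos[OF F(1)] wQ_pos[OF F(1)] by (intro mult_right_mono) auto
    have "wQ p F = psi n p F * (wP p F * real n ^ card (\<Union>F))"
      using wP_pos[OF F(1)] n_pos by (simp add: psi_def)
    also have "\<dots> \<le> M * (wP p F * real n ^ card (\<Union>F))"
      using wP_pos[OF F(1)] by (intro mult_right_mono psi_le F) auto
    finally have "(coef F)\<^sup>2 * wP p F * real n ^ (2 * card V) * wQ p F \<le> (coef F)\<^sup>2 * wP p F * real n ^ (2 * card V) * (M * (wP p F * real n ^ card (\<Union>F)))"
      using wP_pos[OF F(1)] by (intro mult_left_mono) auto
    also have "\<dots> = (coef F)\<^sup>2 * (wP p F)\<^sup>2 * M * real n ^ (2 * card V) * real n ^ card (\<Union>F)"
      by (simp add: power2_eq_square mult_ac)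
    also have "\<dots> \<le> K * real n ^ card (\<Union>F)"
      by (intro mult_right_mono coef_bound x) auto
    finally have "(coef F)\<^sup>2 * (wP p F * wQ p F) * real n ^ (2 * card V) \<le> K * real n ^ card (\<Union>F)"
      by (simp add: mult_ac)
    then show "(coef (snd (snd x)) / real (card (img (fst (snd x)) (snd (snd x)))))\<^sup>2 * (\<Prod>e\<in>img (fst (snd x)) (snd (snd x)). var1 e) *
      real n ^ (2 * card (fst (snd x) ` V)) \<le> K * real n ^ card (\<Union>(img (fst (snd x)) (snd (snd x))))"
      using c2 emb_image[OF x(2)] img_weights[OF x(2) F(1)] by (simp add: x(1) prod_var1)
  next
    fix B
    show "card {x \<in> ?X. fst (snd x) ` V = B} \<le> pair_count V E"
    proof (cases "{x \<in> ?X. fst (snd x) ` V = B} = {}")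
      case False
      then obtain \<phi> where "\<phi> \<in> emb" "\<phi> ` V = B" by auto
      then have B: "finite B" "card B \<le> 2 * card V" using finite_V emb_image[of \<phi>] by auto
      let ?T = "Pow B \<times> (((V \<rightarrow>\<^sub>E B) \<times> Pow E) \<times> ((V \<rightarrow>\<^sub>E B) \<times> Pow E)) \<times> Pow (Pow B)"
      note T = card_marked_pairs_le[OF finite_V finite_E B]
      have "card {x \<in> ?X. fst (snd x) ` V = B} \<le> card ?T"
      proof (rule card_inj_on_le[where f = "\<lambda>(e, i). (e, (i, i), {})"])
        show "inj_on (\<lambda>(e, i). (e, (i, i), {})) {x \<in> ?X. fst (snd x) ` V = B}" by (rule inj_onI) auto
        show "finite ?T" by (rule T(1))
        show "(\<lambda>(e, i). (e, (i, i), {})) ` {x \<in> ?X. fst (snd x) ` V = B} \<subseteq> ?T"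
        proof
          fix y assume "y \<in> (\<lambda>(e, i). (e, (i, i), {} :: nat set set)) ` {x \<in> ?X. fst (snd x) ` V = B}"
          then obtain e \<phi> F where y: "y = (e, ((\<phi>, F), (\<phi>, F)), {})" "\<phi> \<in> emb" "F \<in> Fs" "e \<in> img \<phi> F" "\<phi> ` V = B"
            by (auto split: prod.splits)
          have F: "F \<subseteq> E" using y Fs_E by auto
          have "e \<subseteq> B" using img_Union_sub[OF F, of \<phi>] y by blast
          then show "y \<in> ?T" unfolding y using F emb_PiE[OF y(2)] y(5) by auto
        qed
      qed
      then show ?thesis using T(2) by simp
    next
      case True
      then show ?thesis by (simp only: card.empty)
    qed
  qed
  then show ?thesis by (simp add: Y_second_moment)
qed

theorem clt_bound:
  fixes h :: "(nat set \<Rightarrow> bool) \<Rightarrow> complex"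
  assumes h1: "\<And>w. cmod (h w) \<le> 1"
    and h_upd: "\<And>\<phi> F e w b. \<phi> \<in> emb \<Longrightarrow> F \<in> Fs \<Longrightarrow> e \<in> img \<phi> F \<Longrightarrow> h (w(e := b)) = h w"
  shows "cmod (Ex (\<lambda>w. h w * iexp (t * G w)) - Ex h * of_real (exp (- (Ex (\<lambda>w. (G w)\<^sup>2) * t\<^sup>2 / 2))))
    \<le> t\<^sup>2 * sqrt (clt_const * \<epsilon>) + \<bar>t\<bar> ^ 3 / 2 * (clt_const * sqrt \<epsilon>)"
proof -
  let ?c0 = "(real (2 * card V + 1) * real (pair_count V E))\<^sup>2"
  have e0: "0 < sqrt \<epsilon>" using eps_pos by simp
  have K0: "0 \<le> 4 ^ card E * K\<^sup>2" by simp
  have gam: "Ex (\<lambda>w. (Gam w - Ex (\<lambda>w. (G w)\<^sup>2))\<^sup>2) \<le> clt_const * \<epsilon>"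
  proof -
    have "?c0 * (4 ^ card E * \<epsilon> * K\<^sup>2) \<le> ?c0 * ((K + 4 ^ card E * K\<^sup>2) * \<epsilon>)"
      using eps_pos K_nonneg by (intro mult_left_mono) (auto simp: algebra_simps)
    then show ?thesis using Gam_variance unfolding clt_const_def by (simp add: mult.assoc)
  qed
  \<comment> \<open>The choice \<open>\<eta> = sqrt \<epsilon>\<close> balances the two terms of \<open>third_order_le\<close>.\<close>
  have "third_order \<le> sqrt \<epsilon> / 2 * (?c0 * K) + 1 / (2 * sqrt \<epsilon>) * (?c0 * (4 ^ card E * \<epsilon> * K\<^sup>2))"
    by (rule order_trans[OF third_order_le[OF e0]], intro add_mono mult_left_mono Y_moment D_moment) (use e0 in auto)
  also have "1 / (2 * sqrt \<epsilon>) * (?c0 * (4 ^ card E * \<epsilon> * K\<^sup>2)) = sqrt \<epsilon> / 2 * (?c0 * (4 ^ card E * K\<^sup>2))"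
  proof -
    have "\<epsilon> = sqrt \<epsilon> * sqrt \<epsilon>" using eps_pos by simp
    then show ?thesis using e0 by (simp add: field_simps)
  qed
  also have "sqrt \<epsilon> / 2 * (?c0 * K) + sqrt \<epsilon> / 2 * (?c0 * (4 ^ card E * K\<^sup>2)) = clt_const * sqrt \<epsilon> / 2"
    unfolding clt_const_def by (simp add: algebra_simps)
  also have "\<dots> \<le> clt_const * sqrt \<epsilon>"
    using e0 K_nonneg by (simp add: clt_const_def)
  finally have third: "third_order \<le> clt_const * sqrt \<epsilon>" .
  have "cmod (Ex (\<lambda>w. h w * iexp (t * G w)) - Ex h * of_real (exp (- (Ex (\<lambda>w. (G w)\<^sup>2) * t\<^sup>2 / 2))))
    \<le> t\<^sup>2 * sqrt (Ex (\<lambda>w. (Gam w - Ex (\<lambda>w. (G w)\<^sup>2))\<^sup>2)) + \<bar>t\<bar> ^ 3 / 2 * third_order"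
    by (rule stein_tikhomirov) (use h1 h_upd in auto)
  also have "\<dots> \<le> t\<^sup>2 * sqrt (clt_const * \<epsilon>) + \<bar>t\<bar> ^ 3 / 2 * (clt_const * sqrt \<epsilon>)"
    using gam third by (intro add_mono mult_left_mono) auto
  finally show ?thesis .
qed

end

section \<open>Hoeffding decomposition and variance of the placement count\<close>

lemma (in bernoulli_product) Ex_sum_squared_le:
  assumes "finite A"
  shows "Ex (\<lambda>w. (\<Sum>a\<in>A. f a w)\<^sup>2) \<le> real (card A) * (\<Sum>a\<in>A. Ex (\<lambda>w. (f a w)\<^sup>2))"
proof -
  have "Ex (\<lambda>w. (\<Sum>a\<in>A. f a w)\<^sup>2) \<le> Ex (\<lambda>w. (\<Sum>a\<in>A. (f a w)\<^sup>2) * real (card A))"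
    by (rule Ex_mono) (rule sum_squared_le_sum_of_squares)
  also have "\<dots> = real (card A) * (\<Sum>a\<in>A. Ex (\<lambda>w. (f a w)\<^sup>2))"
    by (simp add: Bochner_Integration.integral_sum)
  finally show ?thesis .
qed

context placement
begin

definition X :: "(nat set \<Rightarrow> bool) \<Rightarrow> real" where
  "X w = (\<Sum>\<phi>\<in>emb. \<Prod>e\<in>E. of_bool (w (\<phi> ` e)))"

definition walsh_sum :: "'a set set \<Rightarrow> (nat set \<Rightarrow> bool) \<Rightarrow> real" where
  "walsh_sum F w = (\<Sum>\<phi>\<in>emb. walsh (img \<phi> F) w)"

definition nonempty_subs :: "'a set set set" where "nonempty_subs = Pow E - {{}}"

lemma finite_subs: "finite nonempty_subs" "F \<in> nonempty_subs \<Longrightarrow> finite F"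
  unfolding nonempty_subs_def using finite_E by (auto intro: finite_subset)

lemma subsD: "F \<in> nonempty_subs \<Longrightarrow> F \<subseteq> E" "F \<in> nonempty_subs \<Longrightarrow> F \<noteq> {}"
  by (auto simp: nonempty_subs_def)

lemma card_subs_le: "card nonempty_subs \<le> 2 ^ card E"
  unfolding nonempty_subs_def using finite_E by (metis Diff_subset card_Pow card_mono finite_Pow_iff)

lemma card_emb_le: "card emb \<le> n ^ card V"
proof -
  have "card emb \<le> card (V \<rightarrow>\<^sub>E {1..n})"
    unfolding emb_def using finite_V by (intro card_mono finite_PiE) auto
  then show ?thesis using finite_V by (simp add: card_funcsetE)
qed

lemma card_emb_ge: "(real n / 2) ^ card V \<le> real (card emb)"
proof -
  have "card emb = prod ((-) n) {0..<card V}"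
    unfolding emb_def using card_inj_on_subset_funcset[OF finite_V, of "{1..n}" V] by simp
  then have "real (card emb) = (\<Prod>i\<in>{0..<card V}. real (n - i))" by simp
  moreover have "(\<Prod>i\<in>{0..<card V}. real n / 2) \<le> (\<Prod>i\<in>{0..<card V}. real (n - i))"
  proof (rule prod_mono)
    fix i assume "i \<in> {0..<card V}"
    then show "0 \<le> real n / 2 \<and> real n / 2 \<le> real (n - i)" using n_large by (simp add: field_simps)
  qed
  ultimately show ?thesis by simp
qed

text \<open>Each indicator is \<open>xi f + p (card f)\<close>; the product is expanded over the set \<open>F\<close> of edges where the centred
  term is taken.\<close>

lemma X_expansion: "X w = (\<Sum>F\<in>Pow E. wP p (E - F) * walsh_sum F w)"
proof -
  have "X w = (\<Sum>\<phi>\<in>emb. \<Sum>F\<in>Pow E. wP p (E - F) * walsh (img \<phi> F) w)"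
    unfolding X_def
  proof (rule sum.cong[OF refl])
    fix \<phi> assume \<phi>: "\<phi> \<in> emb"
    have inj: "inj_on ((`) \<phi>) E" using img_inj[OF \<phi>] E_sub by (auto intro: inj_on_subset)
    have c: "card (\<phi> ` e) = card e" if "e \<in> E" for e
      using that E_sub by (intro card_image inj_on_subset[OF emb_inj[OF \<phi>]]) auto
    have "(\<Prod>e\<in>E. of_bool (w (\<phi> ` e))) = (\<Prod>e\<in>E. xi (\<phi> ` e) w + p (card e))"
      by (rule prod.cong) (simp_all add: xi_def c)
    also have "\<dots> = (\<Sum>F\<in>Pow E. (\<Prod>e\<in>F. xi (\<phi> ` e) w) * (\<Prod>e\<in>E - F. p (card e)))"
      by (rule prod_add[OF finite_E])
    also have "\<dots> = (\<Sum>F\<in>Pow E. wP p (E - F) * walsh (img \<phi> F) w)"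
    proof (rule sum.cong[OF refl])
      fix F assume "F \<in> Pow E"
      then have "inj_on ((`) \<phi>) F" using inj by (auto intro: inj_on_subset)
      then have "walsh (img \<phi> F) w = (\<Prod>e\<in>F. xi (\<phi> ` e) w)"
        unfolding walsh_def img_def by (simp add: prod.reindex)
      then show "(\<Prod>e\<in>F. xi (\<phi> ` e) w) * (\<Prod>e\<in>E - F. p (card e)) = wP p (E - F) * walsh (img \<phi> F) w"
        by (simp add: wP_def)
    qed
    finally show "(\<Prod>e\<in>E. of_bool (w (\<phi> ` e))) = (\<Sum>F\<in>Pow E. wP p (E - F) * walsh (img \<phi> F) w)" .
  qed
  also have "\<dots> = (\<Sum>F\<in>Pow E. wP p (E - F) * walsh_sum F w)"
    by (subst sum.swap) (simp add: walsh_sum_def sum_distrib_left)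
  finally show ?thesis .
qed

lemma Ex_walsh_sum: "F \<in> nonempty_subs \<Longrightarrow> Ex (walsh_sum F) = 0"
proof -
  assume F: "F \<in> nonempty_subs"
  have "Ex (walsh_sum F) = (\<Sum>\<phi>\<in>emb. Ex (walsh (img \<phi> F)))"
    unfolding walsh_sum_def by (simp add: Bochner_Integration.integral_sum)
  also have "\<dots> = 0"
    using subsD[OF F] img_sub by (intro sum.neutral ballI Ex_walsh) (auto simp: img_def)
  finally show ?thesis .
qed

lemma Pow_E_split: "(\<Sum>F\<in>Pow E. g F) = g {} + (\<Sum>F\<in>nonempty_subs. g F)" for g :: "_ \<Rightarrow> real"
  unfolding nonempty_subs_def using finite_E by (subst sum.remove[of _ "{}"]) auto

lemma walsh_sum_empty: "walsh_sum {} w = real (card emb)"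
  by (simp add: walsh_sum_def img_def)

lemma Ex_X: "Ex X = wP p E * real (card emb)"
proof -
  have "Ex X = Ex (\<lambda>w. wP p E * real (card emb) + (\<Sum>F\<in>nonempty_subs. wP p (E - F) * walsh_sum F w))"
    unfolding X_expansion Pow_E_split walsh_sum_empty by simp
  also have "\<dots> = wP p E * real (card emb) + (\<Sum>F\<in>nonempty_subs. wP p (E - F) * Ex (walsh_sum F))"
    by (simp add: Bochner_Integration.integral_sum)
  also have "\<dots> = wP p E * real (card emb)" using Ex_walsh_sum by simp
  finally show ?thesis .
qed

lemma X_centered: "X w - Ex X = (\<Sum>F\<in>nonempty_subs. wP p (E - F) * walsh_sum F w)"
  unfolding Ex_X X_expansion Pow_E_split walsh_sum_empty by simp

lemma Ex_walsh_sum_mult: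
  assumes "F \<subseteq> E" "F' \<subseteq> E"
  shows "Ex (\<lambda>w. walsh_sum F w * walsh_sum F' w) =
    (\<Sum>\<phi>\<in>emb. \<Sum>\<phi>'\<in>emb. if img \<phi> F = img \<phi>' F' then wP p F * wQ p F else 0)"
proof -
  have "Ex (\<lambda>w. walsh_sum F w * walsh_sum F' w) = (\<Sum>\<phi>\<in>emb. \<Sum>\<phi>'\<in>emb. Ex (\<lambda>w. walsh (img \<phi> F) w * walsh (img \<phi>' F') w))"
    unfolding walsh_sum_def by (simp add: sum_product Bochner_Integration.integral_sum)
  also have "\<dots> = (\<Sum>\<phi>\<in>emb. \<Sum>\<phi>'\<in>emb. if img \<phi> F = img \<phi>' F' then wP p F * wQ p F else 0)"
  proof (intro sum.cong refl)
    fix \<phi> \<phi>' assume \<phi>: "\<phi> \<in> emb" and \<phi>': "\<phi>' \<in> emb"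
    show "Ex (\<lambda>w. walsh (img \<phi> F) w * walsh (img \<phi>' F') w) = (if img \<phi> F = img \<phi>' F' then wP p F * wQ p F else 0)"
      unfolding Ex_walsh_mult[OF img_sub[OF \<phi> assms(1)] img_sub[OF \<phi>' assms(2)]] prod_var1
        img_weights(1,2)[OF \<phi> assms(1)] ..
  qed
  finally show ?thesis .
qed

lemma Ex_walsh_sum_mult_nonneg:
  assumes "F \<subseteq> E" "F' \<subseteq> E"
  shows "0 \<le> Ex (\<lambda>w. walsh_sum F w * walsh_sum F' w)"
  unfolding Ex_walsh_sum_mult[OF assms] using wP_pos[OF assms(1)] wQ_pos[OF assms(1)] by (auto intro!: sum_nonneg)

text \<open>Placements preserve the number of edges and their sizes, so the two sums have no Walsh function in
  common.\<close>

lemma Ex_walsh_sum_orthogonal: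
  assumes "F \<subseteq> E" "F' \<subseteq> E" and ne: "card F \<noteq> card F' \<or> card ` F \<noteq> card ` F'"
  shows "Ex (\<lambda>w. walsh_sum F w * walsh_sum F' w) = 0"
proof -
  have "img \<phi> F \<noteq> img \<phi>' F'" if "\<phi> \<in> emb" "\<phi>' \<in> emb" for \<phi> \<phi>'
  proof
    assume eq: "img \<phi> F = img \<phi>' F'"
    have *: "card (img \<phi> F) = card F \<and> card ` img \<phi> F = card ` F" if \<phi>: "\<phi> \<in> emb" and F: "F \<subseteq> E" for \<phi> F
    proof
      have "inj_on ((`) \<phi>) F" using img_inj[OF \<phi>] F E_sub by (auto intro: inj_on_subset)
      then show "card (img \<phi> F) = card F" unfolding img_def by (rule card_image)
      have "card (\<phi> ` e) = card e" if "e \<in> F" for e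
        using that F E_sub by (intro card_image inj_on_subset[OF emb_inj[OF \<phi>]]) auto
      then show "card ` img \<phi> F = card ` F" unfolding img_def image_image by (rule image_cong[OF refl])
    qed
    show False using *[OF that(1) assms(1)] *[OF that(2) assms(2)] eq ne by simp
  qed
  then show ?thesis unfolding Ex_walsh_sum_mult[OF assms(1,2)] by (intro sum.neutral ballI) auto
qed

definition cvar :: real where "cvar = (real (card V + 1) * real (pair_count V E))\<^sup>2"

lemma Ex_walsh_sum_squared_le:
  assumes "F \<subseteq> E"
  shows "Ex (\<lambda>w. (walsh_sum F w)\<^sup>2) \<le> cvar * (wP p F * wQ p F * real n ^ (2 * card V) / real n ^ card (\<Union>F))"
proof -
  let ?K = "wP p F * wQ p F * real n ^ (2 * card V) / real n ^ card (\<Union>F)"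
  have "(\<Sum>l\<in>{()}. Ex (\<lambda>w. (\<Sum>\<phi>\<in>{\<phi>\<in>emb. () = l}. 1 * walsh (img \<phi> F) w)\<^sup>2)) \<le> cvar * ?K"
    unfolding cvar_def
  proof (rule labelled_second_moment_le[where Y = "\<lambda>\<phi>. \<phi> ` V", OF bernoulli_product_axioms])
    show "finite emb" by (rule finite_emb)
    show "n \<ge> 1" by (rule n_pos)
    show "0 \<le> ?K" using wP_pos[OF assms] wQ_pos[OF assms] by simp
    fix \<phi> assume \<phi>: "\<phi> \<in> emb"
    show "img \<phi> F \<subseteq> U \<and> \<Union>(img \<phi> F) \<subseteq> \<phi> ` V" using img_sub[OF \<phi> assms] img_Union_sub[OF assms] by simp
    show "\<phi> ` V \<subseteq> {1..n} \<and> card (\<phi> ` V) \<le> card V" using emb_image[OF \<phi>] by simp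
    show "1\<^sup>2 * (\<Prod>e\<in>img \<phi> F. var1 e) * real n ^ (2 * card (\<phi> ` V)) \<le> ?K * real n ^ card (\<Union>(img \<phi> F))"
      using emb_image[OF \<phi>] img_weights[OF \<phi> assms] n_pos by (simp add: prod_var1)
  next
    fix B
    show "card {\<phi>\<in>emb. \<phi> ` V = B} \<le> pair_count V E"
    proof (cases "{\<phi>\<in>emb. \<phi> ` V = B} = {}")
      case False
      then obtain \<phi> where "\<phi> \<in> emb" "\<phi> ` V = B" by auto
      then have B: "finite B" "card B \<le> 2 * card V" using finite_V emb_image[of \<phi>] by auto
      let ?T = "Pow B \<times> (((V \<rightarrow>\<^sub>E B) \<times> Pow E) \<times> ((V \<rightarrow>\<^sub>E B) \<times> Pow E)) \<times> Pow (Pow B)"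
      note T = card_marked_pairs_le[OF finite_V finite_E B]
      have "card {\<phi>\<in>emb. \<phi> ` V = B} \<le> card ?T"
      proof (rule card_inj_on_le[where f = "\<lambda>\<phi>. ({}, ((\<phi>, {}), (\<phi>, {})), {})"])
        show "inj_on (\<lambda>\<phi>. ({}, ((\<phi>, {}), (\<phi>, {})), {})) {\<phi>\<in>emb. \<phi> ` V = B}" by (rule inj_onI) auto
        show "finite ?T" by (rule T(1))
        show "(\<lambda>\<phi>. ({}, ((\<phi>, {}), (\<phi>, {})), {})) ` {\<phi>\<in>emb. \<phi> ` V = B} \<subseteq> ?T"
          by (auto simp: emb_def PiE_def)
      qed
      then show ?thesis using T(2) by simp
    next
      case True
      then show ?thesis by (simp only: card.empty)
    qed
  qed simp
  then show ?thesis by (simp add: walsh_sum_def)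
qed

text \<open>By the Cauchy--Schwarz inequality, the number of pairs of placements with the same image of \<open>F\<close> is at least the
  square of the number of placements divided by the number of images, which is at most
  \<open>n ^ card (\<Union>F)\<close>.\<close>

lemma Ex_walsh_sum_squared_ge:
  assumes "F \<subseteq> E"
  shows "wP p F * wQ p F * (real n / 2) ^ (2 * card V) / real n ^ card (\<Union>F) \<le> Ex (\<lambda>w. (walsh_sum F w)\<^sup>2)"
proof -
  let ?T = "(\<lambda>\<phi>. img \<phi> F) ` emb"
  let ?c = "\<lambda>B. real (card {\<phi>\<in>emb. img \<phi> F = B})"
  have VF: "finite (\<Union>F)" "\<Union>F \<subseteq> V" using assms E_sub finite_V by (auto intro: finite_subset)
  have cT: "card ?T \<le> n ^ card (\<Union>F)"
  proof -
    have "?T \<subseteq> (\<lambda>\<phi>. img \<phi> F) ` (\<Union>F \<rightarrow>\<^sub>E {1..n})"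
    proof
      fix B assume "B \<in> ?T"
      then obtain \<phi> where \<phi>: "\<phi> \<in> emb" "B = img \<phi> F" by auto
      have "img (restrict \<phi> (\<Union>F)) F = img \<phi> F"
        unfolding img_def by (intro image_cong refl) auto
      moreover have "restrict \<phi> (\<Union>F) \<in> \<Union>F \<rightarrow>\<^sub>E {1..n}"
        using \<phi>(1) VF(2) emb_image[of \<phi>] by auto
      ultimately show "B \<in> (\<lambda>\<phi>. img \<phi> F) ` (\<Union>F \<rightarrow>\<^sub>E {1..n})" using \<phi> by (metis imageI)
    qed
    then have "card ?T \<le> card (\<Union>F \<rightarrow>\<^sub>E {1..n})"
      using VF by (intro surj_card_le finite_PiE) auto
    then show ?thesis using VF by (simp add: card_funcsetE)
  qed
  have emb_split: "real (card emb) = (\<Sum>B\<in>?T. ?c B)"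
    using sum.image_gen[OF finite_emb, of "\<lambda>_. 1 :: real" "\<lambda>\<phi>. img \<phi> F"] by simp
  have "Ex (\<lambda>w. (walsh_sum F w)\<^sup>2) = (\<Sum>\<phi>\<in>emb. \<Sum>\<phi>'\<in>emb. if img \<phi> F = img \<phi>' F then wP p F * wQ p F else 0)"
    unfolding power2_eq_square by (rule Ex_walsh_sum_mult[OF assms assms])
  also have "\<dots> = (\<Sum>\<phi>\<in>emb. wP p F * wQ p F * ?c (img \<phi> F))"
  proof (rule sum.cong[OF refl])
    fix \<phi> assume "\<phi> \<in> emb"
    have "(\<Sum>\<phi>'\<in>emb. if img \<phi> F = img \<phi>' F then wP p F * wQ p F else 0) =
        (\<Sum>\<phi>'\<in>{\<phi>'\<in>emb. img \<phi> F = img \<phi>' F}. wP p F * wQ p F)"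
      by (rule sum.inter_filter[symmetric, OF finite_emb])
    moreover have "{\<phi>'\<in>emb. img \<phi> F = img \<phi>' F} = {\<phi>'\<in>emb. img \<phi>' F = img \<phi> F}" by auto
    ultimately show "(\<Sum>\<phi>'\<in>emb. if img \<phi> F = img \<phi>' F then wP p F * wQ p F else 0) = wP p F * wQ p F * ?c (img \<phi> F)"
      by (simp only: sum_constant mult.commute)
  qed
  also have "\<dots> = (\<Sum>B\<in>?T. \<Sum>\<phi>\<in>{\<phi>\<in>emb. img \<phi> F = B}. wP p F * wQ p F * ?c (img \<phi> F))"
    by (rule sum.image_gen[OF finite_emb])
  also have "\<dots> = wP p F * wQ p F * (\<Sum>B\<in>?T. (?c B)\<^sup>2)"
    unfolding sum_distrib_left by (intro sum.cong refl) (simp add: power2_eq_square mult_ac)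
  finally have eq: "Ex (\<lambda>w. (walsh_sum F w)\<^sup>2) = wP p F * wQ p F * (\<Sum>B\<in>?T. (?c B)\<^sup>2)" .
  have "(real n / 2) ^ (2 * card V) = ((real n / 2) ^ card V)\<^sup>2"
    by (simp only: power_mult[symmetric] mult.commute)
  also have "\<dots> \<le> (real (card emb))\<^sup>2"
    by (rule power_mono[OF card_emb_ge]) simp
  also have "\<dots> \<le> (\<Sum>B\<in>?T. (?c B)\<^sup>2) * real (card ?T)"
    unfolding emb_split by (rule sum_squared_le_sum_of_squares)
  also have "\<dots> \<le> (\<Sum>B\<in>?T. (?c B)\<^sup>2) * real n ^ card (\<Union>F)"
    using cT by (intro mult_left_mono sum_nonneg) (simp_all flip: of_nat_power)
  finally have "(real n / 2) ^ (2 * card V) / real n ^ card (\<Union>F) \<le> (\<Sum>B\<in>?T. (?c B)\<^sup>2)"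
    using n_pos by (simp add: divide_le_eq)
  then have "wP p F * wQ p F * ((real n / 2) ^ (2 * card V) / real n ^ card (\<Union>F)) \<le> wP p F * wQ p F * (\<Sum>B\<in>?T. (?c B)\<^sup>2)"
    using wP_pos[OF assms] wQ_pos[OF assms] by (intro mult_left_mono) auto
  then show ?thesis unfolding eq by simp
qed

definition varX :: real where "varX = Ex (\<lambda>w. (X w - Ex X)\<^sup>2)"

lemma wP_split: "F \<subseteq> E \<Longrightarrow> wP p E = wP p (E - F) * wP p F"
  unfolding wP_def by (rule prod.subset_diff[OF _ finite_E])

lemma weighted_psi:
  assumes "F \<subseteq> E"
  shows "(wP p (E - F))\<^sup>2 * (wP p F * wQ p F * c / real n ^ card (\<Union>F)) = (wP p E)\<^sup>2 * psi n p F * c"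
  using wP_pos[OF assms] n_pos unfolding wP_split[OF assms] psi_def
  by (simp add: power2_eq_square field_simps)

text \<open>All covariances between the parts of the decomposition are nonnegative, so a single part bounds the variance from below.\<close>

lemma varX_ge:
  assumes "F \<in> nonempty_subs"
  shows "(wP p E)\<^sup>2 * psi n p F * real n ^ (2 * card V) \<le> 4 ^ card V * varX"
proof -
  note F = subsD[OF assms]
  define t where "t F F' = wP p (E - F) * wP p (E - F') * Ex (\<lambda>w. walsh_sum F w * walsh_sum F' w)" for F F'
  have t0: "0 \<le> t F F'" if "F \<in> nonempty_subs" "F' \<in> nonempty_subs" for F F'
    unfolding t_def using wP_pos[of "E - F"] wP_pos[of "E - F'"] that
    by (intro mult_nonneg_nonneg Ex_walsh_sum_mult_nonneg subsD) auto
  have "t F F \<le> (\<Sum>F'\<in>nonempty_subs. t F F')"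
    by (rule member_le_sum[OF assms]) (use t0 assms finite_subs(1) in auto)
  also have "\<dots> \<le> (\<Sum>F\<in>nonempty_subs. \<Sum>F'\<in>nonempty_subs. t F F')"
    by (rule member_le_sum[OF assms, of "\<lambda>F. \<Sum>F'\<in>nonempty_subs. t F F'"])
      (use t0 finite_subs(1) in \<open>auto intro: sum_nonneg\<close>)
  also have "\<dots> = Ex (\<lambda>w. \<Sum>F\<in>nonempty_subs. \<Sum>F'\<in>nonempty_subs. wP p (E - F) * wP p (E - F') * (walsh_sum F w * walsh_sum F' w))"
    unfolding t_def by (simp add: Bochner_Integration.integral_sum)
  also have "\<dots> = varX"
    unfolding varX_def X_centered power2_eq_square sum_product by (simp add: mult_ac)
  finally have "(wP p (E - F))\<^sup>2 * Ex (\<lambda>w. (walsh_sum F w)\<^sup>2) \<le> varX"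
    unfolding t_def by (simp add: power2_eq_square)
  moreover have "(wP p (E - F))\<^sup>2 * (wP p F * wQ p F * (real n / 2) ^ (2 * card V) / real n ^ card (\<Union>F)) \<le> (wP p (E - F))\<^sup>2 * Ex (\<lambda>w. (walsh_sum F w)\<^sup>2)"
    by (intro mult_left_mono Ex_walsh_sum_squared_ge F) auto
  ultimately have "(wP p E)\<^sup>2 * psi n p F * (real n / 2) ^ (2 * card V) \<le> varX"
    unfolding weighted_psi[OF F(1)] by linarith
  moreover have "(real n / 2) ^ (2 * card V) = real n ^ (2 * card V) / 4 ^ card V"
    unfolding power_divide power_mult[of 2 2] by simp
  ultimately show ?thesis by (simp only:) (simp add: field_simps)
qed

lemma varX_pos: "0 < varX"
proof -
  have E: "E \<in> nonempty_subs" using E_ne by (simp add: nonempty_subs_def)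
  have "0 < (wP p E)\<^sup>2 * psi n p E * real n ^ (2 * card V)"
    using wP_pos[of E] wQ_pos[of E] n_pos by (simp add: psi_def)
  also have "\<dots> \<le> 4 ^ card V * varX" by (rule varX_ge[OF E])
  finally show ?thesis by (simp add: zero_less_mult_iff)
qed

text \<open>The coefficient of a Walsh sum in the standardised count.\<close>

definition coef :: "'a set set \<Rightarrow> real" where
  "coef F = wP p (E - F) / sqrt varX"

definition part :: "'a set set set \<Rightarrow> (nat set \<Rightarrow> bool) \<Rightarrow> real" where
  "part Fs w = (\<Sum>F\<in>Fs. coef F * walsh_sum F w)"

definition W :: "(nat set \<Rightarrow> bool) \<Rightarrow> real" where
  "W w = (X w - Ex X) / sqrt varX"

lemma W_eq_part: "W w = part nonempty_subs w"
  unfolding W_def X_centered part_def coef_def sum_divide_distrib by simp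

lemma Ex_W_squared: "Ex (\<lambda>w. (W w)\<^sup>2) = 1"
proof -
  have "Ex (\<lambda>w. (W w)\<^sup>2) = varX / varX"
    using varX_pos unfolding W_def power_divide by (simp add: varX_def)
  then show ?thesis using varX_pos by simp
qed

lemma coef_nonneg: "0 \<le> coef F"
  unfolding coef_def using wP_pos[of "E - F"] varX_pos by simp

lemma coef_squared:
  assumes "F \<subseteq> E"
  shows "(coef F)\<^sup>2 * (wP p F)\<^sup>2 = (wP p E)\<^sup>2 / varX"
  unfolding coef_def wP_split[OF assms] using varX_pos by (simp add: power_divide power_mult_distrib)

lemma coef_squared_le:
  assumes "F \<subseteq> E" and M: "M \<le> psi n p B" "B \<in> nonempty_subs"
  shows "(coef F)\<^sup>2 * (wP p F)\<^sup>2 * M * real n ^ (2 * card V) \<le> 4 ^ card V"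
proof -
  have "(wP p E)\<^sup>2 * M * real n ^ (2 * card V) \<le> (wP p E)\<^sup>2 * psi n p B * real n ^ (2 * card V)"
    by (intro mult_left_mono mult_right_mono M) auto
  also have "\<dots> \<le> 4 ^ card V * varX" by (rule varX_ge[OF M(2)])
  finally show ?thesis unfolding coef_squared[OF assms(1)] using varX_pos by (simp add: field_simps)
qed

text \<open>The share of \<open>F\<close> in the variance is at most a constant times \<open>psi n p F / M\<close>.\<close>

lemma Ex_part_squared_le:
  assumes Fs: "Fs \<subseteq> nonempty_subs" and M: "M \<le> psi n p B" "B \<in> nonempty_subs" "0 < M" and d: "0 \<le> d"
    and small: "\<And>F. F \<in> Fs \<Longrightarrow> psi n p F \<le> d * M"
  shows "Ex (\<lambda>w. (part Fs w)\<^sup>2) \<le> 4 ^ card E * (cvar * (4 ^ card V * d))"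
proof -
  have finFs: "finite Fs" using Fs finite_subs(1) by (rule finite_subset)
  have cFs: "real (card Fs) \<le> 2 ^ card E"
  proof -
    have "card Fs \<le> 2 ^ card E" using card_mono[OF finite_subs(1) Fs] card_subs_le by (rule le_trans)
    then have "real (card Fs) \<le> real (2 ^ card E)" by (simp only: of_nat_le_iff)
    then show ?thesis by simp
  qed
  have "Ex (\<lambda>w. (part Fs w)\<^sup>2) \<le> real (card Fs) * (\<Sum>F\<in>Fs. Ex (\<lambda>w. (coef F * walsh_sum F w)\<^sup>2))"
    unfolding part_def by (rule Ex_sum_squared_le[OF finFs])
  also have "\<dots> \<le> real (card Fs) * (\<Sum>F\<in>Fs. cvar * (4 ^ card V * d))"
  proof (intro mult_left_mono sum_mono)
    fix F assume F: "F \<in> Fs"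
    then have FE: "F \<subseteq> E" using Fs subsD by auto
    have "Ex (\<lambda>w. (coef F * walsh_sum F w)\<^sup>2) = (coef F)\<^sup>2 * Ex (\<lambda>w. (walsh_sum F w)\<^sup>2)"
      by (simp add: power_mult_distrib)
    also have "\<dots> \<le> (coef F)\<^sup>2 * (cvar * (wP p F * wQ p F * real n ^ (2 * card V) / real n ^ card (\<Union>F)))"
      by (intro mult_left_mono Ex_walsh_sum_squared_le FE) auto
    also have "\<dots> = cvar * ((coef F)\<^sup>2 * (wP p F)\<^sup>2 * psi n p F * real n ^ (2 * card V))"
    proof -
      have "a * (c * (u * q * N / m)) = c * (a * (u * u) * (q / (u * m)) * N)" if "u > 0" for a c u q N m :: real
        using that by simp
      from this[OF wP_pos[OF FE]] show ?thesis unfolding psi_def power2_eq_square .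
    qed
    also have "\<dots> \<le> cvar * ((coef F)\<^sup>2 * (wP p F)\<^sup>2 * (d * M) * real n ^ (2 * card V))"
      by (intro mult_left_mono mult_right_mono small F) (auto simp: cvar_def)
    also have "\<dots> = cvar * (((coef F)\<^sup>2 * (wP p F)\<^sup>2 * M * real n ^ (2 * card V)) * d)"
      by (simp add: mult_ac)
    also have "\<dots> \<le> cvar * (4 ^ card V * d)"
      by (intro mult_left_mono mult_right_mono coef_squared_le[OF FE M(1,2)] d) (auto simp: cvar_def)
    finally show "Ex (\<lambda>w. (coef F * walsh_sum F w)\<^sup>2) \<le> cvar * (4 ^ card V * d)" .
  qed auto
  also have "\<dots> = real (card Fs) * real (card Fs) * (cvar * (4 ^ card V * d))" by simp
  also have "\<dots> \<le> 2 ^ card E * 2 ^ card E * (cvar * (4 ^ card V * d))"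
    using cFs d by (intro mult_right_mono mult_mono) (auto simp: cvar_def)
  also have "(2::real) ^ card E * 2 ^ card E = 4 ^ card E" by (simp flip: power_mult_distrib)
  finally show ?thesis .
qed

lemma varX_le:
  assumes M: "\<And>B. B \<in> nonempty_subs \<Longrightarrow> psi n p B \<le> M"
  shows "varX \<le> 4 ^ card E * (cvar * ((wP p E)\<^sup>2 * M * real n ^ (2 * card V)))"
proof -
  let ?b = "cvar * ((wP p E)\<^sup>2 * M * real n ^ (2 * card V))"
  have M0: "0 \<le> M"
  proof -
    have "0 < psi n p E" using wP_pos[of E] wQ_pos[of E] n_pos by (simp add: psi_def)
    then show ?thesis using M[of E] E_ne by (simp add: nonempty_subs_def)
  qed
  have "varX \<le> real (card nonempty_subs) * (\<Sum>F\<in>nonempty_subs. Ex (\<lambda>w. (wP p (E - F) * walsh_sum F w)\<^sup>2))"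
    unfolding varX_def X_centered by (rule Ex_sum_squared_le[OF finite_subs(1)])
  also have "\<dots> \<le> real (card nonempty_subs) * (\<Sum>F\<in>nonempty_subs. ?b)"
  proof (intro mult_left_mono sum_mono)
    fix F assume F: "F \<in> nonempty_subs"
    then have FE: "F \<subseteq> E" using subsD by auto
    have "Ex (\<lambda>w. (wP p (E - F) * walsh_sum F w)\<^sup>2) = (wP p (E - F))\<^sup>2 * Ex (\<lambda>w. (walsh_sum F w)\<^sup>2)"
      by (simp add: power_mult_distrib)
    also have "\<dots> \<le> (wP p (E - F))\<^sup>2 * (cvar * (wP p F * wQ p F * real n ^ (2 * card V) / real n ^ card (\<Union>F)))"
      by (intro mult_left_mono Ex_walsh_sum_squared_le FE) auto
    also have "\<dots> = cvar * ((wP p (E - F))\<^sup>2 * (wP p F * wQ p F * real n ^ (2 * card V) / real n ^ card (\<Union>F)))"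
      by (simp only: mult.left_commute)
    also have "\<dots> = cvar * ((wP p E)\<^sup>2 * psi n p F * real n ^ (2 * card V))"
      unfolding weighted_psi[OF FE] ..
    also have "\<dots> \<le> ?b" by (intro mult_left_mono mult_right_mono M F) (auto simp: cvar_def)
    finally show "Ex (\<lambda>w. (wP p (E - F) * walsh_sum F w)\<^sup>2) \<le> ?b" .
  qed auto
  also have "\<dots> = real (card nonempty_subs) * real (card nonempty_subs) * ?b" by simp
  also have "\<dots> \<le> 2 ^ card E * 2 ^ card E * ?b"
  proof -
    have "real (card nonempty_subs) \<le> 2 ^ card E" using card_subs_le by (metis of_nat_le_iff of_nat_numeral of_nat_power)
    then show ?thesis using M0 by (intro mult_right_mono mult_mono) (auto simp: cvar_def)
  qed
  also have "(2::real) ^ card E * 2 ^ card E = 4 ^ card E" by (simp flip: power_mult_distrib)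
  finally show ?thesis .
qed

lemma part_Un: "Fs \<inter> Fs' = {} \<Longrightarrow> Fs \<subseteq> nonempty_subs \<Longrightarrow> Fs' \<subseteq> nonempty_subs \<Longrightarrow> part (Fs \<union> Fs') w = part Fs w + part Fs' w"
  unfolding part_def using finite_subs(1) by (intro sum.union_disjoint) (auto intro: finite_subset)

lemma Ex_part_Un_squared:
  assumes Fs: "Fs \<subseteq> nonempty_subs" "Fs' \<subseteq> nonempty_subs"
    and sep: "\<And>F F'. F \<in> Fs \<Longrightarrow> F' \<in> Fs' \<Longrightarrow> card F \<noteq> card F' \<or> card ` F \<noteq> card ` F'"
  shows "Ex (\<lambda>w. (part (Fs \<union> Fs') w)\<^sup>2) = Ex (\<lambda>w. (part Fs w)\<^sup>2) + Ex (\<lambda>w. (part Fs' w)\<^sup>2)"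
proof -
  have "Fs \<inter> Fs' = {}" using sep by blast
  note U = part_Un[OF this Fs]
  have "Ex (\<lambda>w. part Fs w * part Fs' w) = (\<Sum>F\<in>Fs. \<Sum>F'\<in>Fs'. coef F * coef F' * Ex (\<lambda>w. walsh_sum F w * walsh_sum F' w))"
  proof -
    have "part Fs w * part Fs' w = (\<Sum>F\<in>Fs. \<Sum>F'\<in>Fs'. coef F * coef F' * (walsh_sum F w * walsh_sum F' w))" for w
      unfolding part_def sum_product by (simp add: mult_ac)
    then show ?thesis by (simp add: Bochner_Integration.integral_sum)
  qed
  also have "\<dots> = 0"
  proof (intro sum.neutral ballI)
    fix F F' assume F: "F \<in> Fs" "F' \<in> Fs'"
    then have "F \<subseteq> E" "F' \<subseteq> E" using Fs subsD(1) by auto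
    then have "Ex (\<lambda>w. walsh_sum F w * walsh_sum F' w) = 0"
      by (rule Ex_walsh_sum_orthogonal) (rule sep[OF F])
    then show "coef F * coef F' * Ex (\<lambda>w. walsh_sum F w * walsh_sum F' w) = 0" by simp
  qed
  finally have "Ex (\<lambda>w. part Fs w * part Fs' w) = 0" .
  then show ?thesis unfolding U power2_sum by (simp add: mult.assoc)
qed

end

section \<open>Copies of a hypergraph as classes of placements\<close>

lemma prod_of_bool: "finite A \<Longrightarrow> (\<Prod>a\<in>A. of_bool (P a)) = (of_bool (\<forall>a\<in>A. P a) :: real)"
  by (induction A rule: finite_induct) auto

context placement
begin

definition graph_of :: "(nat set \<Rightarrow> bool) \<Rightarrow> nat hypergraph" where
  "graph_of w = Hypergraph {1..n} {e \<in> U. w e}"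

definition autos :: "('a \<Rightarrow> 'a) set" where
  "autos = {\<pi> \<in> V \<rightarrow>\<^sub>E V. inj_on \<pi> V \<and> img \<pi> E = E}"

definition present :: "(nat set \<Rightarrow> bool) \<Rightarrow> ('a \<Rightarrow> nat) set" where
  "present w = {\<phi> \<in> emb. \<forall>e\<in>E. w (\<phi> ` e)}"

definition placed :: "('a \<Rightarrow> nat) \<Rightarrow> nat hypergraph" where
  "placed \<phi> = Hypergraph (\<phi> ` V) (img \<phi> E)"

lemma X_eq_card: "X w = real (card (present w))"
proof -
  have "X w = (\<Sum>\<phi>\<in>emb. of_bool (\<forall>e\<in>E. w (\<phi> ` e)))"
    unfolding X_def by (simp add: prod_of_bool finite_E)
  also have "\<dots> = real (card (emb \<inter> {\<phi>. \<forall>e\<in>E. w (\<phi> ` e)}))"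
    using finite_emb by simp
  also have "emb \<inter> {\<phi>. \<forall>e\<in>E. w (\<phi> ` e)} = present w" by (auto simp: present_def)
  finally show ?thesis .
qed

lemma E_subD: "e \<in> E \<Longrightarrow> e \<subseteq> V" using E_sub by auto

lemma wf_H: "wf_hypergraph (Hypergraph V E)"
  using E_sub finite_V by (simp add: wf_hypergraph_def)

text \<open>An isomorphism from a copy to the hypergraph, inverted, is a placement.\<close>

lemma placed_copies: "placed ` present w = copies (Hypergraph V E) n (graph_of w)"
proof
  show "placed ` present w \<subseteq> copies (Hypergraph V E) n (graph_of w)"
  proof
    fix H' assume "H' \<in> placed ` present w"
    then obtain \<phi> where \<phi>: "\<phi> \<in> emb" "\<forall>e\<in>E. w (\<phi> ` e)" and H': "H' = placed \<phi>" by (auto simp: present_def)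
    have U: "img \<phi> E \<subseteq> U" by (rule img_sub[OF \<phi>(1) subset_refl])
    have "img \<phi> E \<subseteq> Pow (\<phi> ` V) - {{}}" using E_sub unfolding img_def by blast
    then have wf: "wf_hypergraph H'" using finite_V by (simp add: H' placed_def wf_hypergraph_def)
    have V': "\<phi> ` V \<subseteq> {1..n}" using emb_image[OF \<phi>(1)] by simp
    have 1: "subhypergraph H' (complete_hypergraph n)"
      using wf U V' by (auto simp: subhypergraph_def complete_hypergraph_def wf_hypergraph_def H' placed_def U_def)
    have 2: "subhypergraph H' (graph_of w)"
      using wf U V' \<phi>(2) by (auto simp: subhypergraph_def graph_of_def wf_hypergraph_def H' placed_def U_def img_def)
    have "isomorphic H' (Hypergraph V E)"
      unfolding isomorphic_def
    proof (intro exI conjI)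
      note inj = emb_inj[OF \<phi>(1)]
      show "bij_betw (inv_into V \<phi>) (verts H') (verts (Hypergraph V E))"
        using bij_betw_inv_into[OF inj_on_imp_bij_betw[OF inj]] by (simp add: H' placed_def)
      have "inv_into V \<phi> ` (\<phi> ` e) = e" if "e \<in> E" for e
        using inv_into_image_cancel[OF inj E_subD[OF that]] .
      then show "(\<lambda>e. inv_into V \<phi> ` e) ` edges H' = edges (Hypergraph V E)"
        by (simp add: H' placed_def img_def image_image)
    qed
    then show "H' \<in> copies (Hypergraph V E) n (graph_of w)" using 1 2 by (simp add: copies_def)
  qed
  show "copies (Hypergraph V E) n (graph_of w) \<subseteq> placed ` present w"
  proof
    fix H' assume "H' \<in> copies (Hypergraph V E) n (graph_of w)"
    then have H': "subhypergraph H' (graph_of w)" "isomorphic H' (Hypergraph V E)" by (auto simp: copies_def)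
    then obtain f where f: "bij_betw f (verts H') V" "(\<lambda>e. f ` e) ` edges H' = E" by (auto simp: isomorphic_def)
    have sub: "verts H' \<subseteq> {1..n}" "edges H' \<subseteq> {e \<in> U. w e}" "edges H' \<subseteq> Pow (verts H')"
      using H'(1) by (auto simp: subhypergraph_def graph_of_def wf_hypergraph_def)
    define \<phi> where "\<phi> = restrict (inv_into (verts H') f) V"
    have inv: "bij_betw (inv_into (verts H') f) V (verts H')" by (rule bij_betw_inv_into[OF f(1)])
    then have b: "bij_betw \<phi> V (verts H')" unfolding \<phi>_def by (rule bij_betw_cong[THEN iffD1, rotated]) auto
    have \<phi>: "\<phi> \<in> emb" using b sub(1) by (auto simp: emb_def bij_betw_def \<phi>_def)
    have inv_img: "\<phi> ` (f ` e) = e" if "e \<in> edges H'" for e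
    proof -
      have e: "e \<subseteq> verts H'" using that sub(3) by auto
      then have "f ` e \<subseteq> V" using f(1) by (auto simp: bij_betw_def)
      then have "\<phi> ` (f ` e) = inv_into (verts H') f ` (f ` e)" unfolding \<phi>_def by (intro image_cong) auto
      also have "\<dots> = e" using f(1) e by (auto simp: bij_betw_def intro: inv_into_image_cancel)
      finally show ?thesis .
    qed
    have img: "img \<phi> E = edges H'"
    proof -
      have "img \<phi> E = (\<lambda>e. \<phi> ` (f ` e)) ` edges H'" unfolding img_def f(2)[symmetric] by (rule image_image)
      also have "\<dots> = (\<lambda>e. e) ` edges H'" by (rule image_cong[OF refl inv_img])
      finally show ?thesis by simp
    qed
    have "\<phi> \<in> present w" using \<phi> sub(2) img by (auto simp: present_def img_def)
    moreover have "placed \<phi> = H'" using img b by (cases H') (simp add: placed_def bij_betw_def)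
    ultimately show "H' \<in> placed ` present w" by blast
  qed
qed

text \<open>Two placements of the same copy differ by an automorphism.\<close>

lemma fibre_card:
  assumes "\<phi> \<in> present w"
  shows "card {\<theta> \<in> present w. placed \<theta> = placed \<phi>} = card autos"
proof -
  have \<phi>: "\<phi> \<in> emb" "\<forall>e\<in>E. w (\<phi> ` e)" using assms by (auto simp: present_def)
  note inj = emb_inj[OF \<phi>(1)]
  define f where "f \<pi> = restrict (\<phi> \<circ> \<pi>) V" for \<pi> :: "'a \<Rightarrow> 'a"
  define g where "g \<theta> = restrict (inv_into V \<phi> \<circ> \<theta>) V" for \<theta> :: "'a \<Rightarrow> nat"
  let ?F = "{\<theta> \<in> present w. placed \<theta> = placed \<phi>}"
  have img_f: "img (f \<pi>) E = img \<phi> (img \<pi> E)" for \<pi>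
    unfolding f_def img_def image_image using E_subD by (intro image_cong refl) (auto simp: image_def)
  have "bij_betw f autos ?F"
  proof (rule bij_betw_byWitness[where f' = g])
    show "\<forall>\<pi>\<in>autos. g (f \<pi>) = \<pi>"
    proof
      fix \<pi> assume "\<pi> \<in> autos"
      then have \<pi>: "\<pi> \<in> V \<rightarrow>\<^sub>E V" by (simp add: autos_def)
      show "g (f \<pi>) = \<pi>"
      proof
        fix x show "g (f \<pi>) x = \<pi> x"
        proof (cases "x \<in> V")
          case True
          then have "inv_into V \<phi> (\<phi> (\<pi> x)) = \<pi> x" using inv_into_f_f[OF inj PiE_mem[OF \<pi> True]] by simp
          then show ?thesis using True by (simp only: g_def f_def restrict_apply if_True o_apply)
        next
          case False
          then show ?thesis using PiE_arb[OF \<pi> False] by (simp add: g_def)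
        qed
      qed
    qed
    show "\<forall>\<theta>\<in>?F. f (g \<theta>) = \<theta>"
    proof
      fix \<theta> assume "\<theta> \<in> ?F"
      then have \<theta>: "\<theta> \<in> V \<rightarrow>\<^sub>E {1..n}" "\<theta> ` V = \<phi> ` V" by (auto simp: present_def emb_def placed_def)
      show "f (g \<theta>) = \<theta>"
      proof
        fix x show "f (g \<theta>) x = \<theta> x"
        proof (cases "x \<in> V")
          case True
          then have "\<theta> x \<in> \<phi> ` V" using \<theta>(2) by blast
          then have "\<phi> (inv_into V \<phi> (\<theta> x)) = \<theta> x" by (rule f_inv_into_f)
          then show ?thesis using True by (simp only: g_def f_def restrict_apply if_True o_apply)
        next
          case False
          then show ?thesis using PiE_arb[OF \<theta>(1) False] by (simp add: f_def)
        qed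
      qed
    qed
    show "f ` autos \<subseteq> ?F"
    proof
      fix \<theta> assume "\<theta> \<in> f ` autos"
      then obtain \<pi> where \<pi>: "\<pi> \<in> V \<rightarrow>\<^sub>E V" "inj_on \<pi> V" "img \<pi> E = E" and \<theta>: "\<theta> = f \<pi>" by (auto simp: autos_def)
      have \<pi>V: "\<pi> ` V = V" using \<pi> finite_V by (intro endo_inj_surj) auto
      have im: "\<theta> ` V = \<phi> ` V"
      proof -
        have "\<theta> ` V = \<phi> ` (\<pi> ` V)" unfolding \<theta> f_def by (auto simp: image_def)
        then show ?thesis using \<pi>V by simp
      qed
      have ie: "img \<theta> E = img \<phi> E" unfolding \<theta> img_f \<pi>(3) ..
      have "inj_on (\<phi> \<circ> \<pi>) V" using \<pi>(2) inj \<pi>V by (simp add: comp_inj_on)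
      then have "inj_on \<theta> V" unfolding \<theta> f_def by (simp add: inj_on_def)
      moreover have "\<theta> ` V \<subseteq> {1..n}" using emb_image[OF \<phi>(1)] unfolding im by blast
      moreover have "\<theta> \<in> extensional V" by (simp add: \<theta> f_def)
      ultimately have "\<theta> \<in> emb" unfolding emb_def PiE_def by blast
      moreover have "\<forall>e\<in>E. w (\<theta> ` e)"
      proof
        fix e assume "e \<in> E"
        then have "\<theta> ` e \<in> img \<theta> E" unfolding img_def by (rule imageI)
        then have "\<theta> ` e \<in> img \<phi> E" unfolding ie .
        then show "w (\<theta> ` e)" using \<phi>(2) by (auto simp: img_def)
      qed
      ultimately show "\<theta> \<in> ?F" using im ie by (simp add: present_def placed_def)
    qed
    show "g ` ?F \<subseteq> autos"
    proof
      fix \<pi> assume "\<pi> \<in> g ` ?F"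
      then obtain \<theta> where \<theta>: "\<theta> \<in> emb" "\<theta> ` V = \<phi> ` V" "img \<theta> E = img \<phi> E" and \<pi>: "\<pi> = g \<theta>"
        by (auto simp: present_def placed_def)
      have bt: "bij_betw \<theta> V (\<phi> ` V)" using emb_inj[OF \<theta>(1)] \<theta>(2) by (simp add: bij_betw_def)
      have "bij_betw (inv_into V \<phi> \<circ> \<theta>) V V"
        by (rule bij_betw_trans[OF bt bij_betw_inv_into[OF inj_on_imp_bij_betw[OF inj]]])
      then have b: "bij_betw \<pi> V V" unfolding \<pi> g_def by (rule bij_betw_cong[THEN iffD1, rotated]) auto
      have "img \<pi> E = E"
      proof -
        have "img \<pi> E = (\<lambda>e. inv_into V \<phi> ` e) ` img \<theta> E"
          unfolding \<pi> g_def img_def image_image using E_subD by (intro image_cong refl) (auto simp: image_def)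
        also have "\<dots> = (\<lambda>e. inv_into V \<phi> ` (\<phi> ` e)) ` E" unfolding \<theta>(3) unfolding img_def by (rule image_image)
        also have "\<dots> = (\<lambda>e. e) ` E" by (rule image_cong[OF refl inv_into_image_cancel[OF inj E_subD]])
        also have "\<dots> = E" by simp
        finally show ?thesis .
      qed
      then show "\<pi> \<in> autos" using b unfolding autos_def by (auto simp: bij_betw_def \<pi> g_def)
    qed
  qed
  then show ?thesis by (simp add: bij_betw_same_card)
qed

lemma autos_pos: "0 < card autos"
proof -
  have "finite autos" unfolding autos_def using finite_V by (intro finite_subset[OF _ finite_PiE[of V "\<lambda>_. V"]]) auto
  moreover have "restrict id V \<in> autos"
  proof -
    have "restrict id V ` e = e" if "e \<in> E" for e using E_subD[OF that] by (force simp: image_def)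
    then show ?thesis unfolding autos_def img_def by (auto simp: inj_on_def)
  qed
  ultimately show ?thesis by (auto simp: card_gt_0_iff)
qed

lemma X_eq_Z: "X w = real (card autos) * Z (Hypergraph V E) n (graph_of w)"
proof -
  have fin: "finite (present w)" unfolding present_def using finite_emb by simp
  have "card (present w) = (\<Sum>H'\<in>placed ` present w. card {\<theta> \<in> present w. placed \<theta> = H'})"
    using sum.image_gen[OF fin, of "\<lambda>_. 1 :: nat" placed] by simp
  also have "\<dots> = (\<Sum>H'\<in>placed ` present w. card autos)"
    by (rule sum.cong) (auto simp: fibre_card)
  also have "\<dots> = card autos * card (placed ` present w)" by simp
  finally show ?thesis unfolding X_eq_card Z_def placed_copies[symmetric] by simp
qed

lemma binomial_hypergraph_eq: "binomial_hypergraph n p = map_pmf graph_of space_pmf"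
proof -
  have "edges (complete_hypergraph n) = U" by (simp add: complete_hypergraph_def U_def)
  then show ?thesis unfolding binomial_hypergraph_def space_pmf_def graph_of_def by simp
qed

lemma Z_std_graph_of: "Z_std (Hypergraph V E) n p (graph_of w) = W w"
proof -
  let ?a = "real (card autos)"
  have a: "?a > 0" using autos_pos by simp
  have Z: "Z (Hypergraph V E) n (graph_of w) = X w / ?a" for w using X_eq_Z[of w] a by simp
  have m: "measure_pmf.expectation (binomial_hypergraph n p) (Z (Hypergraph V E) n) = Ex X / ?a"
    unfolding binomial_hypergraph_eq by (simp add: Z)
  have "measure_pmf.variance (binomial_hypergraph n p) (Z (Hypergraph V E) n) = Ex (\<lambda>w. (X w / ?a - Ex X / ?a)\<^sup>2)"
    unfolding m unfolding binomial_hypergraph_eq by (simp add: Z)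
  also have "\<dots> = Ex (\<lambda>w. (X w - Ex X)\<^sup>2 / ?a\<^sup>2)"
    by (simp add: diff_divide_distrib[symmetric] power_divide)
  also have "\<dots> = varX / ?a\<^sup>2" by (simp add: varX_def)
  finally have v: "measure_pmf.variance (binomial_hypergraph n p) (Z (Hypergraph V E) n) = varX / ?a\<^sup>2" .
  show ?thesis
    unfolding Z_std_def v unfolding m Z W_def using a by (simp add: real_sqrt_divide diff_divide_distrib[symmetric])
qed

lemma char_Z_std:
  "char (distr (measure_pmf (binomial_hypergraph n p)) borel (Z_std (Hypergraph V E) n p)) t = Ex (\<lambda>w. iexp (t * W w))"
  unfolding char_def
  by (subst integral_distr) (auto simp: binomial_hypergraph_eq Z_std_graph_of)

end

section \<open>Gaussian approximation of the good part\<close>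

context placement
begin

text \<open>The nonempty edge sets are split according to a set \<open>Gd\<close> of good edge sizes.\<close>

definition all_good :: "nat set \<Rightarrow> 'a set set set" where
  "all_good Gd = {F \<in> nonempty_subs. card ` F \<subseteq> Gd}"

definition single_bad :: "nat set \<Rightarrow> 'a set set set" where
  "single_bad Gd = {F \<in> nonempty_subs. card F = 1 \<and> \<not> card ` F \<subseteq> Gd}"

definition mixed :: "nat set \<Rightarrow> 'a set set set" where
  "mixed Gd = {F \<in> nonempty_subs. card F \<noteq> 1 \<and> \<not> card ` F \<subseteq> Gd}"

lemma parts_sub: "all_good Gd \<subseteq> nonempty_subs" "single_bad Gd \<subseteq> nonempty_subs" "mixed Gd \<subseteq> nonempty_subs"
  by (auto simp: all_good_def single_bad_def mixed_def)

lemma W_parts: "W w = part (single_bad Gd) w + part (all_good Gd) w + part (mixed Gd) w"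
proof -
  have "nonempty_subs = (single_bad Gd \<union> all_good Gd) \<union> mixed Gd"
    by (auto simp: all_good_def single_bad_def mixed_def)
  moreover have "part ((single_bad Gd \<union> all_good Gd) \<union> mixed Gd) w = part (single_bad Gd \<union> all_good Gd) w + part (mixed Gd) w"
    by (rule part_Un) (auto simp: all_good_def single_bad_def mixed_def)
  moreover have "part (single_bad Gd \<union> all_good Gd) w = part (single_bad Gd) w + part (all_good Gd) w"
    by (rule part_Un) (auto simp: all_good_def single_bad_def)
  ultimately show ?thesis unfolding W_eq_part by simp
qed

lemma parts_variance:
  "Ex (\<lambda>w. (part (single_bad Gd) w)\<^sup>2) + Ex (\<lambda>w. (part (all_good Gd) w)\<^sup>2) + Ex (\<lambda>w. (part (mixed Gd) w)\<^sup>2) = 1"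
proof -
  have u: "nonempty_subs = (single_bad Gd \<union> all_good Gd) \<union> mixed Gd"
    by (auto simp: all_good_def single_bad_def mixed_def)
  have 1: "Ex (\<lambda>w. (part (single_bad Gd \<union> all_good Gd) w)\<^sup>2) =
      Ex (\<lambda>w. (part (single_bad Gd) w)\<^sup>2) + Ex (\<lambda>w. (part (all_good Gd) w)\<^sup>2)"
  proof (rule Ex_part_Un_squared[OF parts_sub(2,1)])
    fix F F' assume "F \<in> single_bad Gd" "F' \<in> all_good Gd"
    then have "\<not> card ` F \<subseteq> Gd" "card ` F' \<subseteq> Gd" unfolding all_good_def single_bad_def by blast+
    then show "card F \<noteq> card F' \<or> card ` F \<noteq> card ` F'" by metis
  qed
  have 2: "Ex (\<lambda>w. (part ((single_bad Gd \<union> all_good Gd) \<union> mixed Gd) w)\<^sup>2) =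
      Ex (\<lambda>w. (part (single_bad Gd \<union> all_good Gd) w)\<^sup>2) + Ex (\<lambda>w. (part (mixed Gd) w)\<^sup>2)"
  proof (rule Ex_part_Un_squared)
    fix F F' assume F: "F \<in> single_bad Gd \<union> all_good Gd" and F': "F' \<in> mixed Gd"
    show "card F \<noteq> card F' \<or> card ` F \<noteq> card ` F'"
    proof (cases "F \<in> single_bad Gd")
      case True
      then have "card F \<noteq> card F'" using F' by (auto simp: single_bad_def mixed_def)
      then show ?thesis by simp
    next
      case False
      then have "F \<in> all_good Gd" using F by simp
      then have "card ` F \<subseteq> Gd" "\<not> card ` F' \<subseteq> Gd" using F' unfolding all_good_def mixed_def by blast+
      then show ?thesis by metis
    qed
  qed (auto simp: all_good_def single_bad_def mixed_def)
  show ?thesis using Ex_W_squared 1 2 unfolding W_eq_part by (simp only: u[symmetric])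
qed

text \<open>Removing \<open>e\<close> does not increase the number of vertices and removes the factor \<open>(1 - p (card e)) / p (card e)\<close>.\<close>

lemma psi_remove_le:
  assumes F: "F \<subseteq> E" and e: "e \<in> F" and "F - {e} \<noteq> {}" and pe: "1 / 2 \<le> p (card e)"
  shows "psi n p F \<le> 2 * (1 - p (card e)) * psi n p (F - {e})"
proof -
  have finF: "finite F" using F finite_E finite_subset by blast
  have P: "wP p F = p (card e) * wP p (F - {e})" and Q: "wQ p F = (1 - p (card e)) * wQ p (F - {e})"
    unfolding wP_def wQ_def using finF e by (simp_all add: prod.remove)
  have F': "F - {e} \<subseteq> E" using F by auto
  note pos = wP_pos[OF F'] wQ_pos[OF F']
  have pe1: "p (card e) < 1" using E_p F e by auto
  have N: "real n \<ge> 1" using n_pos by simp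
  have pw: "real n ^ card (\<Union>(F - {e})) \<le> real n ^ card (\<Union>F)"
  proof (rule power_increasing[OF card_mono N])
    have "\<Union>F \<subseteq> V" using F E_sub by auto
    then show "finite (\<Union>F)" by (rule finite_subset[OF _ finite_V])
    show "\<Union>(F - {e}) \<subseteq> \<Union>F" by (rule Union_mono) auto
  qed
  have "psi n p F \<le> (1 - p (card e)) * wQ p (F - {e}) / (1 / 2 * wP p (F - {e}) * real n ^ card (\<Union>(F - {e})))"
    unfolding psi_def P Q
  proof (rule divide_left_mono)
    show "1 / 2 * wP p (F - {e}) * real n ^ card (\<Union>(F - {e})) \<le> p (card e) * wP p (F - {e}) * real n ^ card (\<Union>F)"
      using pw pe pos N by (intro mult_mono) auto
  qed (use pos pe1 pe N in \<open>auto intro!: mult_pos_pos\<close>)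
  also have "\<dots> = 2 * (1 - p (card e)) * psi n p (F - {e})" by (simp add: psi_def)
  finally show ?thesis .
qed

lemma iexp_diff_le: "cmod (iexp x - iexp y) \<le> \<bar>x - y\<bar>"
proof -
  have "iexp x - iexp y = iexp y * (iexp (x - y) - 1)"
    by (simp add: exp_diff right_diff_distrib)
  then have "cmod (iexp x - iexp y) = cmod (iexp (x - y) - 1)" by (simp only: norm_mult norm_exp_i_times mult_1_left)
  also have "\<dots> \<le> \<bar>x - y\<bar>" using iexp_approx1[of "x - y" 0] by simp
  finally show ?thesis .
qed

lemma Ex_iexp_diff_le:
  "cmod (Ex (\<lambda>w. iexp (f w)) - Ex (\<lambda>w. iexp (g w))) \<le> sqrt (Ex (\<lambda>w. (f w - g w)\<^sup>2))"
proof -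
  have "Ex (\<lambda>w. iexp (f w)) - Ex (\<lambda>w. iexp (g w)) = Ex (\<lambda>w. iexp (f w) - iexp (g w))"
    by (rule Bochner_Integration.integral_diff[symmetric]) auto
  then have "cmod (Ex (\<lambda>w. iexp (f w)) - Ex (\<lambda>w. iexp (g w))) = cmod (Ex (\<lambda>w. iexp (f w) - iexp (g w)))"
    by (rule arg_cong)
  also have "\<dots> \<le> Ex (\<lambda>w. cmod (iexp (f w) - iexp (g w)))"
    by (rule integral_norm_bound)
  also have "\<dots> \<le> Ex (\<lambda>w. \<bar>f w - g w\<bar>)" by (rule Ex_mono) (rule iexp_diff_le)
  also have "\<dots> \<le> sqrt (Ex (\<lambda>w. (f w - g w)\<^sup>2))" by (rule Ex_abs_le)
  finally show ?thesis .
qed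

definition rest_const :: real where "rest_const = 4 ^ card E * (cvar * (4 ^ card V * 2))"

context
  fixes M \<epsilon> :: real and B0 :: "'a set set" and Gd :: "nat set"
  assumes M_upper: "\<And>B. B \<in> nonempty_subs \<Longrightarrow> psi n p B \<le> M"
    and M_lower: "B0 \<in> nonempty_subs" "M \<le> psi n p B0"
    and dense: "\<And>B. B \<in> nonempty_subs \<Longrightarrow> 1 \<le> \<epsilon> * (real n ^ card (\<Union>B) * wP p B)"
    and eps_n: "1 \<le> \<epsilon> * real n"
    and good: "\<And>e. e \<in> E \<Longrightarrow> card e \<in> Gd \<Longrightarrow> 1 \<le> \<epsilon> * (real n ^ card e * (1 - p (card e)))"
    and bad: "\<And>e. e \<in> E \<Longrightarrow> card e \<notin> Gd \<Longrightarrow> 1 - p (card e) \<le> \<epsilon> \<and> 1 / 2 \<le> p (card e)"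
begin

lemma family: "placement_family V E n p (all_good Gd) coef (4 ^ card V) M \<epsilon>"
proof unfold_locales
  show "all_good Gd \<subseteq> Pow E - {{}}" by (auto simp: all_good_def nonempty_subs_def)
  show "(coef F)\<^sup>2 * (wP p F)\<^sup>2 * M * real n ^ (2 * card V) \<le> 4 ^ card V" if "F \<in> all_good Gd" for F
    by (rule coef_squared_le[OF _ M_lower(2,1)]) (use that in \<open>auto simp: all_good_def nonempty_subs_def\<close>)
  show "1 \<le> \<epsilon> * (real n ^ card e * (1 - p (card e)))" if "F \<in> all_good Gd" "e \<in> F" for F e
    by (rule good) (use that in \<open>auto simp: all_good_def nonempty_subs_def\<close>)
qed (use M_upper dense eps_n in \<open>auto simp: nonempty_subs_def\<close>)

lemma mixed_small: "Ex (\<lambda>w. (part (mixed Gd) w)\<^sup>2) \<le> rest_const * \<epsilon>"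
proof -
  interpret pf: placement_family V E n p "all_good Gd" coef "4 ^ card V" M \<epsilon> by (rule family)
  have "Ex (\<lambda>w. (part (mixed Gd) w)\<^sup>2) \<le> 4 ^ card E * (cvar * (4 ^ card V * (2 * \<epsilon>)))"
  proof (rule Ex_part_squared_le[OF parts_sub(3) M_lower(2,1) pf.M_pos])
    show "0 \<le> 2 * \<epsilon>" using pf.eps_pos by simp
    fix F assume F: "F \<in> mixed Gd"
    then have FE: "F \<subseteq> E" "F \<noteq> {}" "card F \<noteq> 1" using parts_sub(3) subsD by (auto simp: mixed_def)
    obtain e where e: "e \<in> F" "card e \<notin> Gd" using F by (auto simp: mixed_def)
    have ne: "F - {e} \<noteq> {}"
    proof
      assume "F - {e} = {}"
      then have "F = {e}" using e by auto
      then show False using FE by simp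
    qed
    have b: "1 - p (card e) \<le> \<epsilon>" "1 / 2 \<le> p (card e)" using bad[of e] e FE by auto
    have "psi n p F \<le> 2 * (1 - p (card e)) * psi n p (F - {e})"
      by (rule psi_remove_le[OF FE(1) e(1) ne b(2)])
    also have "\<dots> \<le> 2 * \<epsilon> * M"
    proof (rule mult_mono)
      show "psi n p (F - {e}) \<le> M" using FE ne by (intro M_upper) (auto simp: nonempty_subs_def)
      have "F - {e} \<subseteq> E" using FE by auto
      then show "0 \<le> psi n p (F - {e})"
        using wP_pos[of "F - {e}"] wQ_pos[of "F - {e}"] by (simp add: psi_def)
    qed (use b pf.eps_pos in auto)
    finally show "psi n p F \<le> 2 * \<epsilon> * M" .
  qed
  then show ?thesis by (simp add: rest_const_def mult_ac)
qed

lemma single_bad_upd: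
  assumes "\<phi> \<in> emb" "F \<in> all_good Gd" "e \<in> img \<phi> F"
  shows "part (single_bad Gd) (w(e := b)) = part (single_bad Gd) w"
proof -
  have card_img: "card e' \<in> card ` F'" if m: "\<theta> \<in> emb" "F' \<subseteq> E" "e' \<in> img \<theta> F'" for \<theta> F' e'
  proof -
    obtain g where g: "g \<in> F'" "e' = \<theta> ` g" using m(3) by (auto simp: img_def)
    then have "card e' = card g"
      using m E_sub by (auto intro!: card_image inj_on_subset[OF emb_inj])
    then show ?thesis using g by auto
  qed
  have Gd: "card e \<in> Gd"
    using card_img[OF assms(1) _ assms(3)] assms(2) by (auto simp: all_good_def nonempty_subs_def)
  have "e \<notin> img \<theta> F'" if "\<theta> \<in> emb" "F' \<in> single_bad Gd" for \<theta> F'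
  proof
    assume "e \<in> img \<theta> F'"
    moreover have F': "F' \<subseteq> E" "\<not> card ` F' \<subseteq> Gd" "card F' = 1" using that(2) by (auto simp: single_bad_def nonempty_subs_def)
    ultimately have "card e \<in> card ` F'" using card_img that(1) by blast
    moreover obtain g where "F' = {g}" using F'(3) card_1_singletonE by blast
    ultimately show False using Gd F'(2) by auto
  qed
  then show ?thesis unfolding part_def walsh_sum_def
    by (intro sum.cong refl arg_cong2[where f = "(*)"] walsh_upd) auto
qed

text \<open>The part of the single bad edges depends on other coordinates than the part of the good sets, so it
  can serve as the factor \<open>h\<close> in \<open>clt_bound\<close>.\<close>

lemma gaussian_approx:
  defines "C \<equiv> placement_family.clt_const V E (4 ^ card V)"
  shows "cmod (Ex (\<lambda>w. iexp (t * W w)) - Ex (\<lambda>w. iexp (t * part (single_bad Gd) w)) *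
      of_real (exp (- (Ex (\<lambda>w. (part (all_good Gd) w)\<^sup>2) * t\<^sup>2 / 2))))
    \<le> t\<^sup>2 * sqrt (C * \<epsilon>) + \<bar>t\<bar> ^ 3 / 2 * (C * sqrt \<epsilon>) + \<bar>t\<bar> * sqrt (rest_const * \<epsilon>)"
proof -
  interpret pf: placement_family V E n p "all_good Gd" coef "4 ^ card V" M \<epsilon> by (rule family)
  let ?A = "part (single_bad Gd)" and ?G = "part (all_good Gd)" and ?R = "part (mixed Gd)"
  have G: "pf.G = ?G"
  proof
    fix w show "pf.G w = ?G w"
      unfolding pf.G_def part_def walsh_sum_def sum_distrib_left
      by (subst sum.swap, subst sum.cartesian_product) (auto intro!: sum.cong)
  qed
  have "cmod (Ex (\<lambda>w. iexp (t * ?A w) * iexp (t * pf.G w)) - Ex (\<lambda>w. iexp (t * ?A w)) *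
      of_real (exp (- (Ex (\<lambda>w. (pf.G w)\<^sup>2) * t\<^sup>2 / 2)))) \<le> t\<^sup>2 * sqrt (pf.clt_const * \<epsilon>) + \<bar>t\<bar> ^ 3 / 2 * (pf.clt_const * sqrt \<epsilon>)"
  proof (rule pf.clt_bound)
    show "cmod (iexp (t * ?A w)) \<le> 1" for w by (simp only: norm_exp_i_times order_refl)
    show "iexp (t * ?A (w(e := b))) = iexp (t * ?A w)" if "\<phi> \<in> emb" "F \<in> all_good Gd" "e \<in> img \<phi> F" for \<phi> F e w b
      by (simp only: single_bad_upd[OF that])
  qed
  then have main: "cmod (Ex (\<lambda>w. iexp (t * (?A w + ?G w))) - Ex (\<lambda>w. iexp (t * ?A w)) *
      of_real (exp (- (Ex (\<lambda>w. (?G w)\<^sup>2) * t\<^sup>2 / 2)))) \<le> t\<^sup>2 * sqrt (C * \<epsilon>) + \<bar>t\<bar> ^ 3 / 2 * (C * sqrt \<epsilon>)"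
    unfolding G C_def by (simp add: exp_add[symmetric] distrib_left)
  have "cmod (Ex (\<lambda>w. iexp (t * W w)) - Ex (\<lambda>w. iexp (t * (?A w + ?G w)))) \<le> sqrt (Ex (\<lambda>w. (t * W w - t * (?A w + ?G w))\<^sup>2))"
    by (rule Ex_iexp_diff_le)
  also have "\<dots> = sqrt (Ex (\<lambda>w. t\<^sup>2 * (?R w)\<^sup>2))"
    unfolding W_parts[of _ Gd] by (simp add: algebra_simps power_mult_distrib)
  also have "\<dots> = \<bar>t\<bar> * sqrt (Ex (\<lambda>w. (?R w)\<^sup>2))" by (simp add: real_sqrt_mult)
  also have "\<dots> \<le> \<bar>t\<bar> * sqrt (rest_const * \<epsilon>)"
    by (intro mult_left_mono real_sqrt_le_mono mixed_small) auto
  finally have rest: "cmod (Ex (\<lambda>w. iexp (t * W w)) - Ex (\<lambda>w. iexp (t * (?A w + ?G w)))) \<le> \<bar>t\<bar> * sqrt (rest_const * \<epsilon>)" .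
  show ?thesis
    using norm_triangle_le[OF add_mono[OF rest main]] by (simp add: algebra_simps)
qed

end

end

section \<open>The excess of a trigonometric polynomial over a Gaussian\<close>

text \<open>Let \<open>v\<close> be the variance of the indicator of an event. The characteristic function at 1 of \<open>x\<close> times this
  indicator has squared modulus \<open>1 - 2 * v * (1 - cos x)\<close>, against \<open>exp (- v * x\<^sup>2)\<close> for a Gaussian variable of the same variance. To
  first order in \<open>v\<close>, the logarithms differ by \<open>v\<close> times the defect.\<close>

definition cos_defect :: "real \<Rightarrow> real" where
  "cos_defect x = x\<^sup>2 - 2 * (1 - cos x)"

lemma cos_defect_ge: "min (x ^ 4 / 24) (11 / 15 * x\<^sup>2) \<le> cos_defect x"
proof (cases "x\<^sup>2 \<le> 15")
  case True
  obtain t where t: "cos x = (\<Sum>m<6. cos_coeff m * x ^ m) + cos (t + 1 / 2 * real 6 * pi) / fact 6 * x ^ 6"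
    using Maclaurin_cos_expansion[of x 6] by blast
  have sum: "(\<Sum>m<6. cos_coeff m * x ^ m) = 1 - x\<^sup>2 / 2 + x ^ 4 / 24"
  proof -
    have "{..<6} = {0, 1, 2, 3, 4, 5 :: nat}" by auto
    then show ?thesis by (simp add: cos_coeff_def fact_numeral)
  qed
  have x6: "x ^ 6 = x\<^sup>2 * x ^ 4" by (simp flip: power_add)
  have "- 1 * (x ^ 6 / 720) \<le> cos (t + 1 / 2 * real 6 * pi) * (x ^ 6 / 720)"
    by (intro mult_right_mono) auto
  then have c: "1 - x\<^sup>2 / 2 + x ^ 4 / 24 - x ^ 6 / 720 \<le> cos x"
    using t unfolding sum by (simp add: fact_numeral)
  have "x ^ 6 \<le> 15 * x ^ 4" unfolding x6 using True by (intro mult_right_mono) auto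
  then have "x ^ 4 / 24 \<le> cos_defect x" using c unfolding cos_defect_def by simp
  then show ?thesis by linarith
next
  case False
  have "2 * (1 - cos x) \<le> 4" using cos_ge_minus_one[of x] by argo
  then have "11 / 15 * x\<^sup>2 \<le> cos_defect x" using False unfolding cos_defect_def by simp
  then show ?thesis by linarith
qed

lemma cos_defect_nonneg: "0 \<le> cos_defect x"
proof -
  have "0 \<le> min (x ^ 4 / 24) (11 / 15 * x\<^sup>2)" by (simp add: min_def)
  then show ?thesis using cos_defect_ge by (rule order_trans)
qed

lemma cos_defect_ge_square:
  assumes "\<beta> \<le> x\<^sup>2" "0 \<le> \<beta>"
  shows "min (\<beta> / 24) (11 / 15) * x\<^sup>2 \<le> cos_defect x"
proof -
  have "\<beta> * x\<^sup>2 \<le> x\<^sup>2 * x\<^sup>2" using assms by (intro mult_right_mono) auto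
  then have "\<beta> / 24 * x\<^sup>2 \<le> x ^ 4 / 24" by (simp flip: power_add)
  moreover have "min (\<beta> / 24) (11 / 15) * x\<^sup>2 \<le> \<beta> / 24 * x\<^sup>2" by (intro mult_right_mono) auto
  moreover have "min (\<beta> / 24) (11 / 15) * x\<^sup>2 \<le> 11 / 15 * x\<^sup>2" by (intro mult_right_mono) auto
  ultimately show ?thesis using cos_defect_ge[of x] by linarith
qed

lemma norm_bernoulli_char_squared:
  fixes r b :: real
  shows "(cmod (r *\<^sub>R iexp (b * (1 - r)) + (1 - r) *\<^sub>R iexp (b * (0 - r))))\<^sup>2 = 1 - 2 * (r * (1 - r)) * (1 - cos b)"
proof -
  have "r *\<^sub>R iexp (b * (1 - r)) + (1 - r) *\<^sub>R iexp (b * (0 - r)) = iexp (- (b * r)) * (of_real r * iexp b + of_real (1 - r))"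
    by (simp add: scaleR_conv_of_real distrib_left exp_add[symmetric] algebra_simps)
  then have "cmod (r *\<^sub>R iexp (b * (1 - r)) + (1 - r) *\<^sub>R iexp (b * (0 - r))) = cmod (of_real r * iexp b + of_real (1 - r))"
    by (simp only: norm_mult norm_exp_i_times mult_1_left)
  also have "of_real r * iexp b + of_real (1 - r) = Complex (r * cos b + (1 - r)) (r * sin b)"
    by (simp add: complex_eq_iff Re_exp Im_exp)
  also have "(cmod \<dots>)\<^sup>2 = (r * cos b + (1 - r))\<^sup>2 + (r * sin b)\<^sup>2"
    by (simp add: cmod_power2)
  also have "\<dots> = r\<^sup>2 * ((cos b)\<^sup>2 + (sin b)\<^sup>2) + 2 * r * (1 - r) * cos b + (1 - r)\<^sup>2"
  proof -
    have "(r * c + (1 - r))\<^sup>2 + (r * s)\<^sup>2 = r\<^sup>2 * (c\<^sup>2 + s\<^sup>2) + 2 * r * (1 - r) * c + (1 - r)\<^sup>2" for c s :: real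
      by (simp add: power2_eq_square algebra_simps)
    then show ?thesis .
  qed
  also have "\<dots> = 1 - 2 * (r * (1 - r)) * (1 - cos b)"
    by (simp add: power2_eq_square algebra_simps)
  finally show ?thesis .
qed

lemma one_minus_ge_exp:
  assumes "0 \<le> x" "x \<le> 1 / 2"
  shows "exp (- (x + 2 * x\<^sup>2)) \<le> 1 - (x :: real)"
proof -
  have "- x - 2 * x\<^sup>2 \<le> ln (1 - x)" using ln_one_minus_pos_lower_bound[OF assms] by simp
  then have "exp (- x - 2 * x\<^sup>2) \<le> exp (ln (1 - x))" by (simp only: exp_le_cancel_iff)
  then show ?thesis using assms by (simp add: algebra_simps)
qed

context bernoulli_product
begin

lemma Ex_linear_squared:
  assumes "B \<subseteq> U"
  shows "Ex (\<lambda>w. (\<Sum>f\<in>B. b f * xi f w)\<^sup>2) = (\<Sum>f\<in>B. var1 f * (b f)\<^sup>2)"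
proof -
  have fin: "finite B" using assms finite_U finite_subset by blast
  have xi: "xi f w = walsh {f} w" for f w by (simp add: walsh_def)
  have "Ex (\<lambda>w. (\<Sum>f\<in>B. b f * xi f w)\<^sup>2) = Ex (\<lambda>w. \<Sum>f\<in>B. \<Sum>g\<in>B. b f * b g * (walsh {f} w * walsh {g} w))"
    unfolding power2_eq_square sum_product xi by (simp add: mult_ac)
  also have "\<dots> = (\<Sum>f\<in>B. \<Sum>g\<in>B. b f * b g * Ex (\<lambda>w. walsh {f} w * walsh {g} w))"
    by (simp add: Bochner_Integration.integral_sum)
  also have "\<dots> = (\<Sum>f\<in>B. \<Sum>g\<in>B. if g = f then b f * b g * var1 f else 0)"
    by (intro sum.cong refl) (use assms in \<open>subst Ex_walsh_mult; auto\<close>)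
  also have "\<dots> = (\<Sum>f\<in>B. var1 f * (b f)\<^sup>2)"
    using fin by (intro sum.cong refl) (simp add: power2_eq_square mult_ac)
  finally show ?thesis .
qed

text \<open>By independence, the squared modulus is the product of the factors \<open>1 - 2 * var1 f * (1 - cos (b f))\<close>; since
  \<open>var1 f \<le> \<epsilon>\<close>, each of them is nearly the exponential of minus the quantity that is subtracted from 1.\<close>

lemma norm_Ex_iexp_linear_ge:
  assumes B: "B \<subseteq> U" and small: "\<And>f. f \<in> B \<Longrightarrow> 1 - r f \<le> \<epsilon>" and eps0: "0 \<le> \<epsilon>" and eps: "\<epsilon> \<le> 1 / 8"
    and v1: "(\<Sum>f\<in>B. var1 f * (b f)\<^sup>2) \<le> 1"
  shows "exp (- ((\<Sum>f\<in>B. var1 f * (b f)\<^sup>2) - (\<Sum>f\<in>B. var1 f * cos_defect (b f)) + 8 * \<epsilon>))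
    \<le> (cmod (Ex (\<lambda>w. iexp (\<Sum>f\<in>B. b f * xi f w))))\<^sup>2"
proof -
  have fin: "finite B" using B finite_U finite_subset by blast
  define x where "x f = 2 * var1 f * (1 - cos (b f))" for f
  have v0: "0 \<le> var1 f" if "f \<in> B" for f using that B var1_nonneg by auto
  have x0: "0 \<le> x f" if "f \<in> B" for f
    unfolding x_def using v0[OF that] by (intro mult_nonneg_nonneg) auto
  have xe: "x f \<le> 4 * \<epsilon>" if "f \<in> B" for f
  proof -
    have v: "var1 f \<le> 1 * \<epsilon>" unfolding var1_def using small[OF that] r_bounds[of f] that B by (intro mult_mono) auto
    have "2 * var1 f * (1 - cos (b f)) \<le> 2 * \<epsilon> * 2"
    proof (rule mult_mono)
      show "1 - cos (b f) \<le> 2" using cos_ge_minus_one[of "b f"] by argo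
    qed (use v v0[OF that] eps0 in auto)
    then show ?thesis by (simp add: x_def)
  qed
  have xb: "x f = var1 f * (b f)\<^sup>2 - var1 f * cos_defect (b f)" for f
    unfolding x_def cos_defect_def by (simp add: algebra_simps)
  have sum_x: "(\<Sum>f\<in>B. x f) = (\<Sum>f\<in>B. var1 f * (b f)\<^sup>2) - (\<Sum>f\<in>B. var1 f * cos_defect (b f))"
    unfolding xb by (rule sum_subtractf)
  have "(\<Sum>f\<in>B. x f) \<le> (\<Sum>f\<in>B. var1 f * (b f)\<^sup>2)"
    unfolding xb using v0 cos_defect_nonneg by (intro sum_mono) simp
  then have sx1: "(\<Sum>f\<in>B. x f) \<le> 1" using v1 by linarith
  have "(\<Sum>f\<in>B. x f + 2 * (x f)\<^sup>2) \<le> (\<Sum>f\<in>B. x f + 8 * \<epsilon> * x f)"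
  proof (rule sum_mono)
    fix f assume f: "f \<in> B"
    have "x f * x f \<le> 4 * \<epsilon> * x f" by (rule mult_right_mono[OF xe[OF f] x0[OF f]])
    then show "x f + 2 * (x f)\<^sup>2 \<le> x f + 8 * \<epsilon> * x f" by (simp add: power2_eq_square)
  qed
  also have "\<dots> = (\<Sum>f\<in>B. x f) + 8 * \<epsilon> * (\<Sum>f\<in>B. x f)"
    by (simp add: sum.distrib sum_distrib_left)
  also have "\<dots> \<le> (\<Sum>f\<in>B. x f) + 8 * \<epsilon> * 1"
    by (intro add_left_mono mult_left_mono sx1) (use eps0 in auto)
  finally have "exp (- ((\<Sum>f\<in>B. x f) + 8 * \<epsilon>)) \<le> exp (- (\<Sum>f\<in>B. x f + 2 * (x f)\<^sup>2))" by simp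
  also have "\<dots> = (\<Prod>f\<in>B. exp (- (x f + 2 * (x f)\<^sup>2)))"
    using fin by (simp only: sum_negf[symmetric] exp_sum)
  also have "\<dots> \<le> (\<Prod>f\<in>B. 1 - x f)"
  proof (rule prod_mono)
    fix f assume f: "f \<in> B"
    have "x f \<le> 1 / 2" using xe[OF f] eps by linarith
    then show "0 \<le> exp (- (x f + 2 * (x f)\<^sup>2)) \<and> exp (- (x f + 2 * (x f)\<^sup>2)) \<le> 1 - x f"
      using one_minus_ge_exp[OF x0[OF f]] by simp
  qed
  also have "\<dots> = (\<Prod>f\<in>B. (cmod (r f *\<^sub>R iexp (b f * (1 - r f)) + (1 - r f) *\<^sub>R iexp (b f * (0 - r f))))\<^sup>2)"
    unfolding norm_bernoulli_char_squared x_def var1_def ..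
  also have "\<dots> = (cmod (\<Prod>f\<in>B. r f *\<^sub>R iexp (b f * (1 - r f)) + (1 - r f) *\<^sub>R iexp (b f * (0 - r f))))\<^sup>2"
    by (simp only: prod_norm[symmetric] prod_power_distrib)
  also have "(\<Prod>f\<in>B. r f *\<^sub>R iexp (b f * (1 - r f)) + (1 - r f) *\<^sub>R iexp (b f * (0 - r f))) =
      Ex (\<lambda>w. \<Prod>f\<in>B. iexp (b f * (of_bool (w f) - r f)))"
    by (subst Ex_prod[OF B, of "\<lambda>f c. iexp (b f * (of_bool c - r f))"]) simp
  also have "(\<lambda>w. \<Prod>f\<in>B. iexp (b f * (of_bool (w f) - r f))) = (\<lambda>w. iexp (\<Sum>f\<in>B. b f * xi f w))"
    using fin by (simp only: xi_def of_real_sum sum_distrib_left exp_sum)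
  finally show ?thesis unfolding sum_x .
qed

end

section \<open>Consequences for a fixed number of vertices\<close>

lemma exp_minus_diff_le:
  assumes "0 \<le> x" "x \<le> (y :: real)"
  shows "\<bar>exp (- x) - exp (- y)\<bar> \<le> y - x"
proof -
  have "exp (- x) * (1 - exp (- (y - x))) \<le> 1 * (1 - exp (- (y - x)))"
    using assms by (intro mult_right_mono) auto
  also have "1 * (1 - exp (- (y - x))) \<le> y - x" using exp_ge_add_one_self[of "- (y - x)"] by argo
  also have "exp (- x) * (1 - exp (- (y - x))) = exp (- x) - exp (- y)"
    by (simp add: right_diff_distrib flip: exp_add)
  finally have "exp (- x) - exp (- y) \<le> y - x" .
  moreover have "exp (- y) \<le> exp (- x)" using assms by simp
  ultimately show ?thesis by simp
qed

context placement
begin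

text \<open>If the single bad edges are negligible too, then the part of the good sets has variance close to 1.\<close>

lemma forward_bound:
  assumes M_upper: "\<And>B. B \<in> nonempty_subs \<Longrightarrow> psi n p B \<le> M"
    and M_lower: "B0 \<in> nonempty_subs" "M \<le> psi n p B0"
    and dense: "\<And>B. B \<in> nonempty_subs \<Longrightarrow> 1 \<le> \<epsilon> * (real n ^ card (\<Union>B) * wP p B)"
    and eps_n: "1 \<le> \<epsilon> * real n"
    and good: "\<And>e. e \<in> E \<Longrightarrow> card e \<in> Gd \<Longrightarrow> 1 \<le> \<epsilon> * (real n ^ card e * (1 - p (card e)))"
    and bad: "\<And>e. e \<in> E \<Longrightarrow> card e \<notin> Gd \<Longrightarrow> 1 - p (card e) \<le> \<epsilon> \<and> 1 / 2 \<le> p (card e)"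
    and negl: "\<And>e. e \<in> E \<Longrightarrow> card e \<notin> Gd \<Longrightarrow> psi n p {e} \<le> 2 * \<epsilon> * M"
  defines "C \<equiv> placement_family.clt_const V E (4 ^ card V)"
  shows "cmod (Ex (\<lambda>w. iexp (t * W w)) - of_real (exp (- (t\<^sup>2 / 2))))
    \<le> t\<^sup>2 * sqrt (C * \<epsilon>) + \<bar>t\<bar> ^ 3 / 2 * (C * sqrt \<epsilon>) + \<bar>t\<bar> * sqrt (rest_const * \<epsilon>)
      + (\<bar>t\<bar> * sqrt (rest_const * \<epsilon>) + t\<^sup>2 * (rest_const * \<epsilon>))"
proof -
  let ?A = "part (single_bad Gd)" and ?G = "part (all_good Gd)" and ?R = "part (mixed Gd)"
  let ?a = "Ex (\<lambda>w. iexp (t * ?A w))" and ?g = "Ex (\<lambda>w. (?G w)\<^sup>2)"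
  have "0 < psi n p B0" using M_lower(1) wP_pos wQ_pos n_pos unfolding psi_def nonempty_subs_def by simp
  then have M0: "0 < M" using M_upper[OF M_lower(1)] by simp
  have e0: "0 < \<epsilon>" using eps_n n_pos by (smt (verit) mult_nonpos_nonneg of_nat_0_le_iff)
  have A: "Ex (\<lambda>w. (?A w)\<^sup>2) \<le> rest_const * \<epsilon>"
  proof -
    have "Ex (\<lambda>w. (?A w)\<^sup>2) \<le> 4 ^ card E * (cvar * (4 ^ card V * (2 * \<epsilon>)))"
    proof (rule Ex_part_squared_le[OF parts_sub(2) M_lower(2,1) M0])
      show "0 \<le> 2 * \<epsilon>" using e0 by simp
      fix F assume F: "F \<in> single_bad Gd"
      then obtain e where e: "F = {e}" by (auto simp: single_bad_def card_1_singleton_iff)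
      then have "e \<in> E" "card e \<notin> Gd" using F by (auto simp: single_bad_def nonempty_subs_def)
      then show "psi n p F \<le> 2 * \<epsilon> * M" unfolding e by (rule negl)
    qed
    then show ?thesis by (simp add: rest_const_def mult_ac)
  qed
  have R: "Ex (\<lambda>w. (?R w)\<^sup>2) \<le> rest_const * \<epsilon>"
    by (rule mixed_small[OF M_upper M_lower dense eps_n good bad])
  have g0: "0 \<le> ?g" by (rule Bochner_Integration.integral_nonneg) simp
  have nonneg: "0 \<le> Ex (\<lambda>w. (?A w)\<^sup>2)" "0 \<le> Ex (\<lambda>w. (?R w)\<^sup>2)" by (rule Bochner_Integration.integral_nonneg; simp)+
  have g1: "1 - 2 * (rest_const * \<epsilon>) \<le> ?g" "?g \<le> 1" using parts_variance[of Gd] A R nonneg by linarith+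
  have a1: "cmod (?a - 1) \<le> \<bar>t\<bar> * sqrt (rest_const * \<epsilon>)"
  proof -
    have "cmod (Ex (\<lambda>w. iexp (t * ?A w)) - Ex (\<lambda>w. iexp 0)) \<le> sqrt (Ex (\<lambda>w. (t * ?A w - 0)\<^sup>2))"
      by (rule Ex_iexp_diff_le)
    also have "\<dots> = \<bar>t\<bar> * sqrt (Ex (\<lambda>w. (?A w)\<^sup>2))" by (simp add: power_mult_distrib real_sqrt_mult)
    also have "\<dots> \<le> \<bar>t\<bar> * sqrt (rest_const * \<epsilon>)" by (intro mult_left_mono real_sqrt_le_mono A) auto
    finally show ?thesis by simp
  qed
  define x where "x = exp (- (?g * t\<^sup>2 / 2))"
  have x01: "0 < x" "x \<le> 1" using g0 by (auto simp: x_def)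
  have xt: "\<bar>x - exp (- (t\<^sup>2 / 2))\<bar> \<le> t\<^sup>2 * (rest_const * \<epsilon>)"
  proof -
    have "\<bar>x - exp (- (t\<^sup>2 / 2))\<bar> \<le> t\<^sup>2 / 2 - ?g * t\<^sup>2 / 2"
      unfolding x_def
    proof (rule exp_minus_diff_le)
      have "?g * t\<^sup>2 \<le> 1 * t\<^sup>2" by (rule mult_right_mono[OF g1(2)]) simp
      then show "?g * t\<^sup>2 / 2 \<le> t\<^sup>2 / 2" by simp
      show "0 \<le> ?g * t\<^sup>2 / 2" using g0 by simp
    qed
    also have "\<dots> = t\<^sup>2 / 2 * (1 - ?g)" by (simp add: algebra_simps)
    also have "\<dots> \<le> t\<^sup>2 / 2 * (2 * (rest_const * \<epsilon>))" using g1 by (intro mult_left_mono) auto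
    finally show ?thesis by simp
  qed
  have "?a * of_real x - of_real (exp (- (t\<^sup>2 / 2))) = (?a - 1) * of_real x + of_real (x - exp (- (t\<^sup>2 / 2)))"
    by (simp add: algebra_simps)
  then have "cmod (?a * of_real x - of_real (exp (- (t\<^sup>2 / 2)))) \<le> cmod ((?a - 1) * of_real x) + cmod (of_real (x - exp (- (t\<^sup>2 / 2))))"
    by (simp only: norm_triangle_ineq)
  also have "\<dots> = cmod (?a - 1) * x + \<bar>x - exp (- (t\<^sup>2 / 2))\<bar>"
    using x01 by (simp only: norm_mult norm_of_real)
  also have "\<dots> \<le> cmod (?a - 1) * 1 + \<bar>x - exp (- (t\<^sup>2 / 2))\<bar>"
    using x01 by (intro add_right_mono mult_left_mono) auto
  also have "\<dots> \<le> \<bar>t\<bar> * sqrt (rest_const * \<epsilon>) + t\<^sup>2 * (rest_const * \<epsilon>)"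
    using a1 xt by simp
  finally have part2: "cmod (?a * of_real x - of_real (exp (- (t\<^sup>2 / 2)))) \<le> \<bar>t\<bar> * sqrt (rest_const * \<epsilon>) + t\<^sup>2 * (rest_const * \<epsilon>)" .
  have part1: "cmod (Ex (\<lambda>w. iexp (t * W w)) - ?a * of_real x)
    \<le> t\<^sup>2 * sqrt (C * \<epsilon>) + \<bar>t\<bar> ^ 3 / 2 * (C * sqrt \<epsilon>) + \<bar>t\<bar> * sqrt (rest_const * \<epsilon>)"
    unfolding x_def C_def by (rule gaussian_approx[OF M_upper M_lower dense eps_n good bad])
  show ?thesis using norm_triangle_le[OF add_mono[OF part1 part2]] by simp
qed

subsection \<open>Edge sizes with few missing edges\<close>

definition bad_edges :: "nat set \<Rightarrow> nat set set" where
  "bad_edges Gd = {f \<in> U. card f \<in> card ` E - Gd}"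

definition bcoef :: "nat set \<Rightarrow> nat set \<Rightarrow> real" where
  "bcoef Gd f = (\<Sum>F\<in>single_bad Gd. coef F * real (card {\<phi>\<in>emb. img \<phi> F = {f}}))"

lemma single_badE:
  assumes "F \<in> single_bad Gd"
  obtains e where "F = {e}" "e \<in> E" "card e \<notin> Gd"
proof -
  obtain e where "F = {e}" using assms by (auto simp: single_bad_def card_1_singleton_iff)
  then show ?thesis using assms that by (auto simp: single_bad_def nonempty_subs_def)
qed

lemma card_emb_image: "\<phi> \<in> emb \<Longrightarrow> e \<in> E \<Longrightarrow> card (\<phi> ` e) = card e"
  using E_sub by (intro card_image inj_on_subset[OF emb_inj]) auto

lemma single_bad_linear: "part (single_bad Gd) w = (\<Sum>f\<in>bad_edges Gd. bcoef Gd f * xi f w)"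
proof -
  have finB: "finite (bad_edges Gd)" unfolding bad_edges_def using finite_U by simp
  have finS: "finite (single_bad Gd)" using parts_sub(2) finite_subs(1) by (rule finite_subset)
  have "part (single_bad Gd) w = (\<Sum>F\<in>single_bad Gd. \<Sum>f\<in>bad_edges Gd. coef F * real (card {\<phi>\<in>emb. img \<phi> F = {f}}) * xi f w)"
    unfolding part_def
  proof (rule sum.cong[OF refl])
    fix F assume "F \<in> single_bad Gd"
    then obtain e where e: "F = {e}" "e \<in> E" "card e \<notin> Gd" by (rule single_badE)
    have img: "img \<phi> F = {\<phi> ` e}" for \<phi> :: "'a \<Rightarrow> nat" by (simp add: e(1) img_def)
    have mem: "\<phi> ` e \<in> bad_edges Gd" if "\<phi> \<in> emb" for \<phi>
    proof -
      have "F \<subseteq> E" using e by simp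
      then have "\<phi> ` e \<in> U" using img_sub[OF that, of F] unfolding img by simp
      then show ?thesis using card_emb_image[OF that e(2)] e by (simp add: bad_edges_def)
    qed
    have "walsh_sum F w = (\<Sum>\<phi>\<in>emb. xi (\<phi> ` e) w)"
      unfolding walsh_sum_def img by (simp add: walsh_def)
    also have "\<dots> = (\<Sum>f\<in>bad_edges Gd. \<Sum>\<phi>\<in>{\<phi>\<in>emb. \<phi> ` e = f}. xi (\<phi> ` e) w)"
      by (rule sum.group[symmetric, OF finite_emb finB]) (use mem in auto)
    also have "\<dots> = (\<Sum>f\<in>bad_edges Gd. real (card {\<phi>\<in>emb. img \<phi> F = {f}}) * xi f w)"
      unfolding img by (intro sum.cong refl) simp
    finally show "coef F * walsh_sum F w = (\<Sum>f\<in>bad_edges Gd. coef F * real (card {\<phi>\<in>emb. img \<phi> F = {f}}) * xi f w)"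
      by (simp add: sum_distrib_left mult.assoc)
  qed
  also have "\<dots> = (\<Sum>f\<in>bad_edges Gd. bcoef Gd f * xi f w)"
    unfolding bcoef_def sum_distrib_right by (rule sum.swap)
  finally show ?thesis .
qed

text \<open>Fix a bijection from \<open>e\<close> to \<open>f\<close>; every injection of \<open>V - e\<close> into the complement of \<open>f\<close> extends it to a
  placement.\<close>

lemma count_through_ge:
  assumes e: "e \<in> E" and f: "f \<in> U" "card f = card e"
  shows "(real n / 2) ^ (card V - card e) \<le> real (card {\<phi>\<in>emb. \<phi> ` e = f})"
proof -
  have eV: "e \<subseteq> V" and fn: "f \<subseteq> {1..n}" using e f E_sub by (auto simp: U_def)
  have fin: "finite e" "finite f" using finite_subset[OF eV finite_V] finite_subset[OF fn] by auto
  obtain \<beta> where \<beta>: "bij_betw \<beta> e f" using finite_same_card_bij[OF fin f(2)[symmetric]] by auto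
  let ?A = "{\<psi> \<in> (V - e) \<rightarrow>\<^sub>E ({1..n} - f). inj_on \<psi> (V - e)}"
  define ext where "ext \<psi> = (\<lambda>x. if x \<in> e then \<beta> x else \<psi> x)" for \<psi> :: "'a \<Rightarrow> nat"
  have "card ?A \<le> card {\<phi>\<in>emb. \<phi> ` e = f}"
  proof (rule card_inj_on_le)
    show "inj_on ext ?A"
    proof (rule inj_onI)
      fix \<psi> \<psi>' assume a: "\<psi> \<in> ?A" "\<psi>' \<in> ?A" and eq: "ext \<psi> = ext \<psi>'"
      show "\<psi> = \<psi>'"
      proof
        fix x show "\<psi> x = \<psi>' x"
        proof (cases "x \<in> e")
          case True
          then have "\<psi> x = undefined" "\<psi>' x = undefined" using a by (auto intro: PiE_arb)
          then show ?thesis by simp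
        next
          case False
          then show ?thesis using fun_cong[OF eq, of x] by (simp add: ext_def)
        qed
      qed
    qed
    show "ext ` ?A \<subseteq> {\<phi>\<in>emb. \<phi> ` e = f}"
    proof
      fix \<phi> assume "\<phi> \<in> ext ` ?A"
      then obtain \<psi> where \<psi>: "\<psi> \<in> (V - e) \<rightarrow>\<^sub>E ({1..n} - f)" "inj_on \<psi> (V - e)" and \<phi>: "\<phi> = ext \<psi>" by auto
      have im: "\<phi> ` e = f" using \<beta> by (auto simp: \<phi> ext_def bij_betw_def)
      have V: "V = e \<union> (V - e)" using eV by auto
      have o: "\<psi> x \<in> {1..n} - f" if "x \<in> V - e" for x using PiE_mem[OF \<psi>(1) that] .
      have "inj_on \<phi> (e \<union> (V - e))"
      proof (rule inj_on_Un[THEN iffD2], intro conjI)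
        show "inj_on \<phi> e" using \<beta> by (auto simp: \<phi> ext_def bij_betw_def inj_on_def)
        show "inj_on \<phi> (V - e)" using \<psi>(2) by (auto simp: \<phi> ext_def inj_on_def)
        have "\<phi> ` (V - e) \<subseteq> {1..n} - f" using o by (auto simp: \<phi> ext_def)
        moreover have "e - (V - e) = e" "V - e - e = V - e" by auto
        ultimately show "\<phi> ` (e - (V - e)) \<inter> \<phi> ` (V - e - e) = {}" using im by auto
      qed
      then have inj: "inj_on \<phi> V" using V by simp
      have "\<phi> \<in> V \<rightarrow>\<^sub>E {1..n}"
      proof (rule PiE_I)
        fix x assume "x \<in> V"
        then show "\<phi> x \<in> {1..n}"
          using o[of x] \<beta> fn by (cases "x \<in> e") (auto simp: \<phi> ext_def bij_betw_def)
      next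
        fix x assume "x \<notin> V"
        then show "\<phi> x = undefined" using eV PiE_arb[OF \<psi>(1), of x] by (auto simp: \<phi> ext_def)
      qed
      then show "\<phi> \<in> {\<phi>\<in>emb. \<phi> ` e = f}" using inj im by (simp add: emb_def)
    qed
    show "finite {\<phi>\<in>emb. \<phi> ` e = f}" using finite_emb by simp
  qed
  moreover have "card ?A = prod ((-) (n - card e)) {0..<card V - card e}"
  proof -
    have "card ({1..n} - f) = n - card e" using fn fin f(2) by (simp add: card_Diff_subset)
    moreover have "card (V - e) = card V - card e" using eV fin by (simp add: card_Diff_subset)
    ultimately show ?thesis
      using card_inj_on_subset_funcset[of "V - e" "{1..n} - f" "V - e"] finite_V by simp
  qed
  ultimately have "real (prod ((-) (n - card e)) {0..<card V - card e}) \<le> real (card {\<phi>\<in>emb. \<phi> ` e = f})"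
    by (simp only: of_nat_le_iff)
  moreover have "(\<Prod>i\<in>{0..<card V - card e}. real n / 2) \<le> (\<Prod>i\<in>{0..<card V - card e}. real (n - card e - i))"
  proof (rule prod_mono)
    fix i assume i: "i \<in> {0..<card V - card e}"
    have "card e \<le> card V" using eV finite_V by (rule card_mono[rotated])
    then show "0 \<le> real n / 2 \<and> real n / 2 \<le> real (n - card e - i)" using n_large i by (simp add: field_simps)
  qed
  ultimately show ?thesis by simp
qed

lemma bcoef_ge:
  assumes e: "e \<in> E" "card e \<notin> Gd" and f: "f \<in> U" "card f = card e"
  shows "coef {e} * (real n / 2) ^ (card V - card e) \<le> bcoef Gd f"
proof -
  have e_bad: "{e} \<in> single_bad Gd" using e by (simp add: single_bad_def nonempty_subs_def)
  have "{\<phi>\<in>emb. img \<phi> {e} = {f}} = {\<phi>\<in>emb. \<phi> ` e = f}" by (auto simp: img_def)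
  then have "coef {e} * (real n / 2) ^ (card V - card e) \<le> coef {e} * real (card {\<phi>\<in>emb. img \<phi> {e} = {f}})"
    using count_through_ge[OF e(1) f] coef_nonneg by (simp add: mult_left_mono)
  also have "\<dots> \<le> bcoef Gd f"
    unfolding bcoef_def
    by (rule member_le_sum[OF e_bad])
      (use coef_nonneg finite_subset[OF parts_sub(2) finite_subs(1)] in auto)
  finally show ?thesis .
qed

lemma cvar_pos: "0 < cvar"
proof -
  have "pair_count V E > 0" using card_V_pos by (simp add: pair_count_def)
  then show ?thesis by (simp add: cvar_def)
qed

lemma coef_single_squared_ge:
  assumes e: "e \<in> E" and M: "\<And>B. B \<in> nonempty_subs \<Longrightarrow> psi n p B \<le> M"
  shows "1 \<le> (coef {e})\<^sup>2 * (4 ^ card E * cvar * M * real n ^ (2 * card V))"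
proof -
  have M0: "0 \<le> M"
  proof -
    have "0 < psi n p E" using wP_pos[of E] wQ_pos[of E] n_pos by (simp add: psi_def)
    then show ?thesis using M[of E] E_ne by (simp add: nonempty_subs_def)
  qed
  let ?c = "4 ^ card E * cvar * M * real n ^ (2 * card V)"
  have c0: "0 \<le> ?c" using M0 cvar_pos by simp
  have "varX \<le> (wP p E)\<^sup>2 * ?c" using varX_le[OF M] by (simp add: mult_ac)
  then have "1 \<le> (wP p E)\<^sup>2 / varX * ?c" using varX_pos by (simp add: field_simps)
  also have "\<dots> = (coef {e})\<^sup>2 * (wP p {e})\<^sup>2 * ?c" using coef_squared[of "{e}"] e by simp
  also have "\<dots> \<le> (coef {e})\<^sup>2 * 1 * ?c"
    using E_p[OF e] c0 by (intro mult_right_mono mult_left_mono) (auto simp: wP_def power_le_one)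
  finally show ?thesis by simp
qed

text \<open>The gain over a Gaussian characteristic function, for edges of size \<open>k\<close>, when the expected
  number of missing edges of that size is at most \<open>L\<close> and their contribution to the variance is
  not negligible.\<close>

definition defect_gain :: "real \<Rightarrow> nat \<Rightarrow> real" where
  "defect_gain L k = (let \<gamma> = 1 / (4 ^ card V * (4 ^ card E * cvar) * L) in
     min (\<gamma> / L / 24) (11 / 15) * \<gamma> / (2 * real k ^ k))"

lemma defect_gain_pos: "0 < L \<Longrightarrow> 1 \<le> k \<Longrightarrow> 0 < defect_gain L k"
  using cvar_pos by (simp add: defect_gain_def Let_def)

text \<open>By \<open>bcoef_ge\<close> and \<open>varX_le\<close>, the coefficient \<open>b\<close> of every \<open>xi f\<close> with \<open>card f = card e\<close> satisfies
  \<open>b\<^sup>2 \<ge> c * n ^ (- 2 * card e) / M\<close>. By \<open>share\<close> this makes \<open>n ^ card e * (1 - p (card e)) * b\<^sup>2\<close> bounded below, which is of the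
  order of the variance carried by these edges; by \<open>few\<close>, \<open>b\<^sup>2\<close> itself is bounded below, so that \<open>cos_defect b\<close> is at
  least a fixed multiple of \<open>b\<^sup>2\<close>.\<close>

lemma bad_char_ge:
  assumes M: "\<And>B. B \<in> nonempty_subs \<Longrightarrow> psi n p B \<le> M"
    and bad: "\<And>e. e \<in> E \<Longrightarrow> card e \<notin> Gd \<Longrightarrow> 1 - p (card e) \<le> \<epsilon> \<and> 1 / 2 \<le> p (card e)"
    and eps: "0 \<le> \<epsilon>" "\<epsilon> \<le> 1 / 8"
    and e: "e \<in> E" "card e \<notin> Gd" and L: "0 < L"
    and few: "real n ^ card e * (1 - p (card e)) \<le> L"
    and share: "M * real n ^ card e \<le> L * (1 - p (card e))"
  shows "exp (- (Ex (\<lambda>w. (part (single_bad Gd) w)\<^sup>2) - defect_gain L (card e) + 8 * \<epsilon>))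
    \<le> (cmod (Ex (\<lambda>w. iexp (part (single_bad Gd) w))))\<^sup>2"
proof -
  let ?B = "bad_edges Gd" and ?k = "card e"
  define \<gamma> where "\<gamma> = 1 / (4 ^ card V * (4 ^ card E * cvar) * L)"
  define \<eta> where "\<eta> = min (\<gamma> / L / 24) (11 / 15)"
  define q where "q = 1 - p ?k"
  define N where "N = real n"
  have N1: "1 \<le> N" using n_pos by (simp add: N_def)
  have eV: "e \<subseteq> V" "e \<noteq> {}" using e E_sub by auto
  have kV: "?k \<le> card V" using eV finite_V by (intro card_mono)
  have k1: "1 \<le> ?k" using eV finite_subset[OF eV(1) finite_V] by (simp add: Suc_le_eq card_gt_0_iff)
  have \<gamma>0: "0 < \<gamma>" using L cvar_pos by (simp add: \<gamma>_def)
  have \<eta>0: "0 < \<eta>" using \<gamma>0 L by (simp add: \<eta>_def)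
  have pk: "1 / 2 \<le> p ?k" "0 < q" using bad[OF e] E_p[OF e(1)] by (auto simp: q_def)
  have BU: "?B \<subseteq> U" by (auto simp: bad_edges_def)
  have var: "Ex (\<lambda>w. (part (single_bad Gd) w)\<^sup>2) = (\<Sum>f\<in>?B. var1 f * (bcoef Gd f)\<^sup>2)"
    unfolding single_bad_linear by (rule Ex_linear_squared[OF BU])
  have var1: "(\<Sum>f\<in>?B. var1 f * (bcoef Gd f)\<^sup>2) \<le> 1"
  proof -
    have "0 \<le> Ex (\<lambda>w. (part (all_good Gd) w)\<^sup>2)" "0 \<le> Ex (\<lambda>w. (part (mixed Gd) w)\<^sup>2)"
      by (rule Bochner_Integration.integral_nonneg; simp)+
    then show ?thesis using parts_variance[of Gd] unfolding var by linarith
  qed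
  have b_sq: "\<gamma> \<le> N ^ ?k * q * (bcoef Gd f)\<^sup>2" if f: "f \<in> U" "card f = ?k" for f
  proof -
    let ?c = "coef {e} * (N / 2) ^ (card V - ?k)"
    have "?c\<^sup>2 \<le> (bcoef Gd f)\<^sup>2"
      using bcoef_ge[OF e f] coef_nonneg[of "{e}"] N1 unfolding N_def[symmetric] by (intro power_mono) auto
    have c_sq: "?c\<^sup>2 * (4 ^ (card V - ?k) * N ^ (2 * ?k)) = (coef {e})\<^sup>2 * N ^ (2 * card V)"
    proof -
      have half: "((N / 2) ^ j)\<^sup>2 = N ^ (2 * j) / 4 ^ j" for j
      proof -
        have "((N / 2) ^ j)\<^sup>2 = ((N / 2)\<^sup>2) ^ j" by (simp only: power_mult[symmetric] mult.commute)
        also have "(N / 2)\<^sup>2 = N\<^sup>2 / 4" by (simp add: power_divide)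
        also have "(N\<^sup>2 / 4) ^ j = N ^ (2 * j) / 4 ^ j" by (simp only: power_divide power_mult)
        finally show ?thesis .
      qed
      have "2 * (card V - ?k) + 2 * ?k = 2 * card V" using kV by simp
      then have pw: "N ^ (2 * (card V - ?k)) * N ^ (2 * ?k) = N ^ (2 * card V)"
        by (simp only: power_add[symmetric])
      have "x / y * (y * z) = x * z" if "y \<noteq> 0" for x y z :: real using that by simp
      from this[of "4 ^ (card V - ?k)"] show ?thesis
        unfolding power_mult_distrib half mult.assoc by (simp add: pw)
    qed
    have "1 \<le> (coef {e})\<^sup>2 * (4 ^ card E * cvar * M * N ^ (2 * card V))"
      unfolding N_def by (rule coef_single_squared_ge[OF e(1) M])
    also have "\<dots> = ((coef {e})\<^sup>2 * N ^ (2 * card V)) * (4 ^ card E * cvar * M)" by (simp add: mult_ac)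
    also have "\<dots> = ?c\<^sup>2 * 4 ^ (card V - ?k) * N ^ ?k * (4 ^ card E * cvar) * (M * N ^ ?k)"
    proof -
      have "N ^ (2 * ?k) = N ^ ?k * N ^ ?k" by (simp only: mult_2 power_add)
      then show ?thesis unfolding c_sq[symmetric] by (simp only: mult_ac)
    qed
    also have "\<dots> \<le> ?c\<^sup>2 * 4 ^ (card V - ?k) * N ^ ?k * (4 ^ card E * cvar) * (L * q)"
      using share cvar_pos N1 unfolding q_def N_def by (intro mult_left_mono) auto
    also have "\<dots> \<le> (bcoef Gd f)\<^sup>2 * 4 ^ card V * N ^ ?k * (4 ^ card E * cvar) * (L * q)"
      using \<open>?c\<^sup>2 \<le> (bcoef Gd f)\<^sup>2\<close> cvar_pos N1 L pk by (intro mult_right_mono mult_mono power_increasing) auto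
    also have "\<dots> = (N ^ ?k * q * (bcoef Gd f)\<^sup>2) * (4 ^ card V * (4 ^ card E * cvar) * L)"
      by (simp add: mult_ac)
    finally show ?thesis unfolding \<gamma>_def using cvar_pos L by (simp add: field_simps)
  qed
  have each: "\<eta> * \<gamma> / (2 * N ^ ?k) \<le> var1 f * cos_defect (bcoef Gd f)" if f: "f \<in> U" "card f = ?k" for f
  proof -
    note b = b_sq[OF f]
    have "\<gamma> \<le> L * (bcoef Gd f)\<^sup>2"
      using b few unfolding N_def q_def by (meson mult_right_mono order_trans zero_le_power2)
    then have "\<gamma> / L \<le> (bcoef Gd f)\<^sup>2" using L by (simp add: field_simps)
    then have d: "\<eta> * (bcoef Gd f)\<^sup>2 \<le> cos_defect (bcoef Gd f)"
      unfolding \<eta>_def by (rule cos_defect_ge_square) (use \<gamma>0 L in simp)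
    have v: "q / 2 \<le> var1 f"
    proof -
      have "1 / 2 * q \<le> p ?k * q" using pk by (intro mult_right_mono) auto
      then show ?thesis by (simp add: var1_def f q_def)
    qed
    have "\<eta> * \<gamma> / (2 * N ^ ?k) \<le> \<eta> * (N ^ ?k * q * (bcoef Gd f)\<^sup>2) / (2 * N ^ ?k)"
      using b \<eta>0 N1 by (intro divide_right_mono mult_left_mono) auto
    also have "\<dots> = q / 2 * (\<eta> * (bcoef Gd f)\<^sup>2)" using N1 by simp
    also have "\<dots> \<le> var1 f * cos_defect (bcoef Gd f)"
      using v d \<eta>0 pk by (intro mult_mono) auto
    finally show ?thesis .
  qed
  let ?K = "{f \<in> Pow {1..n}. card f = ?k}"
  have KU: "f \<in> U \<and> card f = ?k" if "f \<in> ?K" for f using that k1 by (auto simp: U_def)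
  have "(N / real ?k) ^ ?k \<le> real (card ?K)"
  proof -
    have "card ?K = n choose ?k" using n_subsets[of "{1..n}" ?k] by simp
    moreover have "(of_nat n / of_nat ?k :: real) ^ ?k \<le> of_nat (n choose ?k)"
      by (rule binomial_ge_n_over_k_pow_k) (use kV n_large in simp)
    ultimately show ?thesis by (simp add: N_def)
  qed
  then have "(N / real ?k) ^ ?k * (\<eta> * \<gamma> / (2 * N ^ ?k)) \<le> real (card ?K) * (\<eta> * \<gamma> / (2 * N ^ ?k))"
    using \<eta>0 \<gamma>0 N1 by (intro mult_right_mono) auto
  also have "\<dots> = (\<Sum>f\<in>?K. \<eta> * \<gamma> / (2 * N ^ ?k))" by simp
  also have "\<dots> \<le> (\<Sum>f\<in>?K. var1 f * cos_defect (bcoef Gd f))"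
  proof (rule sum_mono)
    fix f assume "f \<in> ?K"
    then have "f \<in> U" "card f = ?k" using KU[of f] by simp_all
    then show "\<eta> * \<gamma> / (2 * N ^ ?k) \<le> var1 f * cos_defect (bcoef Gd f)" by (rule each)
  qed
  also have "\<dots> \<le> (\<Sum>f\<in>?B. var1 f * cos_defect (bcoef Gd f))"
  proof (rule sum_mono2)
    show "finite ?B" using BU finite_U by (rule finite_subset)
    show "?K \<subseteq> ?B"
    proof
      fix f assume "f \<in> ?K"
      then have "f \<in> U" "card f = ?k" using KU[of f] by simp_all
      then show "f \<in> ?B" using e by (simp add: bad_edges_def)
    qed
    show "0 \<le> var1 f * cos_defect (bcoef Gd f)" if "f \<in> ?B - ?K" for f
    proof (rule mult_nonneg_nonneg[OF var1_nonneg cos_defect_nonneg])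
      show "f \<in> U" using that BU by blast
    qed
  qed
  finally have gain: "defect_gain L ?k \<le> (\<Sum>f\<in>?B. var1 f * cos_defect (bcoef Gd f))"
    using N1 unfolding defect_gain_def Let_def \<gamma>_def[symmetric] \<eta>_def[symmetric] by (simp add: power_divide)
  have "exp (- ((\<Sum>f\<in>?B. var1 f * (bcoef Gd f)\<^sup>2) - (\<Sum>f\<in>?B. var1 f * cos_defect (bcoef Gd f)) + 8 * \<epsilon>))
    \<le> (cmod (Ex (\<lambda>w. iexp (\<Sum>f\<in>?B. bcoef Gd f * xi f w))))\<^sup>2"
  proof (rule norm_Ex_iexp_linear_ge[OF BU _ eps var1])
    fix f assume "f \<in> ?B"
    then obtain e' where "e' \<in> E" "card e' \<notin> Gd" "card f = card e'" by (auto simp: bad_edges_def)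
    then show "1 - p (card f) \<le> \<epsilon>" using bad by simp
  qed
  then have "exp (- ((\<Sum>f\<in>?B. var1 f * (bcoef Gd f)\<^sup>2) - (\<Sum>f\<in>?B. var1 f * cos_defect (bcoef Gd f)) + 8 * \<epsilon>))
    \<le> (cmod (Ex (\<lambda>w. iexp (part (single_bad Gd) w))))\<^sup>2"
    unfolding single_bad_linear .
  moreover have "exp (- (Ex (\<lambda>w. (part (single_bad Gd) w)\<^sup>2) - defect_gain L ?k + 8 * \<epsilon>))
    \<le> exp (- ((\<Sum>f\<in>?B. var1 f * (bcoef Gd f)\<^sup>2) - (\<Sum>f\<in>?B. var1 f * cos_defect (bcoef Gd f)) + 8 * \<epsilon>))"
    unfolding var using gain by simp
  ultimately show ?thesis by (rule order_trans[rotated])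
qed

subsection \<open>Consequences of an unbounded lower tail\<close>

text \<open>Since \<open>X\<close> is nonnegative, \<open>W\<close> is bounded below by minus the ratio of the mean to the standard deviation,
  which is at most a constant times \<open>1 / sqrt M\<close>.\<close>

lemma M_small_of_lower_tail:
  assumes "0 < L" and w: "W w \<le> - L" and M: "B0 \<in> nonempty_subs" "M \<le> psi n p B0"
  shows "L\<^sup>2 * M \<le> 4 ^ card V"
proof -
  have "0 \<le> X w" unfolding X_eq_card by simp
  then have "- Ex X / sqrt varX \<le> W w" unfolding W_def using varX_pos by (intro divide_right_mono) auto
  then have "L \<le> Ex X / sqrt varX" using w by simp
  then have "L\<^sup>2 \<le> (Ex X / sqrt varX)\<^sup>2" using assms(1) by (intro power_mono) auto
  also have "\<dots> = (Ex X)\<^sup>2 / varX" using varX_pos by (simp add: power_divide)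
  finally have "L\<^sup>2 * varX \<le> (Ex X)\<^sup>2" using varX_pos by (simp add: field_simps)
  moreover have "Ex X \<le> wP p E * real n ^ card V"
    unfolding Ex_X using card_emb_le wP_pos[of E] by (intro mult_left_mono) (auto simp flip: of_nat_power)
  moreover have "0 \<le> Ex X" unfolding Ex_X using wP_pos[of E] by simp
  ultimately have "L\<^sup>2 * varX \<le> (wP p E * real n ^ card V)\<^sup>2"
    by (meson order_trans power_mono)
  then have 1: "L\<^sup>2 * varX \<le> (wP p E)\<^sup>2 * real n ^ (2 * card V)"
    by (simp add: power_mult_distrib power_mult[symmetric] mult.commute)
  let ?c = "(wP p E)\<^sup>2 * real n ^ (2 * card V)"
  have c0: "0 < ?c" using wP_pos[of E] n_pos by simp
  have "?c * M \<le> ?c * psi n p B0" by (intro mult_left_mono M) (use c0 in simp)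
  also have "\<dots> \<le> 4 ^ card V * varX" using varX_ge[OF M(1)] by (simp add: mult_ac)
  finally have "L\<^sup>2 * (?c * M) \<le> L\<^sup>2 * (4 ^ card V * varX)" by (intro mult_left_mono) auto
  also have "\<dots> \<le> 4 ^ card V * ?c" using mult_left_mono[OF 1, of "4 ^ card V"] by (simp add: mult_ac)
  finally have "(L\<^sup>2 * M) * ?c \<le> 4 ^ card V * ?c" by (simp add: mult_ac)
  then show ?thesis using c0 by (rule mult_right_le_imp_le)
qed

text \<open>Edges with probability at least one half change \<open>wP\<close> by a bounded factor only. The set \<open>B0\<close> of the
  others has \<open>wQ\<close> bounded below, so that a small \<open>psi\<close> forces many expected copies of it. If there are no others, the
  expected number is at least of order \<open>n\<close>.\<close>

lemma dense_of_M_small: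
  assumes B: "B \<in> nonempty_subs" and M: "\<And>B. B \<in> nonempty_subs \<Longrightarrow> psi n p B \<le> M"
  shows "1 \<le> 4 ^ card E * M * (real n ^ card (\<Union>B) * wP p B) \<or> real n \<le> 2 ^ card E * (real n ^ card (\<Union>B) * wP p B)"
proof -
  define B0 where "B0 = {e\<in>B. p (card e) < 1 / 2}"
  have BE: "B \<subseteq> E" "B \<noteq> {}" "finite B" using subsD[OF B] finite_subs(2)[OF B] by auto
  have N1: "1 \<le> real n" using n_pos by simp
  have s: "B0 \<subseteq> B" "B0 \<subseteq> E" "B - B0 \<subseteq> E" "finite B0" using BE by (auto simp: B0_def)
  have fV: "finite (\<Union>B)" "\<Union>B \<subseteq> V"
  proof -
    show "\<Union>B \<subseteq> V" using BE E_sub by auto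
    then show "finite (\<Union>B)" by (rule finite_subset[OF _ finite_V])
  qed
  have cE: "card B0 \<le> card E" "card (B - B0) \<le> card E"
    using s finite_E by (auto intro: card_mono)
  have split: "wP p B = wP p (B - B0) * wP p B0"
    unfolding wP_def by (rule prod.subset_diff[OF s(1) BE(3)])
  have big: "1 \<le> 2 ^ card E * wP p (B - B0)"
  proof -
    have "(\<Prod>e\<in>B - B0. 1) \<le> (\<Prod>e\<in>B - B0. 2 * p (card e))"
      by (rule prod_mono) (auto simp: B0_def)
    then have "1 \<le> 2 ^ card (B - B0) * wP p (B - B0)"
      by (simp only: wP_def prod.distrib prod_constant power_one)
    also have "\<dots> \<le> 2 ^ card E * wP p (B - B0)"
      using wP_pos[OF s(3)] cE by (intro mult_right_mono power_increasing) auto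
    finally show ?thesis .
  qed
  show ?thesis
  proof (cases "B0 = {}")
    case True
    then have "wP p (B - B0) = wP p B" by simp
    obtain e where e: "e \<in> B" using BE by auto
    then have "e \<noteq> {}" "e \<subseteq> \<Union>B" using BE E_sub by auto
    then have "card (\<Union>B) \<noteq> 0" using fV by auto
    then have "real n ^ 1 \<le> real n ^ card (\<Union>B)" using N1 by (intro power_increasing) auto
    then have "real n * 1 \<le> real n ^ card (\<Union>B) * (2 ^ card E * wP p (B - B0))"
      using big N1 by (intro mult_mono) auto
    then show ?thesis using True by (simp add: mult_ac)
  next
    case False
    then have B0: "B0 \<in> nonempty_subs" using s by (simp add: nonempty_subs_def)
    have q: "1 \<le> 2 ^ card E * wQ p B0"
    proof -
      have "(\<Prod>e\<in>B0. 1) \<le> (\<Prod>e\<in>B0. 2 * (1 - p (card e)))"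
        by (rule prod_mono) (auto simp: B0_def)
      then have "1 \<le> 2 ^ card B0 * wQ p B0"
        by (simp only: wQ_def prod.distrib prod_constant power_one)
      also have "\<dots> \<le> 2 ^ card E * wQ p B0"
        using wQ_pos[OF s(2)] cE by (intro mult_right_mono power_increasing) auto
      finally show ?thesis .
    qed
    have psi0: "0 < psi n p B0" using wP_pos[OF s(2)] wQ_pos[OF s(2)] N1 by (simp add: psi_def)
    have M0: "0 < M" using psi0 M[OF B0] by simp
    have "wQ p B0 = psi n p B0 * (wP p B0 * real n ^ card (\<Union>B0))"
      using wP_pos[OF s(2)] N1 by (simp add: psi_def)
    also have "\<dots> \<le> M * (wP p B0 * real n ^ card (\<Union>B))"
    proof (intro mult_mono M B0 mult_left_mono power_increasing card_mono fV(1))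
      show "\<Union>B0 \<subseteq> \<Union>B" using s(1) by (rule Union_mono)
    qed (use wP_pos[OF s(2)] N1 M0 in auto)
    finally have "2 ^ card E * wQ p B0 \<le> 2 ^ card E * (M * (wP p B0 * real n ^ card (\<Union>B)))"
      by (intro mult_left_mono) auto
    with q have "1 \<le> 2 ^ card E * (M * (wP p B0 * real n ^ card (\<Union>B)))" by (rule order_trans)
    then have "1 * 1 \<le> (2 ^ card E * (M * (wP p B0 * real n ^ card (\<Union>B)))) * (2 ^ card E * wP p (B - B0))"
      using big M0 wP_pos[OF s(2)] by (intro mult_mono) auto
    also have "\<dots> = (2 ^ card E * 2 ^ card E) * M * (real n ^ card (\<Union>B) * wP p B)"
      unfolding split by (simp add: mult_ac)
    also have "(2::real) ^ card E * 2 ^ card E = 4 ^ card E" by (simp flip: power_mult_distrib)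
    finally show ?thesis by simp
  qed
qed

end

section \<open>The two conditions in terms of edge sets\<close>

definition max_psi :: "nat \<Rightarrow> (nat \<Rightarrow> real) \<Rightarrow> 'a hypergraph \<Rightarrow> real" where
  "max_psi n p H = (MAX F\<in>nonempty_subhypergraphs H.
     real n powi (- int (card (verts F))) * Q_weight p F / P_weight p F)"

definition min_copies :: "nat \<Rightarrow> (nat \<Rightarrow> real) \<Rightarrow> 'a hypergraph \<Rightarrow> real" where
  "min_copies n p H = (MIN F\<in>nonempty_subhypergraphs H. P_weight p F * real n ^ card (verts F))"

definition edge_cond :: "nat \<Rightarrow> (nat \<Rightarrow> real) \<Rightarrow> 'a hypergraph \<Rightarrow> nat \<Rightarrow> real" where
  "edge_cond n p H k = real n ^ k * (1 - p k) + max_psi n p H / (real n powi (- int k) * (1 - p k))"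

definition copies_error :: "nat \<Rightarrow> (nat \<Rightarrow> real) \<Rightarrow> 'a set set \<Rightarrow> real" where
  "copies_error n p E = 1 / sqrt (real n) + (\<Sum>B\<in>Pow E - {{}}. 1 / (real n ^ card (\<Union>B) * wP p B))"

definition approx_error :: "'a set \<Rightarrow> 'a set set \<Rightarrow> real \<Rightarrow> real \<Rightarrow> real" where
  "approx_error V E t \<epsilon> = t\<^sup>2 * sqrt (placement_family.clt_const V E (4 ^ card V) * \<epsilon>)
     + \<bar>t\<bar> ^ 3 / 2 * (placement_family.clt_const V E (4 ^ card V) * sqrt \<epsilon>)
     + \<bar>t\<bar> * sqrt (placement.rest_const V E * \<epsilon>)"

context placement
begin

abbreviation "HVE \<equiv> Hypergraph V E"

lemma finite_subhypergraphs: "finite (nonempty_subhypergraphs HVE)"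
proof (rule finite_subset)
  show "nonempty_subhypergraphs HVE \<subseteq> (\<lambda>(A, B). Hypergraph A B) ` (Pow V \<times> Pow E)"
  proof
    fix F assume "F \<in> nonempty_subhypergraphs HVE"
    then show "F \<in> (\<lambda>(A, B). Hypergraph A B) ` (Pow V \<times> Pow E)"
      by (cases F) (auto simp: nonempty_subhypergraphs_def subhypergraph_def)
  qed
  show "finite ((\<lambda>(A, B). Hypergraph A B) ` (Pow V \<times> Pow E))" using finite_V finite_E by simp
qed

lemma spanned_subhypergraph:
  assumes "B \<in> nonempty_subs"
  shows "Hypergraph (\<Union>B) B \<in> nonempty_subhypergraphs HVE"
proof -
  have B: "B \<subseteq> E" "B \<noteq> {}" "finite B" using subsD[OF assms] finite_subs(2)[OF assms] by auto
  have UV: "\<Union>B \<subseteq> V" using B(1) E_sub by auto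
  then have "finite (\<Union>B)" by (rule finite_subset[OF _ finite_V])
  moreover have "B \<subseteq> Pow (\<Union>B) - {{}}" using B(1) E_sub by auto
  ultimately have "wf_hypergraph (Hypergraph (\<Union>B) B)" by (simp add: wf_hypergraph_def)
  moreover have "card B \<ge> 1" using B by (simp add: Suc_le_eq card_gt_0_iff)
  ultimately show ?thesis
    using wf_H B(1) UV by (simp add: nonempty_subhypergraphs_def subhypergraph_def)
qed

lemma subhypergraph_edges:
  assumes "F \<in> nonempty_subhypergraphs HVE"
  shows "edges F \<in> nonempty_subs" "card (\<Union>(edges F)) \<le> card (verts F)"
proof -
  have F: "wf_hypergraph F" "edges F \<subseteq> E" "card (edges F) \<ge> 1"
    using assms by (auto simp: nonempty_subhypergraphs_def subhypergraph_def)
  then have "edges F \<noteq> {}" by auto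
  then show "edges F \<in> nonempty_subs" using F by (simp add: nonempty_subs_def)
  show "card (\<Union>(edges F)) \<le> card (verts F)"
    using F(1) by (intro card_mono) (auto simp: wf_hypergraph_def)
qed

lemma ratio_eq: "real n powi (- int a) * Q / P = Q / (P * real n ^ a)"
  by (simp add: power_int_minus field_simps)

lemma psi_le_max_psi:
  assumes "B \<in> nonempty_subs"
  shows "psi n p B \<le> max_psi n p HVE"
proof -
  have "psi n p B = real n powi (- int (card (verts (Hypergraph (\<Union>B) B)))) * Q_weight p (Hypergraph (\<Union>B) B) / P_weight p (Hypergraph (\<Union>B) B)"
    unfolding ratio_eq by (simp add: psi_def wP_def wQ_def P_weight_def Q_weight_def)
  also have "\<dots> \<le> max_psi n p HVE"
    unfolding max_psi_def
    by (rule Max_ge[OF finite_imageI[OF finite_subhypergraphs] imageI[OF spanned_subhypergraph[OF assms]]])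
  finally show ?thesis .
qed

lemma E_in_subs: "E \<in> nonempty_subs" using E_ne by (simp add: nonempty_subs_def)

text \<open>Isolated vertices only lower the ratio, so subhypergraphs may be replaced by their edge sets.\<close>

lemma max_psi_attained: "\<exists>B\<in>nonempty_subs. max_psi n p HVE \<le> psi n p B"
proof -
  let ?f = "\<lambda>F. real n powi (- int (card (verts F))) * Q_weight p F / P_weight p F"
  have "max_psi n p HVE \<in> ?f ` nonempty_subhypergraphs HVE"
    unfolding max_psi_def using finite_subhypergraphs spanned_subhypergraph[OF E_in_subs] by (intro Max_in) auto
  then obtain F where F: "F \<in> nonempty_subhypergraphs HVE" "max_psi n p HVE = ?f F" by auto
  note e = subhypergraph_edges[OF F(1)]
  have pos: "0 < wP p (edges F)" "0 < wQ p (edges F)" using wP_pos wQ_pos subsD(1)[OF e(1)] by auto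
  have "?f F = wQ p (edges F) / (wP p (edges F) * real n ^ card (verts F))"
    unfolding ratio_eq by (simp add: wP_def wQ_def P_weight_def Q_weight_def)
  also have "\<dots> \<le> psi n p (edges F)"
    unfolding psi_def using pos n_pos e(2)
    by (intro divide_left_mono mult_left_mono power_increasing mult_pos_pos) auto
  finally show ?thesis using e(1) F(2) by auto
qed

lemma min_copies_le:
  assumes "B \<in> nonempty_subs"
  shows "min_copies n p HVE \<le> real n ^ card (\<Union>B) * wP p B"
proof -
  have "min_copies n p HVE \<le> P_weight p (Hypergraph (\<Union>B) B) * real n ^ card (verts (Hypergraph (\<Union>B) B))"
    unfolding min_copies_def
    by (rule Min_le[OF finite_imageI[OF finite_subhypergraphs] imageI[OF spanned_subhypergraph[OF assms]]])
  then show ?thesis by (simp add: P_weight_def wP_def mult.commute)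
qed

lemma min_copies_ge:
  assumes "\<And>B. B \<in> nonempty_subs \<Longrightarrow> c \<le> real n ^ card (\<Union>B) * wP p B"
  shows "c \<le> min_copies n p HVE"
  unfolding min_copies_def
proof (rule Min.boundedI)
  show "finite ((\<lambda>F. P_weight p F * real n ^ card (verts F)) ` nonempty_subhypergraphs HVE)"
    using finite_subhypergraphs by simp
  show "(\<lambda>F. P_weight p F * real n ^ card (verts F)) ` nonempty_subhypergraphs HVE \<noteq> {}"
    using spanned_subhypergraph[OF E_in_subs] by auto
  fix a assume "a \<in> (\<lambda>F. P_weight p F * real n ^ card (verts F)) ` nonempty_subhypergraphs HVE"
  then obtain F where F: "F \<in> nonempty_subhypergraphs HVE" "a = P_weight p F * real n ^ card (verts F)" by auto
  note e = subhypergraph_edges[OF F(1)]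
  have "c \<le> real n ^ card (\<Union>(edges F)) * wP p (edges F)" by (rule assms[OF e(1)])
  also have "\<dots> \<le> real n ^ card (verts F) * wP p (edges F)"
    using n_pos wP_pos[OF subsD(1)[OF e(1)]] e(2) by (intro mult_right_mono power_increasing) auto
  finally show "c \<le> a" by (simp add: F(2) P_weight_def wP_def mult.commute)
qed

lemma max_psi_pos: "0 < max_psi n p HVE"
proof -
  have "0 < psi n p E" using wP_pos[of E] wQ_pos[of E] n_pos by (simp add: psi_def)
  then show ?thesis using psi_le_max_psi[OF E_in_subs] by simp
qed

lemma edge_cond_eq: "edge_cond n p HVE k = real n ^ k * (1 - p k) + max_psi n p HVE * real n ^ k / (1 - p k)"
  unfolding edge_cond_def by (simp add: power_int_minus field_simps)

lemma edge_cond_pos: "e \<in> E \<Longrightarrow> 0 < edge_cond n p HVE (card e)"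
  unfolding edge_cond_eq using E_p[of e] n_pos max_psi_pos by (intro add_pos_pos) auto

lemma copies_error_facts:
  assumes "copies_error n p E \<le> \<epsilon>"
  shows "B \<in> nonempty_subs \<Longrightarrow> 1 \<le> \<epsilon> * (real n ^ card (\<Union>B) * wP p B)" "1 \<le> \<epsilon> * real n" "1 / sqrt (real n) \<le> \<epsilon>"
proof -
  have pos: "0 < real n ^ card (\<Union>B) * wP p B" if "B \<in> Pow E - {{}}" for B using wP_pos that n_pos by simp
  have s0: "0 \<le> (\<Sum>B\<in>Pow E - {{}}. 1 / (real n ^ card (\<Union>B) * wP p B))"
    using pos by (intro sum_nonneg) (auto intro: less_imp_le)
  then show s: "1 / sqrt (real n) \<le> \<epsilon>" using assms unfolding copies_error_def by simp
  have "1 \<le> sqrt (real n)" using n_pos by simp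
  also have "\<dots> = 1 / sqrt (real n) * real n" using n_pos by (simp add: real_div_sqrt)
  also have "\<dots> \<le> \<epsilon> * real n" using s by (intro mult_right_mono) auto
  finally show "1 \<le> \<epsilon> * real n" .
  assume B: "B \<in> nonempty_subs"
  then have B': "B \<in> Pow E - {{}}" by (simp add: nonempty_subs_def)
  have "1 / (real n ^ card (\<Union>B) * wP p B) \<le> (\<Sum>B\<in>Pow E - {{}}. 1 / (real n ^ card (\<Union>B) * wP p B))"
    by (rule member_le_sum[OF B']) (use pos finite_E in \<open>auto intro: less_imp_le\<close>)
  also have "\<dots> \<le> \<epsilon>"
  proof -
    have "0 \<le> 1 / sqrt (real n)" by simp
    then show ?thesis using assms unfolding copies_error_def by linarith
  qed
  finally show "1 \<le> \<epsilon> * (real n ^ card (\<Union>B) * wP p B)" using pos[OF B'] by (simp add: divide_le_eq)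
qed

lemma few_missing:
  assumes n4: "4 \<le> n" and e: "e \<in> E" and few: "real n ^ card e * (1 - p (card e)) \<le> sqrt (real n)"
  shows "1 - p (card e) \<le> 1 / sqrt (real n)" "1 / 2 \<le> p (card e)"
proof -
  have k1: "1 \<le> card e"
  proof -
    have "e \<noteq> {}" "finite e" using e E_sub finite_V by (auto intro: finite_subset)
    then show ?thesis by (simp add: Suc_le_eq card_gt_0_iff)
  qed
  have q0: "0 < 1 - p (card e)" using E_p[OF e] by simp
  have "real n * (1 - p (card e)) \<le> real n ^ card e * (1 - p (card e))"
    using power_increasing[OF k1, of "real n"] n_pos q0 by (intro mult_right_mono) auto
  then have "real n * (1 - p (card e)) \<le> sqrt (real n)" using few by linarith
  then have "(1 - p (card e)) \<le> sqrt (real n) / real n" using n_pos by (simp add: field_simps)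
  also have "\<dots> = 1 / sqrt (real n)" using n_pos by (simp add: field_simps)
  finally show q: "1 - p (card e) \<le> 1 / sqrt (real n)" .
  have "2 \<le> sqrt (real n)" using n4 by (intro real_le_rsqrt) simp
  then have "1 / sqrt (real n) \<le> 1 / 2" using n_pos by (intro divide_left_mono) auto
  then show "1 / 2 \<le> p (card e)" using q by linarith
qed

section \<open>Both directions for a fixed number of vertices\<close>

abbreviation law :: "real measure" where
  "law \<equiv> distr (measure_pmf (binomial_hypergraph n p)) borel (Z_std HVE n p)"

text \<open>A size \<open>k\<close> is good if \<open>n ^ k * (1 - p k)\<close> is at least \<open>sqrt n\<close> or makes up half of the quantity in the second
  condition. For a bad size of an edge, the other summand makes up the other half, and \<open>n ^ k * (1 - p k) < sqrt n\<close> forces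
  \<open>1 - p k \<le> 1 / sqrt n\<close>.\<close>

lemma char_law_close:
  assumes n4: "4 \<le> n"
  defines "\<epsilon> \<equiv> copies_error n p E + (\<Sum>e\<in>E. 4 / edge_cond n p HVE (card e))"
  shows "cmod (char law t - of_real (exp (- (t\<^sup>2 / 2))))
    \<le> approx_error V E t \<epsilon> + (\<bar>t\<bar> * sqrt (rest_const * \<epsilon>) + t\<^sup>2 * (rest_const * \<epsilon>))"
proof -
  define T where "T k = edge_cond n p HVE k" for k
  define Gd where "Gd = {k. T k / 2 \<le> real n ^ k * (1 - p k) \<or> sqrt (real n) \<le> real n ^ k * (1 - p k)}"
  let ?M = "max_psi n p HVE"
  have T0: "0 < T (card e)" if "e \<in> E" for e unfolding T_def by (rule edge_cond_pos[OF that])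
  have Ts0: "0 \<le> (\<Sum>e\<in>E. 4 / T (card e))" using T0 by (intro sum_nonneg) (auto intro: less_imp_le)
  have ce: "copies_error n p E \<le> \<epsilon>" using Ts0 unfolding \<epsilon>_def T_def by simp
  note cf = copies_error_facts[OF ce]
  have Te: "4 / T (card e) \<le> \<epsilon>" if e: "e \<in> E" for e
  proof -
    have "4 / T (card e) \<le> (\<Sum>e\<in>E. 4 / T (card e))"
      by (rule member_le_sum[OF e]) (use T0 finite_E in \<open>auto intro: less_imp_le\<close>)
    moreover have "0 \<le> copies_error n p E"
      by (rule order_trans[OF _ copies_error_facts(3)[OF order_refl]]) simp
    ultimately show ?thesis unfolding \<epsilon>_def T_def by linarith
  qed
  have e0: "0 < \<epsilon>" using cf(2) n_pos by (smt (verit) mult_nonpos_nonneg of_nat_0_le_iff)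
  obtain B0 where B0: "B0 \<in> nonempty_subs" "?M \<le> psi n p B0" using max_psi_attained by blast
  have good: "1 \<le> \<epsilon> * (real n ^ card e * (1 - p (card e)))" if e: "e \<in> E" "card e \<in> Gd" for e
  proof -
    let ?x = "real n ^ card e * (1 - p (card e))"
    have x0: "0 < ?x" using E_p[OF e(1)] n_pos by simp
    consider "T (card e) / 2 \<le> ?x" | "sqrt (real n) \<le> ?x" using e(2) by (auto simp: Gd_def)
    then have "1 / ?x \<le> \<epsilon>"
    proof cases
      case 1
      then have "1 / ?x \<le> 1 / (T (card e) / 2)" using T0[OF e(1)] by (intro divide_left_mono) auto
      also have "\<dots> \<le> 4 / T (card e)" using T0[OF e(1)] by (simp add: field_simps)
      finally show ?thesis using Te[OF e(1)] by simp
    next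
      case 2
      then have "1 / ?x \<le> 1 / sqrt (real n)" using n_pos x0 by (intro divide_left_mono) auto
      then show ?thesis using cf(3) by simp
    qed
    then show ?thesis using x0 by (simp add: divide_le_eq)
  qed
  have bad: "1 - p (card e) \<le> \<epsilon> \<and> 1 / 2 \<le> p (card e)" if e: "e \<in> E" "card e \<notin> Gd" for e
  proof -
    have "real n ^ card e * (1 - p (card e)) \<le> sqrt (real n)" using e(2) by (auto simp: Gd_def)
    from few_missing[OF n4 e(1) this] cf(3) show ?thesis by simp
  qed
  have negl: "psi n p {e} \<le> 2 * \<epsilon> * ?M" if e: "e \<in> E" "card e \<notin> Gd" for e
  proof -
    let ?k = "card e"
    define q where "q = 1 - p ?k"
    have q0: "0 < q" using E_p[OF e(1)] by (simp add: q_def)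
    have N0: "0 < real n ^ ?k" using n_pos by simp
    have "T ?k = real n ^ ?k * q + ?M * real n ^ ?k / q" unfolding T_def edge_cond_eq q_def ..
    moreover have "real n ^ ?k * q < T ?k / 2" using e(2) by (simp add: Gd_def q_def)
    ultimately have "T ?k / 2 \<le> ?M * real n ^ ?k / q" by linarith
    then have "T ?k / 2 * q \<le> ?M * real n ^ ?k" using q0 by (simp add: pos_le_divide_eq)
    then have 1: "q / real n ^ ?k \<le> 2 * ?M / T ?k" using T0[OF e(1)] N0 by (simp add: field_simps)
    have "psi n p {e} = q / (p ?k * real n ^ ?k)" by (simp add: psi_def wP_def wQ_def q_def)
    also have "\<dots> \<le> q / (1 / 2 * real n ^ ?k)"
      using bad[OF e] q0 N0 by (intro divide_left_mono mult_right_mono mult_pos_pos) auto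
    also have "\<dots> = 2 * (q / real n ^ ?k)" by simp
    also have "\<dots> \<le> 2 * (2 * ?M / T ?k)" using 1 by simp
    also have "\<dots> = 4 / T ?k * ?M" by simp
    also have "\<dots> \<le> \<epsilon> * ?M" by (rule mult_right_mono[OF Te[OF e(1)]]) (use max_psi_pos in simp)
    also have "\<dots> \<le> 2 * \<epsilon> * ?M" using e0 max_psi_pos by simp
    finally show ?thesis .
  qed
  show ?thesis
    unfolding char_Z_std approx_error_def
    by (rule forward_bound[OF psi_le_max_psi B0 cf(1,2) good bad negl])
qed

text \<open>Here a size is good if \<open>n ^ k * (1 - p k)\<close> is at least \<open>sqrt n\<close>, so that the size of \<open>e\<close> is bad. The squared modulus of
  the characteristic function of \<open>A + G\<close> at 1 is about \<open>exp (- (v - defect_gain)) * exp (- g)\<close> or larger, where the variances \<open>v\<close> of \<open>A\<close>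
  and \<open>g\<close> of \<open>G\<close> add up to at most 1.\<close>

lemma char_law_lower_bound:
  assumes n4: "4 \<le> n" and e: "e \<in> E" and L: "0 < L" and T: "edge_cond n p HVE (card e) \<le> L" and Ln: "L < sqrt (real n)"
    and eps: "copies_error n p E \<le> 1 / 8"
  defines "\<epsilon> \<equiv> copies_error n p E"
  shows "exp ((- 1 + defect_gain L (card e) - 8 * \<epsilon>) / 2) - approx_error V E 1 \<epsilon> \<le> cmod (char law 1)"
proof -
  define Gd where "Gd = {k. sqrt (real n) \<le> real n ^ k * (1 - p k)}"
  let ?M = "max_psi n p HVE" and ?k = "card e"
  have "copies_error n p E \<le> \<epsilon>" by (simp add: \<epsilon>_def)
  note cf = copies_error_facts[OF this]
  have e0: "0 < \<epsilon>" using cf(2) n_pos by (smt (verit) mult_nonpos_nonneg of_nat_0_le_iff)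
  obtain B0 where B0: "B0 \<in> nonempty_subs" "?M \<le> psi n p B0" using max_psi_attained by blast
  have good: "1 \<le> \<epsilon> * (real n ^ card e * (1 - p (card e)))" if e: "e \<in> E" "card e \<in> Gd" for e
  proof -
    let ?x = "real n ^ card e * (1 - p (card e))"
    have x0: "0 < ?x" using E_p[OF e(1)] n_pos by simp
    have "1 / ?x \<le> 1 / sqrt (real n)" using n_pos x0 e(2) by (intro divide_left_mono) (auto simp: Gd_def)
    then have "1 / ?x \<le> \<epsilon>" using cf(3) by simp
    then show ?thesis using x0 by (simp add: divide_le_eq)
  qed
  have bad: "1 - p (card e) \<le> \<epsilon> \<and> 1 / 2 \<le> p (card e)" if e: "e \<in> E" "card e \<notin> Gd" for e
  proof -
    have "real n ^ card e * (1 - p (card e)) \<le> sqrt (real n)" using e(2) by (auto simp: Gd_def)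
    from few_missing[OF n4 e(1) this] cf(3) show ?thesis by simp
  qed
  define q where "q = 1 - p ?k"
  have q0: "0 < q" using E_p[OF e] by (simp add: q_def)
  have T': "real n ^ ?k * q + ?M * real n ^ ?k / q \<le> L" using T unfolding edge_cond_eq q_def .
  have t1: "0 \<le> real n ^ ?k * q" "0 \<le> ?M * real n ^ ?k / q" using q0 max_psi_pos by auto
  have few: "real n ^ ?k * (1 - p ?k) \<le> L" using T' t1 unfolding q_def by linarith
  have "?M * real n ^ ?k / q \<le> L" using T' t1 by linarith
  then have share: "?M * real n ^ ?k \<le> L * (1 - p ?k)" using q0 by (simp add: pos_divide_le_eq q_def)
  have eGd: "?k \<notin> Gd" using few Ln by (simp add: Gd_def)
  let ?A = "part (single_bad Gd)" and ?G = "part (all_good Gd)"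
  define a where "a = Ex (\<lambda>w. iexp (1 * ?A w))"
  define g where "g = Ex (\<lambda>w. (?G w)\<^sup>2)"
  define v where "v = Ex (\<lambda>w. (?A w)\<^sup>2)"
  define \<delta> where "\<delta> = defect_gain L ?k"
  have vg: "v + g \<le> 1"
  proof -
    have "0 \<le> Ex (\<lambda>w. (part (mixed Gd) w)\<^sup>2)" by (rule Bochner_Integration.integral_nonneg) simp
    then show ?thesis using parts_variance[of Gd] unfolding v_def g_def by linarith
  qed
  have a2: "exp (- (v - \<delta> + 8 * \<epsilon>)) \<le> (cmod a)\<^sup>2"
    unfolding v_def \<delta>_def a_def mult_1_left
    by (rule bad_char_ge[OF psi_le_max_psi bad _ _ e eGd L few share]) (use e0 eps in \<open>auto simp: \<epsilon>_def\<close>)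
  have "exp ((- 1 + \<delta> - 8 * \<epsilon>) / 2) ^ 2 = exp (- 1 + \<delta> - 8 * \<epsilon>)"
    by (simp add: power2_eq_square flip: exp_add)
  also have "\<dots> \<le> exp (- (v - \<delta> + 8 * \<epsilon>)) * exp (- g)" using vg by (simp flip: exp_add)
  also have "\<dots> \<le> (cmod a)\<^sup>2 * exp (- g)" by (rule mult_right_mono[OF a2]) simp
  also have "\<dots> = (cmod a * exp (- (g / 2)))\<^sup>2"
    by (simp add: power_mult_distrib power2_eq_square[of "exp _"] flip: exp_add)
  finally have "exp ((- 1 + \<delta> - 8 * \<epsilon>) / 2) \<le> cmod a * exp (- (g / 2))"
    by (rule power2_le_imp_le) simp
  also have "\<dots> = cmod (a * of_real (exp (- (g * 1\<^sup>2 / 2))))" by (simp add: norm_mult)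
  finally have low: "exp ((- 1 + \<delta> - 8 * \<epsilon>) / 2) \<le> cmod (a * of_real (exp (- (g * 1\<^sup>2 / 2))))" .
  have "cmod (char law 1 - a * of_real (exp (- (g * 1\<^sup>2 / 2)))) \<le> approx_error V E 1 \<epsilon>"
    unfolding char_Z_std approx_error_def a_def g_def
    by (rule gaussian_approx[OF psi_le_max_psi B0 cf(1,2) good bad])
  then show ?thesis
    using low norm_triangle_ineq2[of "a * of_real (exp (- (g * 1\<^sup>2 / 2)))" "char law 1"]
    unfolding \<delta>_def by (simp add: norm_minus_commute)
qed

text \<open>A positive probability only enters through the existence of one outcome in the lower tail.\<close>

lemma max_psi_le_of_cdf_pos:
  assumes "0 < L" and cdf: "0 < cdf law (- L)"
  shows "L\<^sup>2 * max_psi n p HVE \<le> 4 ^ card V"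
proof -
  have "\<exists>w. W w \<le> - L"
  proof (rule ccontr)
    assume "\<nexists>w. W w \<le> - L"
    then have empty: "{w. Z_std HVE n p (graph_of w) \<le> - L} = {}" by (auto simp: Z_std_graph_of)
    have "cdf law (- L) = measure (measure_pmf (binomial_hypergraph n p)) {G. Z_std HVE n p G \<le> - L}"
      unfolding cdf_def by (subst measure_distr) (auto simp: vimage_def)
    also have "\<dots> = measure (measure_pmf space_pmf) {w. Z_std HVE n p (graph_of w) \<le> - L}"
      unfolding binomial_hypergraph_eq by (simp add: vimage_def)
    also have "\<dots> = 0" unfolding empty by simp
    finally show False using cdf by simp
  qed
  then obtain w where "W w \<le> - L" by blast
  moreover obtain B0 where "B0 \<in> nonempty_subs" "max_psi n p HVE \<le> psi n p B0" using max_psi_attained by blast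
  ultimately show ?thesis using M_small_of_lower_tail[OF assms(1)] by blast
qed

lemma min_copies_large:
  assumes z: "0 < z" and M: "4 ^ card E * z * max_psi n p HVE \<le> 1" and n: "2 ^ card E * z \<le> real n"
  shows "z \<le> min_copies n p HVE"
proof (rule min_copies_ge)
  fix B assume B: "B \<in> nonempty_subs"
  let ?x = "real n ^ card (\<Union>B) * wP p B" and ?M = "max_psi n p HVE"
  have x0: "0 < ?x" using wP_pos[OF subsD(1)[OF B]] n_pos by simp
  consider "1 \<le> 4 ^ card E * ?M * ?x" | "real n \<le> 2 ^ card E * ?x"
    using dense_of_M_small[OF B psi_le_max_psi] by blast
  then show "z \<le> ?x"
  proof cases
    case 1
    have "z * 1 \<le> z * (4 ^ card E * ?M * ?x)" using 1 z by (intro mult_left_mono) auto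
    also have "\<dots> = (4 ^ card E * z * ?M) * ?x" by (simp add: mult_ac)
    also have "\<dots> \<le> 1 * ?x" using M x0 by (intro mult_right_mono) auto
    finally show ?thesis by simp
  next
    case 2
    then have "2 ^ card E * z \<le> 2 ^ card E * ?x" using n by linarith
    then show ?thesis by simp
  qed
qed

end

section \<open>The standard normal distribution function\<close>

lemma isCont_cdf_std_normal: "isCont (cdf std_normal_distribution) x"
proof -
  interpret real_distribution std_normal_distribution by (rule real_dist_normal_dist)
  have "emeasure std_normal_distribution {x} = (\<integral>\<^sup>+y. ennreal (std_normal_density y) * indicator {x} y \<partial>lborel)"
    by (rule emeasure_density) auto
  also have "\<dots> = (\<integral>\<^sup>+(y::real). 0 \<partial>lborel)"
  proof (rule nn_integral_cong_AE)
    have "AE y in lborel. y \<noteq> x" by (rule AE_lborel_singleton)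
    then show "AE y in lborel. ennreal (std_normal_density y) * indicator {x} y = 0" by eventually_elim auto
  qed
  finally have "measure std_normal_distribution {x} = 0" by (simp add: measure_def)
  then show ?thesis using isCont_cdf by simp
qed

lemma cdf_std_normal_pos: "0 < cdf std_normal_distribution x"
proof (rule ccontr)
  interpret real_distribution std_normal_distribution by (rule real_dist_normal_dist)
  assume "\<not> 0 < cdf std_normal_distribution x"
  then have "measure std_normal_distribution {..x} = 0"
    unfolding cdf_def using measure_nonneg[of std_normal_distribution "{..x}"] by linarith
  then have "emeasure std_normal_distribution {..x} = 0" by (simp add: emeasure_eq_measure)
  moreover have "emeasure std_normal_distribution {..x} = (\<integral>\<^sup>+y. ennreal (std_normal_density y) * indicator {..x} y \<partial>lborel)"
    by (rule emeasure_density) auto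
  ultimately have "(\<integral>\<^sup>+y. ennreal (std_normal_density y) * indicator {..x} y \<partial>lborel) = 0" by simp
  then have "AE y in lborel. ennreal (std_normal_density y) * indicator {..x} y = 0"
    by (subst (asm) nn_integral_0_iff_AE) auto
  then have "AE y in lborel. y \<notin> {..x}"
    by eventually_elim (auto simp: indicator_def normal_density_def split: if_splits)
  then have "emeasure lborel {y \<in> space lborel. \<not> y \<notin> {..x}} = 0"
    by (subst (asm) AE_iff_measurable[OF _ refl]) auto
  then have null: "emeasure lborel {..x} = 0" by (simp add: lessThan_def atMost_def)
  have "emeasure lborel {x - 1..x} \<le> emeasure lborel {..x}" by (rule emeasure_mono) auto
  then show False using null by simp
qed

section \<open>The limit theorem\<close>

lemma tendsto_inverse_at_top:
  "filterlim f at_top F \<Longrightarrow> ((\<lambda>x. c / f x) \<longlongrightarrow> 0) F" for f :: "'x \<Rightarrow> real"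
  by (intro tendsto_divide_0[OF tendsto_const] filterlim_at_top_imp_at_infinity)

lemma copies_error_tendsto:
  assumes "\<And>B. B \<in> Pow E - {{}} \<Longrightarrow> filterlim (\<lambda>n. real n ^ card (\<Union>B) * wP (p n) B) at_top sequentially"
  shows "(\<lambda>n. copies_error n (p n) E) \<longlonglongrightarrow> 0"
proof -
  have 1: "(\<lambda>n. 1 / sqrt (real n)) \<longlonglongrightarrow> 0"
    by (intro tendsto_inverse_at_top filterlim_compose[OF sqrt_at_top filterlim_real_sequentially])
  have 2: "(\<lambda>n. \<Sum>B\<in>Pow E - {{}}. 1 / (real n ^ card (\<Union>B) * wP (p n) B)) \<longlonglongrightarrow> 0"
    by (intro tendsto_null_sum tendsto_inverse_at_top assms)
  show ?thesis unfolding copies_error_def using tendsto_add[OF 1 2] by simp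
qed

lemma approx_error_tendsto:
  assumes "\<epsilon> \<longlonglongrightarrow> 0"
  shows "(\<lambda>n. approx_error V E t (\<epsilon> n)) \<longlonglongrightarrow> 0"
proof -
  let ?C = "placement_family.clt_const V E (4 ^ card V)" and ?R = "placement.rest_const V E"
  have "(\<lambda>n. approx_error V E t (\<epsilon> n)) \<longlonglongrightarrow>
      t\<^sup>2 * sqrt (?C * 0) + \<bar>t\<bar> ^ 3 / 2 * (?C * sqrt 0) + \<bar>t\<bar> * sqrt (?R * 0)"
    unfolding approx_error_def by (intro tendsto_intros assms)
  then show ?thesis by simp
qed

context
  fixes V :: "'a set" and E :: "'a set set" and p :: "nat \<Rightarrow> nat \<Rightarrow> real"
  assumes placements: "\<And>n. 2 * card V \<le> n \<Longrightarrow> placement V E n (p n)"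
begin

abbreviation "law_of n \<equiv> distr (measure_pmf (binomial_hypergraph n (p n))) borel (Z_std (Hypergraph V E) n (p n))"

lemma real_distribution_law: "real_distribution (law_of n)"
  by (rule prob_space.real_distribution_distr[OF prob_space_measure_pmf]) simp

lemma eventually_placement: "eventually (\<lambda>n. placement V E n (p n) \<and> 4 \<le> n) sequentially"
  using eventually_ge_at_top[of "max (2 * card V) 4"] by eventually_elim (auto intro: placements)

lemma copies_diverge:
  assumes "filterlim (\<lambda>n. min_copies n (p n) (Hypergraph V E)) at_top sequentially"
    and B: "B \<in> Pow E - {{}}"
  shows "filterlim (\<lambda>n. real n ^ card (\<Union>B) * wP (p n) B) at_top sequentially"
proof (rule filterlim_at_top_mono[OF assms(1)])
  show "eventually (\<lambda>n. min_copies n (p n) (Hypergraph V E) \<le> real n ^ card (\<Union>B) * wP (p n) B) sequentially"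
    using eventually_placement
  proof eventually_elim
    case (elim n)
    then interpret placement V E n "p n" by simp
    show ?case by (rule min_copies_le) (use B in \<open>simp add: nonempty_subs_def\<close>)
  qed
qed

lemma normal_limit_of_conditions:
  assumes A: "filterlim (\<lambda>n. min_copies n (p n) (Hypergraph V E)) at_top sequentially"
    and B: "\<And>e. e \<in> E \<Longrightarrow> filterlim (\<lambda>n. edge_cond n (p n) (Hypergraph V E) (card e)) at_top sequentially"
  shows "weak_conv_m law_of std_normal_distribution"
proof (rule levy_continuity[OF real_distribution_law real_dist_normal_dist])
  fix t :: real
  define \<epsilon> where "\<epsilon> n = copies_error n (p n) E + (\<Sum>e\<in>E. 4 / edge_cond n (p n) (Hypergraph V E) (card e))" for n
  define R where "R = placement.rest_const V E"
  have "(\<lambda>n. copies_error n (p n) E) \<longlonglongrightarrow> 0" by (rule copies_error_tendsto[OF copies_diverge[OF A]])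
  moreover have "(\<lambda>n. \<Sum>e\<in>E. 4 / edge_cond n (p n) (Hypergraph V E) (card e)) \<longlonglongrightarrow> 0"
    by (intro tendsto_null_sum tendsto_inverse_at_top B)
  ultimately have e0: "\<epsilon> \<longlonglongrightarrow> 0" unfolding \<epsilon>_def using tendsto_add by fastforce
  have "(\<lambda>n. \<bar>t\<bar> * sqrt (R * \<epsilon> n) + t\<^sup>2 * (R * \<epsilon> n)) \<longlonglongrightarrow> \<bar>t\<bar> * sqrt (R * 0) + t\<^sup>2 * (R * 0)"
    by (intro tendsto_intros e0)
  then have g0: "(\<lambda>n. approx_error V E t (\<epsilon> n) + (\<bar>t\<bar> * sqrt (R * \<epsilon> n) + t\<^sup>2 * (R * \<epsilon> n))) \<longlonglongrightarrow> 0"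
    using tendsto_add[OF approx_error_tendsto[OF e0, of V E t]] by fastforce
  have "eventually (\<lambda>n. cmod (char (law_of n) t - of_real (exp (- (t\<^sup>2 / 2)))) \<le>
     approx_error V E t (\<epsilon> n) + (\<bar>t\<bar> * sqrt (R * \<epsilon> n) + t\<^sup>2 * (R * \<epsilon> n))) sequentially"
    using eventually_placement
  proof eventually_elim
    case (elim n)
    then interpret placement V E n "p n" by simp
    show ?case unfolding \<epsilon>_def R_def by (rule char_law_close) (use elim in simp)
  qed
  then have "(\<lambda>n. char (law_of n) t - of_real (exp (- (t\<^sup>2 / 2)))) \<longlonglongrightarrow> 0"
    using g0 by (rule Lim_null_comparison)
  then have "(\<lambda>n. char (law_of n) t) \<longlonglongrightarrow> of_real (exp (- (t\<^sup>2 / 2)))" by (rule LIM_zero_cancel)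
  then show "(\<lambda>n. char (law_of n) t) \<longlonglongrightarrow> char std_normal_distribution t"
    by (simp add: char_std_normal_distribution)
qed

lemma min_copies_diverges_of_normal_limit:
  assumes lim: "weak_conv_m law_of std_normal_distribution"
  shows "filterlim (\<lambda>n. min_copies n (p n) (Hypergraph V E)) at_top sequentially"
  unfolding filterlim_at_top_gt[where c = "0 :: real"]
proof (intro allI impI)
  fix z :: real assume z: "0 < z"
  define L where "L = sqrt (4 ^ card V * (4 ^ card E * z))"
  have L: "0 < L" "L\<^sup>2 = 4 ^ card V * (4 ^ card E * z)" using z by (simp_all add: L_def)
  have "(\<lambda>n. cdf (law_of n) (- L)) \<longlonglongrightarrow> cdf std_normal_distribution (- L)"
    using lim isCont_cdf_std_normal by (simp add: weak_conv_m_def weak_conv_def)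
  then have "eventually (\<lambda>n. 0 < cdf (law_of n) (- L)) sequentially"
    using cdf_std_normal_pos by (rule order_tendstoD(1))
  moreover have "eventually (\<lambda>n. 2 ^ card E * z \<le> real n) sequentially"
    using filterlim_real_sequentially unfolding filterlim_at_top by blast
  ultimately show "eventually (\<lambda>n. z \<le> min_copies n (p n) (Hypergraph V E)) sequentially"
    using eventually_placement
  proof eventually_elim
    case (elim n)
    then interpret placement V E n "p n" by simp
    have "L\<^sup>2 * max_psi n (p n) HVE \<le> 4 ^ card V"
      by (rule max_psi_le_of_cdf_pos[OF L(1)]) (use elim in simp)
    then have "4 ^ card V * (4 ^ card E * z * max_psi n (p n) HVE) \<le> 4 ^ card V * 1"
      unfolding L(2) by (simp add: mult_ac)
    then have "4 ^ card E * z * max_psi n (p n) HVE \<le> 1" by (rule mult_left_le_imp_le) simp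
    then show ?case using z elim by (intro min_copies_large) auto
  qed
qed

text \<open>If the second condition fails for \<open>e\<close>, then \<open>char_law_lower_bound\<close> applies for infinitely many \<open>n\<close> with the same \<open>L\<close>;
  its left-hand side converges to a number larger than \<open>exp (- 1 / 2)\<close>.\<close>

lemma edge_cond_diverges_of_normal_limit:
  assumes lim: "weak_conv_m law_of std_normal_distribution" and e: "e \<in> E"
  shows "filterlim (\<lambda>n. edge_cond n (p n) (Hypergraph V E) (card e)) at_top sequentially"
proof (rule ccontr)
  assume "\<not> ?thesis"
  then obtain L0 where L0: "\<not> eventually (\<lambda>n. L0 \<le> edge_cond n (p n) (Hypergraph V E) (card e)) sequentially"
    unfolding filterlim_at_top by blast
  define L where "L = max L0 1"
  have L: "0 < L" by (simp add: L_def)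
  define \<epsilon> where "\<epsilon> n = copies_error n (p n) E" for n
  define \<delta> where "\<delta> = placement.defect_gain V E L (card e)"
  have \<delta>: "0 < \<delta>"
  proof -
    interpret placement V E "2 * card V" "p (2 * card V)" by (rule placements) simp
    have "e \<noteq> {}" "finite e" using e E_sub finite_V by (auto intro: finite_subset)
    then show ?thesis unfolding \<delta>_def by (intro defect_gain_pos L) (simp add: Suc_le_eq card_gt_0_iff)
  qed
  have e0: "\<epsilon> \<longlonglongrightarrow> 0" unfolding \<epsilon>_def
    by (rule copies_error_tendsto[OF copies_diverge[OF min_copies_diverges_of_normal_limit[OF lim]]])
  define low where "low n = exp ((- 1 + \<delta> - 8 * \<epsilon> n) / 2) - approx_error V E 1 (\<epsilon> n)" for n
  have "low \<longlonglongrightarrow> exp ((- 1 + \<delta> - 8 * 0) / 2) - 0"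
    unfolding low_def by (intro tendsto_intros e0 approx_error_tendsto[OF e0]) simp
  moreover have "(\<lambda>n. cmod (char (law_of n) 1)) \<longlonglongrightarrow> cmod (char std_normal_distribution 1)"
    by (intro tendsto_norm levy_continuity1 real_distribution_law real_dist_normal_dist lim)
  ultimately have diff: "(\<lambda>n. low n - cmod (char (law_of n) 1)) \<longlonglongrightarrow>
      exp ((- 1 + \<delta> - 8 * 0) / 2) - 0 - cmod (char std_normal_distribution 1)"
    by (rule tendsto_diff)
  have "cmod (char std_normal_distribution 1) = exp (- 1 / 2)"
    by (simp add: char_std_normal_distribution)
  also have "\<dots> < exp ((- 1 + \<delta> - 8 * 0) / 2)" using \<delta> by simp
  finally have "0 < exp ((- 1 + \<delta> - 8 * 0) / 2) - 0 - cmod (char std_normal_distribution 1)" by simp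
  with diff have "eventually (\<lambda>n. 0 < low n - cmod (char (law_of n) 1)) sequentially"
    by (rule order_tendstoD(1))
  moreover have "eventually (\<lambda>n. \<epsilon> n < 1 / 8) sequentially"
    by (rule order_tendstoD(2)[OF e0]) simp
  moreover have "eventually (\<lambda>n. L < sqrt (real n)) sequentially"
    using filterlim_compose[OF sqrt_at_top filterlim_real_sequentially] unfolding filterlim_at_top_dense by blast
  ultimately have "eventually (\<lambda>n. L0 \<le> edge_cond n (p n) (Hypergraph V E) (card e)) sequentially"
    using eventually_placement
  proof eventually_elim
    case (elim n)
    then interpret placement V E n "p n" by simp
    show ?case
    proof (rule ccontr)
      assume "\<not> L0 \<le> edge_cond n (p n) HVE (card e)"
      then have T: "edge_cond n (p n) HVE (card e) \<le> L" by (simp add: L_def)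
      have "low n \<le> cmod (char law 1)"
        unfolding low_def \<epsilon>_def \<delta>_def
        by (rule char_law_lower_bound[OF _ e L T]) (use elim in \<open>simp_all add: \<epsilon>_def\<close>)
      then show False using elim by simp
    qed
  qed
  then show False using L0 by simp
qed

end

theorem theorem3p2:
  fixes H :: "'a hypergraph" and p :: "nat \<Rightarrow> nat \<Rightarrow> real"
  assumes "wf_hypergraph H" and "card (edges H) \<ge> 1"
    and "\<And>n k. 1 \<le> k \<Longrightarrow> k \<le> n \<Longrightarrow> p n k \<in> {0<..<1}"
  shows "weak_conv_m
           (\<lambda>n. distr (measure_pmf (binomial_hypergraph n (p n))) borel (Z_std H n (p n)))
           std_normal_distribution
     \<longleftrightarrow>
       filterlim (\<lambda>n. MIN F\<in>nonempty_subhypergraphs H.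
           P_weight (p n) F * real n ^ card (verts F)) at_top sequentially
       \<and> (\<forall>e\<in>edges H.
            filterlim (\<lambda>n.
                real n ^ card e * (1 - p n (card e))
                + (MAX F\<in>nonempty_subhypergraphs H.
                     real n powi (- int (card (verts F))) * Q_weight (p n) F / P_weight (p n) F)
                  / (real n powi (- int (card e)) * (1 - p n (card e))))
              at_top sequentially)"
proof -
  obtain V E where H: "H = Hypergraph V E" by (cases H)
  have pl: "placement V E n (p n)" if "2 * card V \<le> n" for n
  proof
    show "finite V" "E \<subseteq> Pow V - {{}}" using assms(1) by (auto simp: H wf_hypergraph_def)
    show "E \<noteq> {}" using assms(2) by (auto simp: H)
    show "2 * card V \<le> n" by (rule that)
    show "0 < p n k \<and> p n k < 1" if "1 \<le> k" "k \<le> n" for k using assms(3)[OF that] by simp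
  qed
  have "weak_conv_m (\<lambda>n. distr (measure_pmf (binomial_hypergraph n (p n))) borel (Z_std H n (p n))) std_normal_distribution
     \<longleftrightarrow> filterlim (\<lambda>n. min_copies n (p n) H) at_top sequentially
       \<and> (\<forall>e\<in>edges H. filterlim (\<lambda>n. edge_cond n (p n) H (card e)) at_top sequentially)"
    unfolding H hypergraph.sel
    using normal_limit_of_conditions[of V E p, OF pl] min_copies_diverges_of_normal_limit[of V E p, OF pl]
      edge_cond_diverges_of_normal_limit[of V E p, OF pl] by blast
  then show ?thesis unfolding min_copies_def edge_cond_def max_psi_def .
qed

end
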